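(* Let $\mathrm{L}$ and $\mathbf{D}$ be a spline-admissible pair of order $r>d/2$ on $\mathbb{R}^d$, and let $0\le\tilde r\le r$. Let $\Omega=[-\pi,\pi]^d$. If the functions $$|\det(\mathbf{D}^T)|^{-2j\tilde r/d}\;\frac{1-m_j(\bm{\omega})}{1+|\widehat L(\bm{\omega})|^2}$$ are bounded in $L_\infty\big((\mathbf{D}^T)^{-j}\Omega\big)$ by a constant independent of $j\in\mathbb{Z}$, then the multiresolution spaces $V_j$ provide approximation order $\tilde r$; that is, there is a constant $C>0$ such that $$E(f,V_j)\le C\,|\det(\mathbf{D})|^{j\tilde r/d}\,\|f\|_{W_2^{\mathrm{L}}}$$ for every $f\in W_2^{\mathrm{L}}(\mathbb{R}^d)$ and every $j\in\mathbb{Z}$.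
   Context: Conventions: $\widehat f(\bm{\omega})=\int_{\mathbb{R}^d}f(\bm{x})e^{-i\bm{x}\cdot\bm{\omega}}\,d\bm{x}$, $g^\vee$ is the inverse Fourier transform. A Fourier multiplier operator $\mathrm{L}$ with measurable symbol $\widehat L$ acts by $\mathrm{L}f=(\widehat L\,\widehat f)^\vee$. It is admissible if $\widehat L=f/g$ with $f,g$ continuous functions on $\mathbb{R}^d$ such that the set of zeros of $fg$ has Lebesgue measure zero and the zero sets of $f$ and $g$ are disjoint. An operator $\mathrm{L}$ and an integer $d\times d$ matrix $\mathbf{D}$ are a spline-admissible pair of order $r>d/2$ if: (1) $\mathrm{L}$ is an admissible Fourier multiplier operator; (2) $\mathbf{D}=a\mathbf{R}$ with $\mathbf{R}$ orthogonal and $a>1$; (3) there is $C_{\mathrm{L}}>0$ with $C_{\mathrm{L}}(1+|\widehat L(\bm{\omega})|^2)\ge|\bm{\omega}|^{2r}$ for almost every $\bm{\omega}$; (4) for every $j\in\mathbb{Z}$ there is a periodic function $\widehat L_{\mathrm{d},j}(\bm{\omega})=\sum_{\bm{k}\in\mathbb{Z}^d}p_j[\bm{k}]e^{i\bm{\omega}\cdot\mathbf{D}^j\bm{k}}$ with $p_j\in\ell_1(\mathbb{Z}^d)$ such that $\widehat\varphi_j:=\widehat L_{\mathrm{d},j}\widehat L^{-1}$ satisfies, for some real constants $A_j,B_j$ and almost every $\bm{\omega}$, $$0<A_j\le\sum_{\bm{k}\in\mathbb{Z}^d}|\widehat\varphi_j(\bm{\omega}+2\pi(\mathbf{D}^T)^{-j}\bm{k})|^2\le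 B_j<\infty.$$ The functions $\varphi_j:=(\widehat\varphi_j)^\vee\in L_2(\mathbb{R}^d)$ are the generalized B-splines for $\mathrm{L}$, and $V_j=\{\sum_{\bm{k}\in\mathbb{Z}^d}c[\bm{k}]\varphi_j(\cdot-\mathbf{D}^j\bm{k}):c\in\ell_2(\mathbb{Z}^d)\}$, a closed subspace of $L_2(\mathbb{R}^d)$. Further notation: $$m_j(\bm{\omega})=\frac{|\widehat L(\bm{\omega})|^{-2}}{\sum_{\bm{k}\in\mathbb{Z}^d}|\widehat L(\bm{\omega}+2\pi(\mathbf{D}^T)^{-j}\bm{k})|^{-2}},$$ $\|f\|_{W_2^{\mathrm{L}}}=\big(\int_{\mathbb{R}^d}|\widehat f(\bm{\omega})|^2(1+|\widehat L(\bm{\omega})|^2)\,d\bm{\omega}\big)^{1/2}$, $W_2^{\mathrm{L}}(\mathbb{R}^d)=\{f\in L_2(\mathbb{R}^d):\|f\|_{W_2^{\mathrm{L}}}<\infty\}$, and for a closed subspace $X\subseteq L_2(\mathbb{R}^d)$, $E(f,X)=\min_{s\in X}\|f-s\|_{L_2(\mathbb{R}^d)}$. *)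

theory Defs
  imports "HOL-Analysis.Analysis"
begin

section \<open>Square-integrable functions\<close>

text \<open>
  Elements of \<open>L\<^sub>2(\<real>\<^sup>d)\<close>, where \<open>d = CARD('n)\<close>, are represented by Borel functions, and every
  almost-everywhere class of Lebesgue measurable functions has such a representative. All notions
  below are insensitive to changes on null sets.
\<close>

definition L2 :: "(real^'n \<Rightarrow> complex) set" where
  "L2 = {f. f \<in> borel_measurable lborel \<and> integrable lborel (\<lambda>x. (cmod (f x))\<^sup>2)}"

definition L2_norm :: "(real^'n \<Rightarrow> complex) \<Rightarrow> real" where
  "L2_norm f = sqrt (LINT x|lborel. (cmod (f x))\<^sup>2)"

text \<open>
  Convergence in the \<open>L\<^sub>2\<close> metric. The extended integral is used so that a difference which is not
  square-integrable counts as infinitely large, not as zero.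
\<close>

definition L2_tendsto ::
  "('i \<Rightarrow> real^'n \<Rightarrow> complex) \<Rightarrow> (real^'n \<Rightarrow> complex) \<Rightarrow> 'i filter \<Rightarrow> bool" where
  "L2_tendsto u f F \<longleftrightarrow>
     ((\<lambda>i. \<integral>\<^sup>+x. ennreal ((cmod (u i x - f x))\<^sup>2) \<partial>lborel) \<longlongrightarrow> 0) F"

section \<open>The Fourier transform on \<open>L\<^sub>2\<close>\<close>

text \<open>
  For \<open>f\<close> in \<open>L\<^sub>2\<close> the defining integral need not converge, and the transform is the \<open>L\<^sub>2\<close> limit of
  the (absolutely convergent) integrals over balls of radius \<open>R\<close>, as \<open>R\<close> tends to infinity. It is
  determined up to a null set. The inverse transform is obtained in the same way.
\<close>

definition fourier :: "(real^'n \<Rightarrow> complex) \<Rightarrow> real^'n \<Rightarrow> complex" where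
  "fourier f = (SOME F. F \<in> L2 \<and>
     L2_tendsto (\<lambda>R \<omega>. LINT x:cball 0 R|lborel. f x * cis (- (x \<bullet> \<omega>))) F at_top)"

definition inv_fourier :: "(real^'n \<Rightarrow> complex) \<Rightarrow> real^'n \<Rightarrow> complex" where
  "inv_fourier g = (SOME f. f \<in> L2 \<and>
     L2_tendsto (\<lambda>R x. of_real (1 / (2 * pi) ^ CARD('n)) *
        (LINT \<omega>:cball 0 R|lborel. g \<omega> * cis (x \<bullet> \<omega>))) f at_top)"

section \<open>Lattices generated by matrix powers\<close>

text \<open>The product \<open>*\<close> on \<open>real^'n^'n\<close> is componentwise, so \<open>^\<close> is not the matrix power.\<close>

definition matrix_zpow :: "real^'n^'n \<Rightarrow> int \<Rightarrow> real^'n^'n" where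
  "matrix_zpow A j =
     (if 0 \<le> j then (((**) A) ^^ nat j) (mat 1) else (((**) (matrix_inv A)) ^^ nat (- j)) (mat 1))"

definition real_vec :: "int^'n \<Rightarrow> real^'n" where
  "real_vec k = (\<chi> i. real_of_int (k $ i))"

definition lattice_pt :: "real^'n^'n \<Rightarrow> int \<Rightarrow> int^'n \<Rightarrow> real^'n" where
  "lattice_pt D j k = matrix_zpow D j *v real_vec k"

definition dual_lattice_pt :: "real^'n^'n \<Rightarrow> int \<Rightarrow> int^'n \<Rightarrow> real^'n" where
  "dual_lattice_pt D j k = (2 * pi) *\<^sub>R (matrix_zpow (transpose D) (- j) *v real_vec k)"

section \<open>Spline-admissible pairs\<close>

text \<open>A Fourier multiplier operator is represented by its symbol \<open>L\<close>.\<close>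

definition admissible_symbol :: "(real^'n \<Rightarrow> complex) \<Rightarrow> bool" where
  "admissible_symbol L \<longleftrightarrow> L \<in> borel_measurable lborel \<and>
     (\<exists>f g. continuous_on UNIV f \<and> continuous_on UNIV g \<and>
        {\<omega>. f \<omega> * g \<omega> = 0} \<in> null_sets lborel \<and>
        {\<omega>. f \<omega> = 0} \<inter> {\<omega>. g \<omega> = 0} = {} \<and>
        (AE \<omega> in lborel. L \<omega> = f \<omega> / g \<omega>))"

definition discrete_symbol ::
  "real^'n^'n \<Rightarrow> int \<Rightarrow> (int^'n \<Rightarrow> complex) \<Rightarrow> real^'n \<Rightarrow> complex" where
  "discrete_symbol D j p \<omega> = (\<Sum>\<^sub>\<infinity>k. p k * cis (\<omega> \<bullet> lattice_pt D j k))"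

definition bspline_hat ::
  "(real^'n \<Rightarrow> complex) \<Rightarrow> real^'n^'n \<Rightarrow> int \<Rightarrow> (int^'n \<Rightarrow> complex) \<Rightarrow> real^'n \<Rightarrow> complex" where
  "bspline_hat L D j p \<omega> = discrete_symbol D j p \<omega> * inverse (L \<omega>)"

text \<open>
  The real sum in the Riesz bounds is zero when the series diverges, so the lower bound \<open>0 < A\<close>
  enforces convergence.
\<close>

definition localizing_coeffs ::
  "(real^'n \<Rightarrow> complex) \<Rightarrow> real^'n^'n \<Rightarrow> int \<Rightarrow> (int^'n \<Rightarrow> complex) \<Rightarrow> bool" where
  "localizing_coeffs L D j p \<longleftrightarrow> (\<lambda>k. cmod (p k)) summable_on UNIV \<and>
     (\<exists>A B. 0 < A \<and> (AE \<omega> in lborel.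
        A \<le> (\<Sum>\<^sub>\<infinity>k. (cmod (bspline_hat L D j p (\<omega> + dual_lattice_pt D j k)))\<^sup>2) \<and>
        (\<Sum>\<^sub>\<infinity>k. (cmod (bspline_hat L D j p (\<omega> + dual_lattice_pt D j k)))\<^sup>2) \<le> B))"

definition spline_admissible_pair ::
  "(real^'n \<Rightarrow> complex) \<Rightarrow> real^'n^'n \<Rightarrow> real \<Rightarrow> bool" where
  "spline_admissible_pair L D r \<longleftrightarrow>
     r > real CARD('n) / 2 \<and>
     (\<forall>i k. D $ i $ k \<in> \<int>) \<and>
     admissible_symbol L \<and>
     (\<exists>a R. a > 1 \<and> orthogonal_matrix R \<and> D = a *\<^sub>R R) \<and>
     (\<exists>C>0. AE \<omega> in lborel. C * (1 + (cmod (L \<omega>))\<^sup>2) \<ge> norm \<omega> powr (2 * r)) \<and>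
     (\<forall>j. \<exists>p. localizing_coeffs L D j p)"

section \<open>Spline spaces and approximation\<close>

definition bspline ::
  "(real^'n \<Rightarrow> complex) \<Rightarrow> real^'n^'n \<Rightarrow> int \<Rightarrow> (int^'n \<Rightarrow> complex) \<Rightarrow> real^'n \<Rightarrow> complex" where
  "bspline L D j p = inv_fourier (bspline_hat L D j p)"

definition spline_space ::
  "(real^'n \<Rightarrow> complex) \<Rightarrow> real^'n^'n \<Rightarrow> int \<Rightarrow> (int^'n \<Rightarrow> complex) \<Rightarrow> (real^'n \<Rightarrow> complex) set" where
  "spline_space L D j p = {s \<in> L2. \<exists>c. (\<lambda>k. (cmod (c k))\<^sup>2) summable_on UNIV \<and>
     L2_tendsto (\<lambda>K x. \<Sum>k\<in>K. c k * bspline L D j p (x - lattice_pt D j k)) s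
       (finite_subsets_at_top UNIV)}"

text \<open>
  For a spline-admissible pair the periodization converges, and \<open>L\<close> has no zero on the shifted dual
  lattice, for almost every \<open>\<omega>\<close>; the HOL conventions for divergent sums and for the inverse of zero
  matter only on a null set.
\<close>

definition m_ratio :: "(real^'n \<Rightarrow> complex) \<Rightarrow> real^'n^'n \<Rightarrow> int \<Rightarrow> real^'n \<Rightarrow> real" where
  "m_ratio L D j \<omega> = inverse ((cmod (L \<omega>))\<^sup>2) /
     (\<Sum>\<^sub>\<infinity>k. inverse ((cmod (L (\<omega> + dual_lattice_pt D j k)))\<^sup>2))"

definition sobolev_norm :: "(real^'n \<Rightarrow> complex) \<Rightarrow> (real^'n \<Rightarrow> complex) \<Rightarrow> real" where
  "sobolev_norm L f = sqrt (LINT \<omega>|lborel. (cmod (fourier f \<omega>))\<^sup>2 * (1 + (cmod (L \<omega>))\<^sup>2))"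

definition sobolev_space :: "(real^'n \<Rightarrow> complex) \<Rightarrow> (real^'n \<Rightarrow> complex) set" where
  "sobolev_space L = {f \<in> L2.
     integrable lborel (\<lambda>\<omega>. (cmod (fourier f \<omega>))\<^sup>2 * (1 + (cmod (L \<omega>))\<^sup>2))}"

text \<open>For a closed subspace \<open>X\<close> of \<open>L\<^sub>2\<close> the infimum is attained.\<close>

definition approx_error :: "(real^'n \<Rightarrow> complex) \<Rightarrow> (real^'n \<Rightarrow> complex) set \<Rightarrow> real" where
  "approx_error f X = (INF s\<in>X. L2_norm (\<lambda>x. f x - s x))"

end

theory Submission
  imports Defs
begin

text \<open>
  \<^bold>\<open>Idea of the proof.\<close> On the Fourier side a spline in \<open>V\<^sub>j\<close> has the form \<open>T \<phi>'\<^sub>j\<close>, where \<open>\<phi>'\<^sub>j\<close> is the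
  transform of the B-spline and \<open>T\<close> is periodic with respect to the dual lattice \<open>2 \<pi> B \<int>\<^sup>n\<close>,
  \<open>B = (D\<^sup>T)\<^sup>-\<^sup>j\<close>. Approximation from \<open>V\<^sub>j\<close> therefore decouples over the fibres \<open>\<omega> + 2 \<pi> B \<int>\<^sup>n\<close>: on
  each of them one approximates the sequence of values of the transform \<open>F\<close> of \<open>f\<close> by multiples of the
  sequence of values of \<open>\<phi>'\<^sub>j\<close>. Since \<open>\<phi>'\<^sub>j\<close> is a periodic factor times \<open>1 / L\<close>, the periodic factor
  cancels from all ratios on a fibre, and \<open>m\<^sub>j(\<omega>)\<close> is the share of the squared norm of the fibre of \<open>\<phi>'\<^sub>j\<close>
  that sits at \<open>\<omega>\<close>.

  Split \<open>F = F\<^sub>1 + F\<^sub>2\<close>, where \<open>F\<^sub>1\<close> is the part of \<open>F\<close> in the fundamental cell \<open>B (-\<pi>, \<pi>]\<^sup>n\<close>. On each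
  fibre \<open>F\<^sub>1\<close> has at most one nonzero entry, so its squared distance to the multiples of \<open>\<phi>'\<^sub>j\<close> is exactly
  \<open>|F(\<omega>)|\<^sup>2 (1 - m\<^sub>j(\<omega>))\<close>, which the hypothesis bounds by a multiple of
  \<open>|det D|\<^sup>2\<^sup>j\<^sup>r\<^sup>'\<^sup>/\<^sup>n |F|\<^sup>2 (1 + |L|\<^sup>2)\<close>. The part \<open>F\<^sub>2\<close> is not approximated at all: outside the cell
  \<open>|\<omega>|\<close> is large, and the growth of \<open>L\<close> bounds \<open>|F\<^sub>2|\<^sup>2\<close> by the same kind of weight
  (\<open>weight_outside_cell\<close>). The projection coefficient is square-integrable over the cell but not a
  trigonometric polynomial; because of the upper Riesz bound it may be replaced by one with arbitrarily
  small loss (\<open>trig_poly_near_fibre_projection\<close>), so finite combinations of translates of the B-spline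
  are enough.

  \<^bold>\<open>Supporting theory.\<close> Passing to the Fourier side requires Plancherel's theorem and the
  inversion theorem on \<open>L\<^sub>2(\<real>\<^sup>n)\<close>, and all of it is derived from Fourier series. The trigonometric
  polynomials are dense in \<open>L\<^sub>2\<close> of the cell (\<open>trig_polys_dense\<close>, from the Stone-Weierstrass theorem on
  the torus), which gives \<open>Parseval\<close>. For \<open>g\<close> supported in the cell, Parseval's identity for the
  modulations of \<open>g\<close> says that the sum of \<open>|g'(\<tau> + k)|\<^sup>2\<close> over \<open>k\<close>, where \<open>g'\<close> is the transform of \<open>g\<close>,
  does not depend on \<open>\<tau>\<close>; integrating over \<open>\<tau>\<close> yields Plancherel's identity (\<open>Plancherel_bounded\<close>).
  Truncation and completeness extend the transform to \<open>L\<^sub>2\<close> (\<open>fourier_L2\<close>, \<open>inv_fourier_L2\<close>), and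
  \<open>Fourier_inversion\<close> follows by expanding the square of the truncated inversion error. What the
  main argument takes from this is \<open>energy_spline_error_le\<close>.
\<close>

section \<open>Energies\<close>

text \<open>Squared \<open>L\<^sub>2\<close> norms are taken in the extended reals, so that estimates can be chained without
  integrability conditions.\<close>

definition energy :: "'a measure \<Rightarrow> ('a \<Rightarrow> complex) \<Rightarrow> ennreal" where
  "energy M f = (\<integral>\<^sup>+x. ennreal ((cmod (f x))^2) \<partial>M)"

lemma cmod_add_square_le: "(cmod (a + b))^2 \<le> 2 * (cmod a)^2 + 2 * (cmod b)^2"
proof -
  have "(cmod (a + b))^2 \<le> (cmod a + cmod b)^2"
    by (intro power_mono norm_triangle_ineq) auto
  also have "\<dots> \<le> 2 * (cmod a)^2 + 2 * (cmod b)^2"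
    using sum_squares_bound[of "cmod a" "cmod b"] by (simp add: power2_sum)
  finally show ?thesis .
qed

lemma energy_add_le:
  assumes [measurable]: "f \<in> borel_measurable M" "g \<in> borel_measurable M"
  shows "energy M (\<lambda>x. f x + g x) \<le> 2 * energy M f + 2 * energy M g"
proof -
  have "energy M (\<lambda>x. f x + g x)
    \<le> (\<integral>\<^sup>+x. 2 * ennreal ((cmod (f x))^2) + 2 * ennreal ((cmod (g x))^2) \<partial>M)"
    unfolding energy_def
  proof (rule nn_integral_mono)
    fix x
    have "ennreal ((cmod (f x + g x))^2) \<le> ennreal (2 * (cmod (f x))^2 + 2 * (cmod (g x))^2)"
      by (intro ennreal_leI cmod_add_square_le)
    then show "ennreal ((cmod (f x + g x))^2)
      \<le> 2 * ennreal ((cmod (f x))^2) + 2 * ennreal ((cmod (g x))^2)"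
      by (simp add: ennreal_plus ennreal_mult)
  qed
  also have "\<dots> = 2 * energy M f + 2 * energy M g"
    unfolding energy_def by (subst nn_integral_add) (auto simp: nn_integral_cmult)
  finally show ?thesis .
qed

lemma energy_minus_commute: "energy M (\<lambda>x. f x - g x) = energy M (\<lambda>x. g x - f x)"
  by (simp add: energy_def norm_minus_commute)

lemma energy_diff_le:
  assumes [measurable]: "f \<in> borel_measurable M" "g \<in> borel_measurable M" "h \<in> borel_measurable M"
  shows "energy M (\<lambda>x. f x - h x) \<le> 2 * energy M (\<lambda>x. f x - g x) + 2 * energy M (\<lambda>x. g x - h x)"
  using energy_add_le[of "\<lambda>x. f x - g x" M "\<lambda>x. g x - h x"] by simp

lemma energy_cmult:
  assumes [measurable]: "f \<in> borel_measurable M"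
  shows "energy M (\<lambda>x. c * f x) = ennreal ((cmod c)^2) * energy M f"
  by (simp add: energy_def norm_mult power_mult_distrib ennreal_mult nn_integral_cmult)

lemma energy_cong_AE: "AE x in M. f x = g x \<Longrightarrow> energy M f = energy M g"
  unfolding energy_def by (intro nn_integral_cong_AE) auto

lemma energy_finite_integrable:
  assumes "f \<in> borel_measurable M"
  shows "energy M f < top \<longleftrightarrow> integrable M (\<lambda>x. (cmod (f x))^2)"
  using assms by (simp add: energy_def integrable_iff_bounded)

lemma energy_eq_integral:
  assumes "integrable M (\<lambda>x. (cmod (f x))^2)"
  shows "energy M f = ennreal (LINT x|M. (cmod (f x))^2)"
  unfolding energy_def by (intro nn_integral_eq_integral assms) auto

lemma L2_iff: "f \<in> L2 \<longleftrightarrow> f \<in> borel_measurable lborel \<and> energy lborel f < top"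
  using energy_finite_integrable[of f lborel] by (auto simp: L2_def)

lemma L2_norm_square: "f \<in> L2 \<Longrightarrow> ennreal ((L2_norm f)^2) = energy lborel f"
  by (simp add: L2_norm_def L2_def energy_eq_integral)

text \<open>Bounds along a sequence pass to its almost everywhere limit; this replaces norm convergence where the
  limit is only known pointwise.\<close>

lemma energy_Fatou:
  assumes [measurable]: "h \<in> borel_measurable M" "\<And>i::nat. u i \<in> borel_measurable M"
    and lim: "AE x in M. (\<lambda>i. u i x) \<longlonglongrightarrow> f x"
    and le: "\<And>i. i \<ge> k \<Longrightarrow> energy M (\<lambda>x. h x - u i x) \<le> b"
  shows "energy M (\<lambda>x. h x - f x) \<le> b"
proof -
  have "energy M (\<lambda>x. h x - f x) = (\<integral>\<^sup>+x. liminf (\<lambda>i. ennreal ((cmod (h x - u i x))^2)) \<partial>M)"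
    unfolding energy_def
  proof (rule nn_integral_cong_AE)
    show "AE x in M. ennreal ((cmod (h x - f x))^2) = liminf (\<lambda>i. ennreal ((cmod (h x - u i x))^2))"
      using lim
    proof eventually_elim
      fix x assume "(\<lambda>i. u i x) \<longlonglongrightarrow> f x"
      then have "(\<lambda>i. ennreal ((cmod (h x - u i x))^2)) \<longlonglongrightarrow> ennreal ((cmod (h x - f x))^2)"
        by (intro tendsto_intros)
      then show "ennreal ((cmod (h x - f x))^2) = liminf (\<lambda>i. ennreal ((cmod (h x - u i x))^2))"
        by (intro lim_imp_Liminf[symmetric]) auto
    qed
  qed
  also have "\<dots> \<le> liminf (\<lambda>i. energy M (\<lambda>x. h x - u i x))"
    unfolding energy_def by (rule nn_integral_liminf) measurable
  also have "\<dots> \<le> b"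
    by (rule Liminf_le) (auto simp: le eventually_sequentially intro!: exI[of _ k])
  finally show ?thesis .
qed

text \<open>The weighted sum \<open>\<Sum>i. 2\<^sup>i |u\<^sub>i\<^sub>+\<^sub>1 - u\<^sub>i|\<^sup>2\<close> has a finite integral, so almost everywhere it is finite and
  the increments decay geometrically.\<close>

lemma fast_Cauchy_AE_convergent:
  fixes u :: "nat \<Rightarrow> 'a \<Rightarrow> complex"
  assumes [measurable]: "\<And>i. u i \<in> borel_measurable M"
    and le: "\<And>i. energy M (\<lambda>x. u (Suc i) x - u i x) \<le> ennreal (c * (1/4)^i)" and "c \<ge> 0"
  shows "\<exists>f\<in>borel_measurable M. AE x in M. (\<lambda>i. u i x) \<longlonglongrightarrow> f x"
proof -
  define w where "w x = (\<Sum>i. ennreal (2^i * (cmod (u (Suc i) x - u i x))^2))" for x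
  have [measurable]: "w \<in> borel_measurable M"
    unfolding w_def by measurable
  have "(\<integral>\<^sup>+x. w x \<partial>M) = (\<Sum>i. \<integral>\<^sup>+x. ennreal (2^i * (cmod (u (Suc i) x - u i x))^2) \<partial>M)"
    unfolding w_def by (rule nn_integral_suminf) measurable
  also have "\<dots> = (\<Sum>i. ennreal (2^i) * energy M (\<lambda>x. u (Suc i) x - u i x))"
    unfolding energy_def by (subst nn_integral_cmult[symmetric]) (auto simp: ennreal_mult)
  also have "\<dots> \<le> (\<Sum>i. ennreal (c * (1/2)^i))"
  proof (rule suminf_le)
    fix i
    have "ennreal (2^i) * energy M (\<lambda>x. u (Suc i) x - u i x) \<le> ennreal (2^i) * ennreal (c * (1/4)^i)"
      by (intro mult_left_mono le) auto
    also have "\<dots> = ennreal (c * (1/2)^i)"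
    proof -
      have "(2::real)^i * (1/4)^i = (1/2)^i"
        unfolding power_mult_distrib[symmetric] by simp
      then have "(2::real)^i * (c * (1/4)^i) = c * (1/2)^i"
        by (metis mult.left_commute)
      then show ?thesis
        using \<open>c \<ge> 0\<close> by (subst ennreal_mult[symmetric]) auto
    qed
    finally show "ennreal (2^i) * energy M (\<lambda>x. u (Suc i) x - u i x) \<le> ennreal (c * (1/2)^i)" .
  qed auto
  also have "\<dots> = ennreal (\<Sum>i. c * (1/2)^i)"
    using \<open>c \<ge> 0\<close> by (intro suminf_ennreal2) (auto intro!: summable_mult summable_geometric)
  also have "\<dots> < \<infinity>" by simp
  finally have "AE x in M. w x \<noteq> \<infinity>"
    by (intro nn_integral_PInf_AE) auto
  then have conv: "AE x in M. convergent (\<lambda>i. u i x)"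
  proof eventually_elim
    fix x assume fin: "w x \<noteq> \<infinity>"
    define C where "C = enn2real (w x)"
    have C: "w x = ennreal C" "C \<ge> 0" using fin by (simp_all add: C_def less_top)
    have b: "norm (u (Suc i) x - u i x) \<le> sqrt C * (1 / sqrt 2) ^ i" for i
    proof -
      have "ennreal (2^i * (cmod (u (Suc i) x - u i x))^2) \<le> w x"
      proof -
        have "(\<Sum>i\<in>{i}. ennreal (2^i * (cmod (u (Suc i) x - u i x))^2)) \<le> w x"
          unfolding w_def by (rule sum_le_suminf) (auto intro: summableI)
        then show ?thesis by (simp only: sum.insert sum.empty finite.emptyI empty_iff not_False_eq_True add_0_right)
      qed
      then have "2^i * (cmod (u (Suc i) x - u i x))^2 \<le> C"
        using C by (simp add: ennreal_le_iff)
      then have "(cmod (u (Suc i) x - u i x))^2 \<le> C / 2^i"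
        by (simp add: field_simps)
      then have "cmod (u (Suc i) x - u i x) \<le> sqrt (C / 2^i)"
        by (simp add: real_le_rsqrt)
      then show ?thesis by (simp add: real_sqrt_divide real_sqrt_power power_divide)
    qed
    have "summable (\<lambda>i. sqrt C * (1 / sqrt 2) ^ i)"
      by (intro summable_mult summable_geometric) simp
    then have "summable (\<lambda>i. u (Suc i) x - u i x)"
      by (rule summable_comparison_test') (use b in auto)
    then have "convergent (\<lambda>n. \<Sum>i<n. u (Suc i) x - u i x)"
      by (simp add: summable_iff_convergent)
    then have "convergent (\<lambda>n. u n x - u 0 x)"
      by (simp only: sum_lessThan_telescope[of "\<lambda>i. u i x"])
    then have "convergent (\<lambda>n. u n x - u 0 x + u 0 x)"
      by (rule convergent_add) (rule convergent_const)
    then show "convergent (\<lambda>i. u i x)" by simp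
  qed
  show ?thesis
  proof (intro bexI)
    show "(\<lambda>x. lim (\<lambda>i. u i x)) \<in> borel_measurable M" by measurable
    show "AE x in M. (\<lambda>i. u i x) \<longlonglongrightarrow> lim (\<lambda>i. u i x)"
      using conv by (simp add: convergent_LIMSEQ_iff)
  qed
qed

section \<open>Linear changes of variables and unfolding\<close>

lemma borel_measurable_matrix_vector [measurable]:
  "(\<lambda>x. (A :: real^'n^'m) *v x) \<in> borel_measurable borel"
  by (intro borel_measurable_continuous_onI linear_continuous_on
      linear_conv_bounded_linear[THEN iffD1] matrix_vector_mul_linear)

lemma nn_integral_lborel_translate:
  fixes c :: "'a::euclidean_space"
  assumes "u \<in> borel_measurable borel"
  shows "(\<integral>\<^sup>+x. u (c + x) \<partial>lborel) = (\<integral>\<^sup>+x. u x \<partial>lborel)"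
  using assms by (subst (2) lborel_distr_plus[symmetric, of c]) (simp add: nn_integral_distr)

text \<open>This is the usual argument for the uniqueness of Haar measure: the double integral of
  \<open>f x * g (R x + y)\<close>, where \<open>f\<close> is the indicator of the unit ball, can be evaluated in two ways using
  translations only, because the ball itself is invariant.\<close>

lemma nn_integral_lborel_orthogonal:
  fixes R :: "real^'n^'n" and g :: "real^'n \<Rightarrow> ennreal"
  assumes [measurable]: "g \<in> borel_measurable borel" and R: "orthogonal_matrix R"
  shows "(\<integral>\<^sup>+x. g (R *v x) \<partial>lborel) = (\<integral>\<^sup>+x. g x \<partial>lborel)"
proof -
  define f :: "real^'n \<Rightarrow> ennreal" where "f = indicator (cball 0 1)"
  have [measurable]: "f \<in> borel_measurable borel" unfolding f_def by (intro borel_measurable_indicator) auto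
  have "R *v (transpose R *v y) = y" for y
    using R by (simp only: matrix_vector_mul_assoc orthogonal_matrix_def matrix_vector_mul_lid)
  then have RR: "R *v (y v* R) = y" for y by simp
  have nR: "norm (R *v x) = norm x" for x
  proof -
    have "orthogonal_transformation (\<lambda>x. R *v x)"
      using R by (simp add: orthogonal_transformation_matrix matrix_of_matrix_vector_mul)
    then show ?thesis by (rule orthogonal_transformation_norm)
  qed
  define v where "v = emeasure lborel (cball (0::real^'n) 1)"
  have v: "v \<noteq> 0" "v \<noteq> \<infinity>"
    using content_cball_pos[of 1 "0::real^'n"] emeasure_lborel_cball_finite[of "0::real^'n" 1]
    by (auto simp: v_def measure_def)
  have fv: "(\<integral>\<^sup>+x. f x \<partial>lborel) = v"
    by (simp add: f_def v_def)
  have neg: "R *v (- z) = - (R *v z)" for z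
    by (rule linear_neg) simp
  have "v * (\<integral>\<^sup>+y. g y \<partial>lborel) = (\<integral>\<^sup>+x. f x * (\<integral>\<^sup>+y. g y \<partial>lborel) \<partial>lborel)"
    by (simp add: nn_integral_multc fv)
  also have "\<dots> = (\<integral>\<^sup>+x. f x * (\<integral>\<^sup>+y. g (R *v x + y) \<partial>lborel) \<partial>lborel)"
    by (simp add: nn_integral_lborel_translate)
  also have "\<dots> = (\<integral>\<^sup>+x. (\<integral>\<^sup>+y. f x * g (R *v x + y) \<partial>lborel) \<partial>lborel)"
    by (simp add: nn_integral_cmult)
  also have "\<dots> = (\<integral>\<^sup>+y. (\<integral>\<^sup>+x. f x * g (R *v x + y) \<partial>lborel) \<partial>lborel)"
    by (rule lborel_pair.Fubini') measurable
  also have "\<dots> = (\<integral>\<^sup>+y. (\<integral>\<^sup>+x. f (- (transpose R *v y) + x) * g (R *v x) \<partial>lborel) \<partial>lborel)"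
  proof (rule nn_integral_cong)
    fix y
    show "(\<integral>\<^sup>+x. f x * g (R *v x + y) \<partial>lborel)
      = (\<integral>\<^sup>+x. f (- (transpose R *v y) + x) * g (R *v x) \<partial>lborel)"
      by (subst nn_integral_lborel_translate[of _ "- (transpose R *v y)", symmetric])
        (simp_all add: matrix_vector_mult_diff_distrib RR)
  qed
  also have "\<dots> = (\<integral>\<^sup>+x. (\<integral>\<^sup>+y. f (- (transpose R *v y) + x) * g (R *v x) \<partial>lborel) \<partial>lborel)"
    by (rule lborel_pair.Fubini') measurable
  also have "\<dots> = (\<integral>\<^sup>+x. v * g (R *v x) \<partial>lborel)"
  proof (rule nn_integral_cong)
    fix x
    have "norm (- (transpose R *v y) + x) = norm (R *v x + - y)" for y
      by (subst nR[symmetric]) (simp add: matrix_vector_mult_diff_distrib RR)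
    then have "f (- (transpose R *v y) + x) = indicator (cball (R *v x) 1) y" for y
      by (simp add: f_def indicator_def dist_norm norm_minus_commute[of "y v* R" x])
    then have "(\<integral>\<^sup>+y. f (- (transpose R *v y) + x) * g (R *v x) \<partial>lborel)
      = emeasure lborel (cball (R *v x) 1) * g (R *v x)"
      by (simp add: nn_integral_multc borel_measurable_indicator)
    also have "emeasure lborel (cball (R *v x) 1) = v"
      by (simp add: v_def emeasure_cball)
    finally show "(\<integral>\<^sup>+y. f (- (transpose R *v y) + x) * g (R *v x) \<partial>lborel) = v * g (R *v x)" .
  qed
  also have "\<dots> = v * (\<integral>\<^sup>+x. g (R *v x) \<partial>lborel)"
    by (simp add: nn_integral_cmult)
  finally show ?thesis using v by (simp add: ennreal_mult_cancel_left)
qed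

lemma nn_integral_lborel_scaleR:
  fixes u :: "'a::euclidean_space \<Rightarrow> ennreal"
  assumes [measurable]: "u \<in> borel_measurable borel" and "c > 0"
  shows "(\<integral>\<^sup>+x. u x \<partial>lborel) = ennreal (c ^ DIM('a)) * (\<integral>\<^sup>+x. u (c *\<^sub>R x) \<partial>lborel)"
  using \<open>c > 0\<close>
  by (subst lborel_affine[of c 0]) (auto simp: nn_integral_density nn_integral_distr nn_integral_cmult)

text \<open>All matrices \<open>(D\<^sup>T)\<^sup>-\<^sup>j\<close> are multiples of orthogonal matrices, so every linear change of variables
  below splits into a dilation and a rotation.\<close>

lemma nn_integral_lborel_conformal:
  fixes B R :: "real^'n^'n" and u :: "real^'n \<Rightarrow> ennreal"
  assumes [measurable]: "u \<in> borel_measurable borel"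
    and B: "B = c *\<^sub>R R" "orthogonal_matrix R" "c > 0"
  shows "(\<integral>\<^sup>+x. u x \<partial>lborel) = ennreal (c ^ CARD('n)) * (\<integral>\<^sup>+x. u (B *v x) \<partial>lborel)"
proof -
  have "(\<integral>\<^sup>+x. u (B *v x) \<partial>lborel) = (\<integral>\<^sup>+x. u (c *\<^sub>R x) \<partial>lborel)"
    using B nn_integral_lborel_orthogonal[of "\<lambda>x. u (c *\<^sub>R x)" R]
    by (simp add: scaleR_matrix_vector_assoc)
  then show ?thesis using nn_integral_lborel_scaleR[of u c] B by simp
qed

lemma AE_lborel_conformal:
  fixes B R :: "real^'n^'n"
  assumes B: "B = c *\<^sub>R R" "orthogonal_matrix R" "c > 0" and AE: "AE x in lborel. P x"
  shows "AE x in lborel. P (B *v x)"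
proof -
  from AE obtain N where N: "{x. \<not> P x} \<subseteq> N" "N \<in> null_sets lborel"
    by (auto simp: eventually_ae_filter)
  then have [measurable]: "N \<in> sets borel" and N0: "emeasure lborel N = 0" by (auto dest: null_setsD2)
  have "0 = (\<integral>\<^sup>+x. indicator N x \<partial>lborel)" using N0 by (simp)
  also have "\<dots> = ennreal (c ^ CARD('n)) * (\<integral>\<^sup>+x. indicator N (B *v x) \<partial>lborel)"
    by (rule nn_integral_lborel_conformal[OF _ B]) simp
  finally have "(\<integral>\<^sup>+x. indicator N (B *v x) \<partial>(lborel :: (real^'n) measure)) = 0"
    using zero_less_power[OF B(3), of "CARD('n)"] by (auto simp: ennreal_eq_0_iff)
  then have "AE x in (lborel :: (real^'n) measure). indicator N (B *v x) = (0::ennreal)"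
    by (subst (asm) nn_integral_0_iff_AE) auto
  then show ?thesis
    by eventually_elim (use N in \<open>auto simp: indicator_def split: if_splits\<close>)
qed

text \<open>Half-open, so that the translates by \<open>2 \<pi> \<int>\<^sup>n\<close> tile the space without overlap.\<close>

definition period_cell :: "(real^'n) set" where
  "period_cell = {x. \<forall>i. - pi < x $ i \<and> x $ i \<le> pi}"

text \<open>A density on the whole space, so that functions on \<open>real^'n\<close> need not be restricted.\<close>

definition cell_measure :: "(real^'n) measure" where
  "cell_measure = density lborel (\<lambda>x. ennreal (indicator period_cell x))"

lemma sets_period_cell [measurable]: "period_cell \<in> sets borel"
proof -
  have eq: "period_cell = (\<Inter>i. {x. - pi < x $ i} \<inter> {x. x $ i \<le> pi})" by (auto simp: period_cell_def)
  moreover have "{x::real^'n. - pi < x $ i} \<inter> {x. x $ i \<le> pi} \<in> sets borel" for i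
    by (intro sets.Int borel_open borel_closed open_halfspace_component_gt_cart closed_halfspace_component_le_cart)
  ultimately show ?thesis unfolding eq by (intro sets.countable_INT'') auto
qed

lemma sets_cell_measure [simp, measurable_cong]: "sets cell_measure = sets borel"
  by (simp add: cell_measure_def)

lemma space_cell_measure [simp]: "space cell_measure = UNIV"
  by (simp add: cell_measure_def)

lemma nn_integral_cell_measure:
  "u \<in> borel_measurable borel \<Longrightarrow>
    (\<integral>\<^sup>+x. u x \<partial>cell_measure) = (\<integral>\<^sup>+x. indicator period_cell x * u x \<partial>lborel)"
  by (simp add: cell_measure_def nn_integral_density ennreal_indicator)

lemma AE_cell_measure: "(AE x in cell_measure. P x) \<longleftrightarrow> (AE x in lborel. x \<in> period_cell \<longrightarrow> P x)"
  unfolding cell_measure_def by (subst AE_density) (auto simp: indicator_def elim!: eventually_mono)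

lemma AE_cell_measureI: "(AE x in lborel. P x) \<Longrightarrow> AE x in cell_measure. P x"
  by (simp add: AE_cell_measure eventually_mono)

lemma countable_UNIV_int_vec [simp]: "countable (UNIV :: (int^'n) set)"
  by (rule countableI_type)

text \<open>Componentwise, the index of the translate is the ceiling of \<open>(x\<^sub>i - \<pi>) / (2 \<pi>)\<close>.\<close>

lemma period_cell_unique_translate: "\<exists>!k. x - (2 * pi) *\<^sub>R real_vec k \<in> period_cell"
proof -
  have *: "(- pi < t - 2 * pi * of_int k \<and> t - 2 * pi * of_int k \<le> pi) \<longleftrightarrow> \<lceil>(t - pi) / (2 * pi)\<rceil> = k" for t k
  proof -
    have "(- pi < t - 2 * pi * of_int k) \<longleftrightarrow> real_of_int k - 1 < (t - pi) / (2*pi)"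
      by (simp add: field_simps)
    moreover have "(t - 2 * pi * of_int k \<le> pi) \<longleftrightarrow> (t - pi) / (2*pi) \<le> real_of_int k"
      by (simp add: field_simps)
    ultimately show ?thesis by (auto simp: ceiling_eq_iff)
  qed
  have "x - (2 * pi) *\<^sub>R real_vec k \<in> period_cell \<longleftrightarrow> k = (\<chi> i. \<lceil>(x $ i - pi) / (2 * pi)\<rceil>)" for k
    using *[of "x $ i" "k $ i" for i] by (auto simp: period_cell_def real_vec_def vec_eq_iff)
  then show ?thesis by simp
qed

lemma sum_period_cell_translates:
  fixes x :: "real^'n"
  shows "(\<integral>\<^sup>+k. indicator period_cell (x - (2 * pi) *\<^sub>R real_vec k) \<partial>count_space UNIV) = (1::ennreal)"
    and "(\<integral>\<^sup>+k. indicator period_cell (x + (2 * pi) *\<^sub>R real_vec k) \<partial>count_space UNIV) = (1::ennreal)"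
proof -
  obtain k0 where k0: "\<And>k. x - (2 * pi) *\<^sub>R real_vec k \<in> period_cell \<longleftrightarrow> k = k0"
    using period_cell_unique_translate[of x] by metis
  have neg: "real_vec (- k) = - (real_vec k :: real^'n)" for k
    by (simp add: real_vec_def vec_eq_iff)
  have "indicator period_cell (x - (2 * pi) *\<^sub>R real_vec k) = (indicator {k0} k :: ennreal)"
    and "indicator period_cell (x + (2 * pi) *\<^sub>R real_vec k) = (indicator {- k0} k :: ennreal)" for k
    using k0[of k] k0[of "- k"] by (auto simp: indicator_def neg)
  then show "(\<integral>\<^sup>+k. indicator period_cell (x - (2 * pi) *\<^sub>R real_vec k) \<partial>count_space UNIV) = (1::ennreal)"
    "(\<integral>\<^sup>+k. indicator period_cell (x + (2 * pi) *\<^sub>R real_vec k) \<partial>count_space UNIV) = (1::ennreal)"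
    by simp_all
qed

text \<open>The indicators of the translated cells sum to one; insert this sum, exchange it with the integral, and
  translate each term back to the cell.\<close>

lemma nn_integral_unfold_cell:
  fixes u :: "real^'n \<Rightarrow> ennreal"
  assumes [measurable]: "u \<in> borel_measurable borel"
  shows "(\<integral>\<^sup>+x. u x \<partial>lborel)
    = (\<integral>\<^sup>+x. (\<integral>\<^sup>+k. u (x + (2 * pi) *\<^sub>R real_vec k) \<partial>count_space UNIV) \<partial>cell_measure)"
proof -
  let ?v = "\<lambda>k::int^'n. (2 * pi) *\<^sub>R real_vec k"
  have [measurable]: "(\<lambda>x. \<integral>\<^sup>+k. u (x + ?v k) \<partial>count_space UNIV) \<in> borel_measurable borel"
    by (intro sigma_finite_measure.borel_measurable_nn_integral sigma_finite_measure_count_space_countable)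
       auto
  have "(\<integral>\<^sup>+x. u x \<partial>lborel) = (\<integral>\<^sup>+x. (\<integral>\<^sup>+k. indicator period_cell (x - ?v k) * u x \<partial>count_space UNIV) \<partial>lborel)"
    by (simp add: nn_integral_multc sum_period_cell_translates)
  also have "\<dots> = (\<integral>\<^sup>+k. (\<integral>\<^sup>+x. indicator period_cell (x - ?v k) * u x \<partial>lborel) \<partial>count_space UNIV)"
    by (rule nn_integral_count_space_nn_integral) auto
  also have "\<dots> = (\<integral>\<^sup>+k. (\<integral>\<^sup>+x. indicator period_cell x * u (x + ?v k) \<partial>lborel) \<partial>count_space UNIV)"
  proof (rule nn_integral_cong)
    fix k
    show "(\<integral>\<^sup>+x. indicator period_cell (x - ?v k) * u x \<partial>lborel)
      = (\<integral>\<^sup>+x. indicator period_cell x * u (x + ?v k) \<partial>lborel)"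
      by (subst nn_integral_lborel_translate[of _ "?v k", symmetric]) (auto simp: add.commute)
  qed
  also have "\<dots> = (\<integral>\<^sup>+x. (\<integral>\<^sup>+k. indicator period_cell x * u (x + ?v k) \<partial>count_space UNIV) \<partial>lborel)"
    by (rule nn_integral_count_space_nn_integral[symmetric]) auto
  also have "\<dots> = (\<integral>\<^sup>+x. indicator period_cell x * (\<integral>\<^sup>+k. u (x + ?v k) \<partial>count_space UNIV) \<partial>lborel)"
    by (simp add: nn_integral_cmult)
  also have "\<dots> = (\<integral>\<^sup>+x. (\<integral>\<^sup>+k. u (x + ?v k) \<partial>count_space UNIV) \<partial>cell_measure)"
    by (simp add: nn_integral_cell_measure)
  finally show ?thesis .
qed

lemma nn_integral_cell_conformal_le:
  fixes u :: "real^'n \<Rightarrow> ennreal" and B R :: "real^'n^'n"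
  assumes [measurable]: "u \<in> borel_measurable borel"
    and B: "B = c *\<^sub>R R" "orthogonal_matrix R" "c > 0"
  shows "ennreal (c ^ CARD('n)) * (\<integral>\<^sup>+x. u (B *v x) \<partial>cell_measure) \<le> (\<integral>\<^sup>+x. u x \<partial>lborel)"
  unfolding nn_integral_lborel_conformal[OF assms]
  by (auto simp: nn_integral_cell_measure indicator_def intro!: mult_left_mono nn_integral_mono)

definition dual_shift :: "real^'n^'n \<Rightarrow> int^'n \<Rightarrow> real^'n" where
  "dual_shift B l = (2 * pi) *\<^sub>R (B *v real_vec l)"

lemma add_dual_shift: "B *v x + dual_shift B l = B *v (x + (2 * pi) *\<^sub>R real_vec l)"
  by (simp add: dual_shift_def matrix_vector_right_distrib matrix_vector_mult_scaleR)

lemma dual_shift_0 [simp]: "dual_shift (B :: real^'n^'n) 0 = 0"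
proof -
  have "real_vec 0 = (0 :: real^'n)" by (simp add: real_vec_def vec_eq_iff)
  then show ?thesis by (simp add: dual_shift_def)
qed

lemma nn_integral_unfold_lattice:
  fixes u :: "real^'n \<Rightarrow> ennreal" and B R :: "real^'n^'n"
  assumes [measurable]: "u \<in> borel_measurable borel"
    and B: "B = c *\<^sub>R R" "orthogonal_matrix R" "c > 0"
  shows "(\<integral>\<^sup>+x. u x \<partial>lborel) = ennreal (c ^ CARD('n)) *
    (\<integral>\<^sup>+x. (\<integral>\<^sup>+k. u (B *v x + dual_shift B k) \<partial>count_space UNIV) \<partial>cell_measure)"
proof -
  have "(\<integral>\<^sup>+x. u (B *v x) \<partial>lborel)
    = (\<integral>\<^sup>+x. (\<integral>\<^sup>+k. u (B *v (x + (2 * pi) *\<^sub>R real_vec k)) \<partial>count_space UNIV) \<partial>cell_measure)"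
    by (rule nn_integral_unfold_cell) measurable
  then show ?thesis
    by (subst nn_integral_lborel_conformal[OF _ B])
      (simp_all add: add_dual_shift)
qed

section \<open>Characters and trigonometric polynomials\<close>

definition character :: "int^'n \<Rightarrow> real^'n \<Rightarrow> complex" where
  "character k x = cis (real_vec k \<bullet> x)"

lemma real_vec_simps:
  "real_vec 0 = 0" "real_vec (k + l) = real_vec k + real_vec l" "real_vec (- k) = - real_vec k"
  "real_vec (k - l) = real_vec k - real_vec l"
  by (simp_all add: real_vec_def vec_eq_iff)

lemma real_vec_eq_0_iff: "real_vec k = 0 \<longleftrightarrow> k = 0"
  by (auto simp: real_vec_def vec_eq_iff)

lemma character_0 [simp]: "character 0 x = 1"
  by (simp add: character_def real_vec_simps)

lemma character_add: "character (k + l) x = character k x * character l x"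
  by (simp add: character_def real_vec_simps inner_add_left cis_mult)

lemma cnj_character: "cnj (character k x) = character (- k) x"
  by (simp add: character_def real_vec_simps cis_cnj)

lemma norm_character [simp]: "cmod (character k x) = 1"
  by (simp add: character_def)

lemma borel_measurable_cis [measurable (raw)]:
  "f \<in> borel_measurable M \<Longrightarrow> (\<lambda>x. cis (f x)) \<in> borel_measurable M"
  by (rule borel_measurable_continuous_on[of cis]) (auto intro!: continuous_intros)

lemma borel_measurable_character [measurable]: "character k \<in> borel_measurable borel"
  unfolding character_def[abs_def] by measurable

lemma cis_2pi_real_vec: "cis (2 * pi * (real_vec k \<bullet> real_vec l)) = 1"
proof -
  have "real_vec k \<bullet> real_vec l = of_int (\<Sum>i\<in>UNIV. k $ i * l $ i)"
    by (simp add: inner_vec_def real_vec_def)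
  then show ?thesis by (simp only: cis_multiple_2pi Ints_of_int)
qed

text \<open>Generated by monomials and sums: closure properties are then inductions, and the representation as a
  finite sum over distinct characters is extracted once.\<close>

inductive_set trig_polys :: "(real^'n \<Rightarrow> complex) set" where
  monomial: "(\<lambda>x. c * character k x) \<in> trig_polys"
| add: "s \<in> trig_polys \<Longrightarrow> t \<in> trig_polys \<Longrightarrow> (\<lambda>x. s x + t x) \<in> trig_polys"

lemma trig_polys_const: "(\<lambda>x. c) \<in> trig_polys"
  using trig_polys.monomial[of c 0] by simp

lemma trig_polys_monomial_mult: "t \<in> trig_polys \<Longrightarrow> (\<lambda>x. (c * character k x) * t x) \<in> trig_polys"
proof (induction rule: trig_polys.induct)
  case (monomial d l)
  have "(\<lambda>x. c * character k x * (d * character l x)) = (\<lambda>x. (c * d) * character (k + l) x)"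
    by (auto simp: character_add)
  then show ?case by (simp only: trig_polys.monomial)
next
  case (add s t)
  then show ?case by (simp only: distrib_left trig_polys.add)
qed

lemma trig_polys_cmult: "t \<in> trig_polys \<Longrightarrow> (\<lambda>x. c * t x) \<in> trig_polys"
  using trig_polys_monomial_mult[of t c 0] by simp

lemma trig_polys_mult: "s \<in> trig_polys \<Longrightarrow> t \<in> trig_polys \<Longrightarrow> (\<lambda>x. s x * t x) \<in> trig_polys"
proof (induction rule: trig_polys.induct)
  case (monomial c k)
  then show ?case by (rule trig_polys_monomial_mult)
next
  case (add s u)
  then show ?case by (simp only: distrib_right trig_polys.add)
qed

lemma trig_polys_sum: "finite I \<Longrightarrow> (\<And>i. i \<in> I \<Longrightarrow> t i \<in> trig_polys) \<Longrightarrow> (\<lambda>x. \<Sum>i\<in>I. t i x) \<in> trig_polys"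
proof (induction I rule: finite_induct)
  case empty
  then show ?case using trig_polys_const[of 0] by simp
next
  case (insert i I)
  then show ?case by (simp add: trig_polys.add)
qed

lemma borel_measurable_trig_polys [measurable_dest]: "t \<in> trig_polys \<Longrightarrow> t \<in> borel_measurable borel"
  by (induction rule: trig_polys.induct) measurable

lemma trig_polys_eq_sum:
  "t \<in> trig_polys \<Longrightarrow> \<exists>K c. finite K \<and> t = (\<lambda>x. \<Sum>k\<in>K. c k * character k x)"
proof (induction rule: trig_polys.induct)
  case (monomial c k)
  show ?case by (intro exI[of _ "{k}"] exI[of _ "\<lambda>_. c"]) simp
next
  case (add s t)
  then obtain K c M d where K: "finite K" "s = (\<lambda>x. \<Sum>k\<in>K. c k * character k x)"
    and M: "finite M" "t = (\<lambda>x. \<Sum>k\<in>M. d k * character k x)" by blast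
  have s: "s = (\<lambda>x. \<Sum>k\<in>K \<union> M. (if k \<in> K then c k else 0) * character k x)"
    unfolding K(2) by (intro ext sum.mono_neutral_cong_left) (use K M in auto)
  have t: "t = (\<lambda>x. \<Sum>k\<in>K \<union> M. (if k \<in> M then d k else 0) * character k x)"
    unfolding M(2) by (intro ext sum.mono_neutral_cong_left) (use K M in auto)
  show ?case
    by (intro exI[of _ "K \<union> M"]
        exI[of _ "\<lambda>k. (if k \<in> K then c k else 0) + (if k \<in> M then d k else 0)"] conjI)
      (use K(1) M(1) in simp, subst s, subst t, simp add: sum.distrib distrib_right)
qed

section \<open>Orthogonality of the characters\<close>

lemma emeasure_period_cell: "emeasure lborel (period_cell :: (real^'n) set) = ennreal ((2 * pi) ^ CARD('n))"
proof -
  let ?a = "(\<chi> i. - pi) :: real^'n" and ?b = "(\<chi> i. pi) :: real^'n"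
  have ab: "b \<in> Basis \<Longrightarrow> ?a \<bullet> b \<le> ?b \<bullet> b" for b
    by (auto simp: Basis_vec_def inner_axis)
  have pr: "(\<Prod>b\<in>Basis. (?b - ?a) \<bullet> b) = (2 * pi) ^ CARD('n)"
  proof -
    have "(\<Prod>b\<in>Basis. (?b - ?a) \<bullet> b) = (\<Prod>b\<in>(Basis :: (real^'n) set). 2 * pi)"
      by (rule prod.cong) (auto simp: Basis_vec_def inner_axis)
    then show ?thesis by simp
  qed
  have "emeasure lborel (box ?a ?b) \<le> emeasure lborel (period_cell :: (real^'n) set)"
    by (rule emeasure_mono) (auto simp: period_cell_def mem_box_cart less_imp_le)
  moreover have "emeasure lborel (period_cell :: (real^'n) set) \<le> emeasure lborel (cbox ?a ?b)"
    by (rule emeasure_mono) (auto simp: period_cell_def mem_box_cart less_imp_le)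
  moreover have "emeasure lborel (box ?a ?b) = ennreal ((2 * pi) ^ CARD('n))"
    using ab pr by (subst emeasure_lborel_box) auto
  moreover have "emeasure lborel (cbox ?a ?b) = ennreal ((2 * pi) ^ CARD('n))"
    using ab pr by (subst emeasure_lborel_cbox) auto
  ultimately show ?thesis by simp
qed

lemma emeasure_cell_measure: "emeasure cell_measure (UNIV :: (real^'n) set) = ennreal ((2 * pi) ^ CARD('n))"
  by (simp add: cell_measure_def emeasure_density ennreal_indicator emeasure_period_cell)

lemma finite_measure_cell_measure: "finite_measure cell_measure"
  by (rule finite_measureI) (simp add: emeasure_cell_measure)

text \<open>The translated cell is a fundamental domain as well: unfolding the integral over it and using the
  periodicity of \<open>u\<close> leaves the sum of the indicators of its translates, which is one.\<close>

lemma nn_integral_cell_measure_translate: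
  fixes u :: "real^'n \<Rightarrow> ennreal"
  assumes [measurable]: "u \<in> borel_measurable borel"
    and per: "\<And>x k. u (x + (2 * pi) *\<^sub>R real_vec k) = u x"
  shows "(\<integral>\<^sup>+x. u (c + x) \<partial>cell_measure) = (\<integral>\<^sup>+x. u x \<partial>cell_measure)"
proof -
  let ?v = "\<lambda>k::int^'n. (2 * pi) *\<^sub>R real_vec k"
  have "(\<integral>\<^sup>+x. u (c + x) \<partial>cell_measure) = (\<integral>\<^sup>+x. indicator period_cell x * u (c + x) \<partial>lborel)"
    by (simp add: nn_integral_cell_measure)
  also have "\<dots> = (\<integral>\<^sup>+x. indicator period_cell (- c + x) * u x \<partial>lborel)"
    by (subst nn_integral_lborel_translate[of _ "- c", symmetric]) auto
  also have "\<dots> = (\<integral>\<^sup>+x. (\<integral>\<^sup>+k. indicator period_cell (- c + (x + ?v k)) * u (x + ?v k) \<partial>count_space UNIV) \<partial>cell_measure)"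
    by (rule nn_integral_unfold_cell) measurable
  also have "\<dots> = (\<integral>\<^sup>+x. u x \<partial>cell_measure)"
    by (simp only: per nn_integral_multc measurable_count_space_eq1 Pi_UNIV UNIV_I sum_period_cell_translates mult_1 add.assoc[symmetric] space_borel)
  finally show ?thesis .
qed

text \<open>A translation that advances the phase by \<open>\<pi>\<close> flips the sign of the cosine and, by periodicity, does
  not change the integral. The constant \<open>1\<close> is added in the proof to make the integrand nonnegative.\<close>

lemma integral_cell_cos:
  fixes k :: "int^'n"
  assumes "k \<noteq> 0"
  shows "(LINT x|cell_measure. cos (real_vec k \<bullet> x + b)) = 0"
proof -
  interpret finite_measure "cell_measure :: (real^'n) measure" by (rule finite_measure_cell_measure)
  have cosper: "cos (real_vec k \<bullet> (x + (2 * pi) *\<^sub>R real_vec l) + b) = cos (real_vec k \<bullet> x + b)" for x l b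
  proof -
    have "cis (real_vec k \<bullet> (x + (2 * pi) *\<^sub>R real_vec l) + b)
      = cis (real_vec k \<bullet> x + b) * cis (2 * pi * (real_vec k \<bullet> real_vec l))"
      by (simp add: cis_mult inner_add_right algebra_simps)
    then show ?thesis by (metis cis.sel(1) cis_2pi_real_vec mult_1_right)
  qed
  have int: "integrable cell_measure (\<lambda>x. cos (real_vec k \<bullet> x + b))" for b
    by (rule integrable_const_bound[of _ 1]) auto
  have total: "(LINT x|cell_measure. 1 + cos (real_vec k \<bullet> x + b))
    = measure cell_measure (UNIV::(real^'n) set) + (LINT x|cell_measure. cos (real_vec k \<bullet> x + b))" for b
    by (subst Bochner_Integration.integral_add) (auto simp: int)
  (* The translation along k that advances the phase by pi. *)
  define c where "c = (pi / (real_vec k \<bullet> real_vec k)) *\<^sub>R real_vec k"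
  have kc: "real_vec k \<bullet> c = pi"
    using assms by (simp add: c_def real_vec_eq_0_iff)
  have ge: "0 \<le> 1 + cos t" for t :: real using cos_ge_minus_one[of t] by linarith
  have "(LINT x|cell_measure. 1 + cos (real_vec k \<bullet> x + b))
    = (LINT x|cell_measure. 1 + cos (real_vec k \<bullet> (c + x) + b))"
  proof -
    have "(\<integral>\<^sup>+x. ennreal (1 + cos (real_vec k \<bullet> (c + x) + b)) \<partial>cell_measure)
      = (\<integral>\<^sup>+x. ennreal (1 + cos (real_vec k \<bullet> x + b)) \<partial>cell_measure)"
      by (rule nn_integral_cell_measure_translate) (simp_all add: cosper)
    then show ?thesis by (simp add: integral_eq_nn_integral ge)
  qed
  also have "\<dots> = (LINT x|cell_measure. 1 + cos (real_vec k \<bullet> x + (b + pi)))"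
    by (simp add: inner_add_right kc algebra_simps)
  finally have "(LINT x|cell_measure. cos (real_vec k \<bullet> x + b)) = (LINT x|cell_measure. cos (real_vec k \<bullet> x + (b + pi)))"
    unfolding total by simp
  also have "\<dots> = (LINT x|cell_measure. - cos (real_vec k \<bullet> x + b))"
    by (simp add: add.assoc[symmetric] cos_periodic_pi)
  finally show ?thesis by simp
qed

lemma integral_cell_character:
  "(LINT x|cell_measure. character k x) = (if k = 0 then (2 * pi) ^ CARD('n) else 0)"
  for k :: "int^'n"
proof (cases "k = 0")
  case True
  then show ?thesis by (simp add: measure_def emeasure_cell_measure scaleR_conv_of_real)
next
  case False
  interpret finite_measure "cell_measure :: (real^'n) measure" by (rule finite_measure_cell_measure)
  have int: "integrable cell_measure (character k)"
    by (rule integrable_const_bound[of _ 1]) auto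
  have "Re (LINT x|cell_measure. character k x) = 0"
    using integral_cell_cos[OF False, of 0]
    by (subst integral_Re[OF int, symmetric]) (simp add: character_def)
  moreover have "Im (LINT x|cell_measure. character k x) = 0"
    using integral_cell_cos[OF False, of "- (pi / 2)"]
    by (subst integral_Im[OF int, symmetric]) (simp add: character_def cos_diff)
  ultimately show ?thesis using False by (simp add: complex_eq_iff)
qed

section \<open>Density of the trigonometric polynomials\<close>

definition approximable :: "(real^'n \<Rightarrow> complex) \<Rightarrow> bool" where
  "approximable g \<longleftrightarrow> g \<in> borel_measurable borel \<and>
    (\<forall>\<epsilon>>0. \<exists>t\<in>trig_polys. energy cell_measure (\<lambda>x. g x - t x) \<le> ennreal \<epsilon>)"

lemma approximable_measurable [measurable_dest]:
  "approximable g \<Longrightarrow> g \<in> borel_measurable borel"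
  by (simp add: approximable_def)

lemma double_ennreal_quarter: "0 \<le> \<epsilon> \<Longrightarrow> 2 * ennreal (\<epsilon> / 4) + 2 * ennreal (\<epsilon> / 4) = ennreal \<epsilon>"
proof -
  assume "0 \<le> \<epsilon>"
  then have "2 * ennreal (\<epsilon> / 4) = ennreal (2 * (\<epsilon> / 4))"
    by (subst ennreal_mult) auto
  then show ?thesis
    using \<open>0 \<le> \<epsilon>\<close> by (simp del: ennreal_plus add: ennreal_plus[symmetric])
qed

lemma approximable_closed:
  assumes [measurable]: "g \<in> borel_measurable borel"
    and ap: "\<And>\<epsilon>. \<epsilon> > 0 \<Longrightarrow> \<exists>h. approximable h \<and> energy cell_measure (\<lambda>x. g x - h x) \<le> ennreal \<epsilon>"
  shows "approximable g"
  unfolding approximable_def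
proof (intro conjI allI impI)
  fix \<epsilon> :: real assume \<epsilon>: "\<epsilon> > 0"
  obtain h where h: "approximable h" "energy cell_measure (\<lambda>x. g x - h x) \<le> ennreal (\<epsilon>/4)"
    using ap[of "\<epsilon>/4"] \<epsilon> by auto
  obtain t where t: "t \<in> trig_polys" "energy cell_measure (\<lambda>x. h x - t x) \<le> ennreal (\<epsilon>/4)"
    using h(1) \<epsilon> unfolding approximable_def by (metis divide_pos_pos zero_less_numeral)
  note [measurable] = approximable_measurable[OF h(1)] borel_measurable_trig_polys[OF t(1)]
  have "energy cell_measure (\<lambda>x. g x - t x)
    \<le> 2 * energy cell_measure (\<lambda>x. g x - h x) + 2 * energy cell_measure (\<lambda>x. h x - t x)"
    by (rule energy_diff_le) measurable
  also have "\<dots> \<le> 2 * ennreal (\<epsilon>/4) + 2 * ennreal (\<epsilon>/4)"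
    by (intro add_mono mult_left_mono h t) auto
  finally show "\<exists>t\<in>trig_polys. energy cell_measure (\<lambda>x. g x - t x) \<le> ennreal \<epsilon>"
    using t(1) \<epsilon> double_ennreal_quarter[of \<epsilon>] by auto
qed fact

lemma approximable_trig_polys: "t \<in> trig_polys \<Longrightarrow> approximable t"
  unfolding approximable_def
  by (auto intro!: bexI[of _ t] simp: energy_def)

lemma approximable_lincomb:
  assumes g: "approximable g" and h: "approximable h"
  shows "approximable (\<lambda>x. c * g x + h x)"
  unfolding approximable_def
proof (intro conjI allI impI)
  note [measurable] = approximable_measurable[OF g] approximable_measurable[OF h]
  show "(\<lambda>x. c * g x + h x) \<in> borel_measurable borel" by measurable
  fix \<epsilon> :: real assume \<epsilon>: "\<epsilon> > 0"
  define q where "q = (cmod c)^2 + 1"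
  have q: "q > 0" "(cmod c)^2 \<le> q" by (simp_all add: q_def add_nonneg_pos)
  then have pos: "\<epsilon> / 4 / q > 0" "\<epsilon> / 4 > 0" using \<epsilon> by simp_all
  obtain s where s: "s \<in> trig_polys" "energy cell_measure (\<lambda>x. g x - s x) \<le> ennreal (\<epsilon> / 4 / q)"
    using g pos(1) unfolding approximable_def by blast
  obtain t where t: "t \<in> trig_polys" "energy cell_measure (\<lambda>x. h x - t x) \<le> ennreal (\<epsilon> / 4)"
    using h pos(2) unfolding approximable_def by blast
  note [measurable] = borel_measurable_trig_polys[OF s(1)] borel_measurable_trig_polys[OF t(1)]
  have cs: "energy cell_measure (\<lambda>x. c * (g x - s x)) \<le> ennreal (\<epsilon> / 4)"
  proof -
    have "energy cell_measure (\<lambda>x. c * (g x - s x)) = ennreal ((cmod c)^2) * energy cell_measure (\<lambda>x. g x - s x)"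
      by (rule energy_cmult) measurable
    also have "\<dots> \<le> ennreal q * ennreal (\<epsilon> / 4 / q)"
      using q(2) by (intro mult_mono s ennreal_leI) auto
    also have "\<dots> = ennreal (\<epsilon> / 4)"
      using q(1) pos by (subst ennreal_mult[symmetric]) auto
    finally show ?thesis .
  qed
  have "energy cell_measure (\<lambda>x. (c * g x + h x) - (c * s x + t x))
    = energy cell_measure (\<lambda>x. c * (g x - s x) + (h x - t x))"
    by (simp add: algebra_simps)
  also have "\<dots> \<le> 2 * energy cell_measure (\<lambda>x. c * (g x - s x)) + 2 * energy cell_measure (\<lambda>x. h x - t x)"
    by (rule energy_add_le) measurable
  also have "\<dots> \<le> 2 * ennreal (\<epsilon> / 4) + 2 * ennreal (\<epsilon> / 4)"
    by (intro add_mono mult_left_mono cs t) auto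
  finally show "\<exists>u\<in>trig_polys. energy cell_measure (\<lambda>x. (c * g x + h x) - u x) \<le> ennreal \<epsilon>"
    using trig_polys.add[OF trig_polys_cmult[OF s(1)] t(1)] \<epsilon> double_ennreal_quarter[of \<epsilon>] by auto
qed

lemma approximable_add:
  "approximable g \<Longrightarrow> approximable h \<Longrightarrow> approximable (\<lambda>x. g x + h x)"
  using approximable_lincomb[of g h 1] by simp

lemma approximable_cmult: "approximable g \<Longrightarrow> approximable (\<lambda>x. c * g x)"
  using approximable_lincomb[OF _ approximable_trig_polys[OF trig_polys_const[of 0]]] by simp

lemma approximable_sum:
  "finite I \<Longrightarrow> (\<And>i. i \<in> I \<Longrightarrow> approximable (g i)) \<Longrightarrow> approximable (\<lambda>x. \<Sum>i\<in>I. g i x)"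
proof (induction I rule: finite_induct)
  case empty
  then show ?case using approximable_trig_polys[OF trig_polys_const[of 0]] by simp
next
  case (insert i I)
  then show ?case by (simp add: approximable_add)
qed

lemma approximable_dominated:
  fixes h :: "nat \<Rightarrow> real^'n \<Rightarrow> complex"
  assumes h: "\<And>m. approximable (h m)"
    and [measurable]: "g \<in> borel_measurable borel" "w \<in> borel_measurable borel"
    and w: "energy cell_measure w < top"
    and le: "\<And>m x. cmod (h m x) \<le> cmod (w x)"
    and lim: "\<And>x. (\<lambda>m. h m x) \<longlonglongrightarrow> g x"
  shows "approximable g"
proof (rule approximable_closed)
  note [measurable] = approximable_measurable[OF h]
  have "(\<lambda>m. \<integral>\<^sup>+x. ennreal ((cmod (g x - h m x))^2) \<partial>cell_measure) \<longlonglongrightarrow> (\<integral>\<^sup>+x. 0 \<partial>(cell_measure :: (real^'n) measure))"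
  proof (rule nn_integral_dominated_convergence[where w = "\<lambda>x. 4 * ennreal ((cmod (w x))^2)"])
    fix m
    show "AE x in cell_measure. ennreal ((cmod (g x - h m x))^2) \<le> 4 * ennreal ((cmod (w x))^2)"
    proof (rule AE_I2)
      fix x
      have "cmod (g x) \<le> cmod (w x)"
        by (rule LIMSEQ_le_const2[OF tendsto_norm[OF lim[of x]]]) (auto intro: le)
      then have "cmod (g x - h m x) \<le> 2 * cmod (w x)"
        using le[of m x] norm_triangle_ineq4[of "g x" "h m x"] by linarith
      then have "(cmod (g x - h m x))^2 \<le> (2 * cmod (w x))^2"
        by (intro power_mono) auto
      then have "ennreal ((cmod (g x - h m x))^2) \<le> ennreal (4 * (cmod (w x))^2)"
        by (intro ennreal_leI) (simp add: power_mult_distrib)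
      then show "ennreal ((cmod (g x - h m x))^2) \<le> 4 * ennreal ((cmod (w x))^2)"
        by (simp add: ennreal_mult)
    qed
  next
    show "(\<integral>\<^sup>+x. 4 * ennreal ((cmod (w x))^2) \<partial>cell_measure) < \<infinity>"
      using w by (subst nn_integral_cmult) (auto simp: energy_def ennreal_mult_less_top)
    show "AE x in cell_measure. (\<lambda>m. ennreal ((cmod (g x - h m x))^2)) \<longlonglongrightarrow> 0"
    proof (rule AE_I2)
      fix x
      have "(\<lambda>m. ennreal ((cmod (g x - h m x))^2)) \<longlonglongrightarrow> ennreal ((cmod (g x - g x))^2)"
        by (intro tendsto_intros lim)
      then show "(\<lambda>m. ennreal ((cmod (g x - h m x))^2)) \<longlonglongrightarrow> 0" by simp
    qed
  qed measurable
  then have *: "(\<lambda>m. energy cell_measure (\<lambda>x. g x - h m x)) \<longlonglongrightarrow> 0"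
    by (simp add: energy_def)
  fix \<epsilon> :: real assume "\<epsilon> > 0"
  then have "\<forall>\<^sub>F m in sequentially. energy cell_measure (\<lambda>x. g x - h m x) < ennreal \<epsilon>"
    by (intro order_tendstoD(2)[OF *]) simp
  then obtain m where "energy cell_measure (\<lambda>x. g x - h m x) < ennreal \<epsilon>"
    by (auto simp: eventually_sequentially)
  then show "\<exists>h. approximable h \<and> energy cell_measure (\<lambda>x. g x - h x) \<le> ennreal \<epsilon>"
    using h[of m] by (auto intro!: exI[of _ "h m"])
qed fact

definition torus_point :: "real^'n \<Rightarrow> complex^'n" where
  "torus_point x = (\<chi> i. cis (x $ i))"

lemma continuous_on_torus_point: "continuous_on UNIV torus_point"
  unfolding torus_point_def by (intro continuous_intros)

lemma borel_measurable_torus_point [measurable]: "torus_point \<in> borel_measurable borel"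
  by (rule borel_measurable_continuous_onI[OF continuous_on_torus_point])

lemma trig_polys_cos_sin:
  "(\<lambda>x :: real^'n. complex_of_real (cos (x $ i))) \<in> trig_polys"
  "(\<lambda>x :: real^'n. complex_of_real (sin (x $ i))) \<in> trig_polys"
proof -
  have ax: "real_vec (axis i 1) \<bullet> x = x $ i" for x :: "real^'n"
  proof -
    have "real_vec (axis i 1) = (axis i 1 :: real^'n)"
      by (auto simp: real_vec_def vec_eq_iff axis_def)
    then show ?thesis by (simp add: inner_axis')
  qed
  have p: "character (axis i 1) x = cis (x $ i)" "character (- axis i 1) x = cis (- x $ i)" for x :: "real^'n"
    by (simp_all add: character_def real_vec_simps ax)
  have "(\<lambda>x :: real^'n. complex_of_real (cos (x $ i)))
    = (\<lambda>x. (1/2) * character (axis i 1) x + (1/2) * character (- axis i 1) x)"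
    by (rule ext) (simp add: p complex_eq_iff)
  then show "(\<lambda>x :: real^'n. complex_of_real (cos (x $ i))) \<in> trig_polys"
    by (simp only: trig_polys.intros)
  have "(\<lambda>x :: real^'n. complex_of_real (sin (x $ i)))
    = (\<lambda>x. (- \<i>/2) * character (axis i 1) x + (\<i>/2) * character (- axis i 1) x)"
    by (rule ext) (simp add: p complex_eq_iff)
  then show "(\<lambda>x :: real^'n. complex_of_real (sin (x $ i))) \<in> trig_polys"
    by (simp only: trig_polys.intros)
qed

text \<open>The real coordinates of \<open>torus_point x\<close> are cosines and sines, so polynomials in them are trigonometric
  polynomials. This is how the Stone-Weierstrass theorem enters.\<close>

lemma trig_polys_real_polynomial:
  fixes f :: "complex^'n \<Rightarrow> real"
  assumes "real_polynomial_function f"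
  shows "(\<lambda>x. complex_of_real (f (torus_point x))) \<in> trig_polys"
  using assms
proof (induction f rule: real_polynomial_function.induct)
  case (linear f)
  have rep: "f z = (\<Sum>b\<in>Basis. (z \<bullet> b) * f b)" for z
  proof -
    have "f z = f (\<Sum>b\<in>Basis. (z \<bullet> b) *\<^sub>R b)" by (simp add: euclidean_representation)
    also have "\<dots> = (\<Sum>b\<in>Basis. (z \<bullet> b) * f b)"
      using linear by (simp add: linear_sum linear_scale bounded_linear.linear)
    finally show ?thesis .
  qed
  have eq: "(\<lambda>x. complex_of_real (f (torus_point x)))
    = (\<lambda>x. \<Sum>b\<in>Basis. of_real (f b) * of_real (torus_point x \<bullet> b))"
    by (rule ext, subst rep) (simp add: mult.commute)
  have "(\<lambda>x. complex_of_real (torus_point x \<bullet> b)) \<in> trig_polys" if "b \<in> Basis" for b :: "complex^'n"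
  proof -
    from that obtain i u where b: "b = axis i u" "u \<in> Basis" by (auto simp: Basis_vec_def)
    have "torus_point x \<bullet> b = cis (x $ i) \<bullet> u" for x
      by (simp add: b torus_point_def inner_axis)
    then show ?thesis
      using b(2) trig_polys_cos_sin[of i] by (auto simp: Basis_complex_def inner_complex_def)
  qed
  then show ?case
    unfolding eq by (intro trig_polys_sum trig_polys_cmult) auto
next
  case (const c)
  then show ?case by (rule trig_polys_const)
next
  case (add f g)
  then show ?case by (simp add: trig_polys.add)
next
  case (mult f g)
  then show ?case by (simp add: trig_polys_mult)
qed

lemma approximable_continuous_torus:
  fixes h :: "complex^'n \<Rightarrow> real"
  assumes h: "continuous_on UNIV h"
  shows "approximable (\<lambda>x. complex_of_real (h (torus_point x)))"
proof (rule approximable_closed)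
  have [measurable]: "h \<in> borel_measurable borel" by (rule borel_measurable_continuous_onI[OF h])
  show "(\<lambda>x. complex_of_real (h (torus_point x))) \<in> borel_measurable borel" by measurable
  fix \<epsilon> :: real assume \<epsilon>: "\<epsilon> > 0"
  let ?T = "{z :: complex^'n. \<forall>i. norm (z $ i) = 1}"
  define V where "V = (2 * pi) ^ CARD('n)"
  have V: "V > 0" by (simp add: V_def)
  have "compact ?T"
  proof (rule compact_eq_bounded_closed[THEN iffD2], intro conjI)
    have "norm z \<le> real CARD('n)" if "z \<in> ?T" for z
      using that L2_set_le_sum[of UNIV "\<lambda>i. norm (z $ i)"] by (simp add: norm_vec_def)
    then show "bounded ?T" by (auto simp: bounded_iff)
    have "?T = (\<Inter>i. {z. norm (z $ i) = 1})" by auto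
    also have "closed \<dots>"
      by (intro closed_INT ballI closed_Collect_eq continuous_intros)
    finally show "closed ?T" .
  qed
  then obtain p where p: "polynomial_function p" "\<And>z. z \<in> ?T \<Longrightarrow> norm (h z - p z) < sqrt (\<epsilon> / V)"
    using Stone_Weierstrass_polynomial_function[of ?T h "sqrt (\<epsilon> / V)"] continuous_on_subset[OF h] \<epsilon> V by auto
  let ?t = "\<lambda>x. complex_of_real (p (torus_point x))"
  have t: "?t \<in> trig_polys"
    using p(1) by (intro trig_polys_real_polynomial) (simp add: real_polynomial_function_eq)
  have "energy cell_measure (\<lambda>x. complex_of_real (h (torus_point x)) - ?t x)
    \<le> (\<integral>\<^sup>+x. ennreal (\<epsilon> / V) \<partial>(cell_measure :: (real^'n) measure))"
    unfolding energy_def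
  proof (rule nn_integral_mono, rule ennreal_leI)
    fix x :: "real^'n"
    have "torus_point x \<in> ?T" by (simp add: torus_point_def)
    then have "\<bar>h (torus_point x) - p (torus_point x)\<bar> \<le> sqrt (\<epsilon> / V)"
      using p(2) by fastforce
    then have "(\<bar>h (torus_point x) - p (torus_point x)\<bar>)^2 \<le> (sqrt (\<epsilon> / V))^2"
      by (intro power_mono) auto
    then show "(cmod (complex_of_real (h (torus_point x)) - ?t x))^2 \<le> \<epsilon> / V"
      using \<epsilon> V by (simp flip: of_real_diff)
  qed
  also have "\<dots> = ennreal \<epsilon>"
  proof -
    have "emeasure cell_measure (UNIV :: (real^'n) set) = ennreal V"
      by (simp only: emeasure_cell_measure V_def)
    then show ?thesis using \<epsilon> V by (simp add: ennreal_mult[symmetric])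
  qed
  finally show "\<exists>t. approximable t \<and>
      energy cell_measure (\<lambda>x. complex_of_real (h (torus_point x)) - t x) \<le> ennreal \<epsilon>"
    using approximable_trig_polys[OF t] by blast
qed

lemma energy_cell_const: "energy (cell_measure :: (real^'n) measure) (\<lambda>x. c) < top"
proof -
  have "emeasure cell_measure (UNIV :: (real^'n) set) < top"
    unfolding emeasure_cell_measure by simp
  then show ?thesis
    unfolding energy_def by (simp only: nn_integral_const space_cell_measure ennreal_mult_less_top) simp
qed

text \<open>The continuous functions \<open>max 0 (1 - m d(z, C))\<close> decrease to the indicator of the closed set \<open>C\<close>.\<close>

lemma approximable_torus_closed:
  fixes C :: "(complex^'n) set"
  assumes "closed C"
  shows "approximable (\<lambda>x. indicator C (torus_point x))"
proof (cases "C = {}")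
  case True
  then show ?thesis using approximable_trig_polys[OF trig_polys_const[of 0]] by simp
next
  case False
  define h where "h m z = max 0 (1 - real m * infdist z C)" for m z
  have [measurable]: "C \<in> sets borel" using assms by simp
  have m: "(\<lambda>x. indicator C (torus_point x) :: complex) \<in> borel_measurable borel"
    by measurable
  have hlim: "(\<lambda>m. h m z) \<longlonglongrightarrow> indicator C z" for z
  proof (cases "z \<in> C")
    case True
    then show ?thesis by (simp add: h_def)
  next
    case notin: False
    then have pos: "infdist z C > 0"
      using assms False in_closed_iff_infdist_zero[of C z] infdist_nonneg[of z C] by simp
    obtain m0 :: nat where m0: "1 / infdist z C \<le> real m0" using real_arch_simple by blast
    have "\<forall>\<^sub>F m in sequentially. h m z = 0"
    proof (rule eventually_sequentiallyI[of m0])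
      fix m assume "m0 \<le> m"
      then have "1 / infdist z C \<le> real m" using m0 by linarith
      then show "h m z = 0" using pos by (simp add: h_def field_simps)
    qed
    then show ?thesis using notin by (simp add: tendsto_eventually)
  qed
  show ?thesis
  proof (rule approximable_dominated[where w = "\<lambda>_. 1" and h = "\<lambda>m x. complex_of_real (h m (torus_point x))"])
    fix m
    have "continuous_on UNIV (h m)"
      unfolding h_def by (intro continuous_intros)
    then show "approximable (\<lambda>x. complex_of_real (h m (torus_point x)))"
      by (rule approximable_continuous_torus)
    fix x :: "real^'n"
    have "0 \<le> h m (torus_point x)" "h m (torus_point x) \<le> 1"
      using infdist_nonneg[of "torus_point x" C] by (auto simp: h_def)
    then show "cmod (complex_of_real (h m (torus_point x))) \<le> cmod 1" by simp
  next
    fix x :: "real^'n"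
    have "(\<lambda>m. complex_of_real (h m (torus_point x))) \<longlonglongrightarrow> of_real (indicator C (torus_point x))"
      by (intro tendsto_of_real hlim)
    then show "(\<lambda>m. complex_of_real (h m (torus_point x))) \<longlonglongrightarrow> indicator C (torus_point x)"
      by (simp add: of_real_indicator)
  qed (use m energy_cell_const in auto)
qed

text \<open>The closed sets form an intersection-stable generator, and the closure of the trigonometric polynomials
  is stable under complements and, by dominated convergence, under countable disjoint unions.\<close>

lemma approximable_torus_borel:
  fixes A :: "(complex^'n) set"
  assumes "A \<in> sets borel"
  shows "approximable (\<lambda>x. indicator A (torus_point x))"
proof -
  have "A \<in> sigma_sets UNIV (Collect closed)"
    using assms unfolding borel_eq_closed by simp
  moreover have Int: "Int_stable (Collect (closed :: (complex^'n) set \<Rightarrow> bool))"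
    by (auto simp: Int_stable_def)
  moreover have Pow: "Collect closed \<subseteq> Pow (UNIV :: (complex^'n) set)" by simp
  ultimately have "A \<in> sets borel \<and> approximable (\<lambda>x. indicator A (torus_point x))"
  proof (induction rule: sigma_sets_induct_disjoint[OF Int Pow, consumes 1, case_names basic empty compl union])
    case (basic A)
    then show ?case by (simp add: approximable_torus_closed)
  next
    case empty
    show ?case using approximable_torus_closed[of "{}"] by simp
  next
    case (compl A)
    then have "approximable (\<lambda>x. 1 + (- 1) * indicator A (torus_point x))"
      by (intro approximable_add approximable_cmult
          approximable_trig_polys[OF trig_polys_const]) simp
    moreover have "(\<lambda>x :: real^'n. 1 + (- 1) * indicator A (torus_point x))
      = (\<lambda>x. indicator (UNIV - A) (torus_point x) :: complex)"
      by (auto simp: indicator_def)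
    ultimately show ?case using compl by auto
  next
    case (union A)
    have [measurable]: "A i \<in> sets borel" for i using union by simp
    have fin: "approximable (\<lambda>x. indicator (\<Union>i<m. A i) (torus_point x))" for m :: nat
    proof (induction m)
      case 0
      show ?case using approximable_torus_closed[of "{}"] by simp
    next
      case (Suc m)
      have "A m \<inter> (\<Union>i<m. A i) = {}"
        using union(1) by (auto simp: disjoint_family_on_def) (metis less_irrefl disjoint_iff)
      then have "(\<lambda>x :: real^'n. indicator (\<Union>i<Suc m. A i) (torus_point x) :: complex)
        = (\<lambda>x. indicator (A m) (torus_point x) + indicator (\<Union>i<m. A i) (torus_point x))"
        by (auto simp: lessThan_Suc indicator_add[symmetric])
      then show ?case using Suc union by (simp add: approximable_add)
    qed
    have "(\<Union>i. A i) \<in> sets borel" by auto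
    then have m: "(\<lambda>x. indicator (\<Union>i. A i) (torus_point x) :: complex) \<in> borel_measurable borel"
      by (intro measurable_compose[OF borel_measurable_torus_point] borel_measurable_indicator)
    have "approximable (\<lambda>x. indicator (\<Union>i. A i) (torus_point x))"
    proof (rule approximable_dominated[where w = "\<lambda>_. 1"
          and h = "\<lambda>m x. indicator (\<Union>i<m. A i) (torus_point x)"])
      fix x :: "real^'n" and m :: nat
      show "cmod (indicator (\<Union>i<m. A i) (torus_point x)) \<le> cmod 1"
        by (simp add: indicator_def)
      show "(\<lambda>m. indicator (\<Union>i<m. A i) (torus_point x) :: complex)
        \<longlonglongrightarrow> indicator (\<Union>i. A i) (torus_point x)"
        by (rule LIMSEQ_indicator_UN)
    qed (use fin m energy_cell_const in auto)
    then show ?case by auto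
  qed
  then show ?thesis by simp
qed

text \<open>The argument in \<open>(-\<pi>, \<pi>]\<close> of a point of the unit circle, written through a continuous function so that
  it is visibly Borel; the second factor clips the real part to the domain of \<open>arccos\<close>.\<close>

definition circle_angle :: "complex \<Rightarrow> real" where
  "circle_angle z = (if 0 \<le> Im z then 1 else - 1) * arccos (max (- 1) (min 1 (Re z)))"

lemma circle_angle_cis:
  assumes "- pi < t" "t \<le> pi"
  shows "circle_angle (cis t) = t"
proof (cases "0 \<le> t")
  case True
  then have "sin t \<ge> 0" "arccos (cos t) = t" using assms by (auto intro: sin_ge_zero arccos_cos)
  then show ?thesis by (simp add: circle_angle_def min_absorb2 max_absorb2)
next
  case False
  then have "sin t < 0" using assms sin_gt_zero[of "- t"] by simp
  moreover have "arccos (cos t) = - t"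
    using False assms arccos_cos2[of t] by simp
  ultimately show ?thesis by (simp add: circle_angle_def min_absorb2 max_absorb2)
qed

lemma borel_measurable_circle_angle [measurable]: "circle_angle \<in> borel_measurable borel"
proof -
  have "continuous_on UNIV (\<lambda>z::complex. arccos (max (- 1) (min 1 (Re z))))"
    by (intro continuous_intros) auto
  then have [measurable]: "(\<lambda>z. arccos (max (- 1) (min 1 (Re z)))) \<in> borel_measurable borel"
    by (rule borel_measurable_continuous_onI)
  show ?thesis unfolding circle_angle_def[abs_def] by measurable
qed

text \<open>Componentwise angles recover a point of the half-open cell from its image on the torus, so on the
  cell the indicator of \<open>A\<close> is the indicator of a Borel set of the torus.\<close>

lemma approximable_indicator:
  fixes A :: "(real^'n) set"
  assumes A: "A \<in> sets borel"
  shows "approximable (indicator A)"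
proof -
  define angles :: "complex^'n \<Rightarrow> real^'n" where "angles z = (\<chi> i. circle_angle (z $ i))" for z
  have "(\<lambda>z :: complex^'n. circle_angle (z $ i)) \<in> borel_measurable borel" for i
    by (rule measurable_compose[OF _ borel_measurable_circle_angle])
      (intro borel_measurable_continuous_onI continuous_intros)
  then have "angles \<in> borel_measurable borel"
    by (subst borel_measurable_euclidean_space) (auto simp: angles_def Basis_vec_def inner_axis)
  then have B: "angles -` A \<in> sets borel"
    using measurable_sets[of angles borel borel A] A by simp
  have inv: "angles (torus_point x) = x" if "x \<in> period_cell" for x
    using that by (auto simp: angles_def torus_point_def period_cell_def circle_angle_cis vec_eq_iff)
  let ?h = "\<lambda>x. indicator (angles -` A) (torus_point x) :: complex"
  show ?thesis
  proof (rule approximable_closed)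
    show "(indicator A :: real^'n \<Rightarrow> complex) \<in> borel_measurable borel" using A by simp
    have "AE x in cell_measure. (indicator A x - ?h x) = 0"
      by (auto simp: AE_cell_measure indicator_def inv)
    then have "energy cell_measure (\<lambda>x. indicator A x - ?h x) = energy cell_measure (\<lambda>x::real^'n. 0)"
      by (rule energy_cong_AE)
    then have "energy cell_measure (\<lambda>x. indicator A x - ?h x) = 0"
      by (simp add: energy_def)
    then show "\<exists>h. approximable h \<and> energy cell_measure (\<lambda>x. indicator A x - h x) \<le> ennreal \<epsilon>" for \<epsilon>
      using approximable_torus_borel[OF B] by (intro exI[of _ ?h]) simp
  qed
qed

text \<open>Indicators are approximable, hence so are simple functions, and a square-integrable function is a
  dominated limit of simple functions.\<close>

theorem trig_polys_dense:
  fixes g :: "real^'n \<Rightarrow> complex"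
  assumes g [measurable]: "g \<in> borel_measurable borel" and fin: "energy cell_measure g < top"
  shows "approximable g"
proof -
  obtain s where s: "\<And>i. simple_function borel (s i)" "\<And>x. (\<lambda>i. s i x) \<longlonglongrightarrow> g x"
      "\<And>i x. cmod (s i x) \<le> 2 * cmod (g x)"
    using borel_measurable_implies_sequence_metric[OF g, of 0] by (auto simp: dist_norm)
  have "approximable (s i)" for i
  proof -
    have fin: "finite (range (s i))" using s(1)[of i] by (simp add: simple_function_def)
    have eq: "s i = (\<lambda>x. \<Sum>y\<in>range (s i). y * indicator (s i -` {y}) x)"
    proof
      fix x
      have "(\<Sum>y\<in>range (s i). y * indicator (s i -` {y}) x) = (\<Sum>y\<in>{s i x}. y * indicator (s i -` {y}) x)"
        by (rule sum.mono_neutral_right) (use fin in \<open>auto simp: indicator_def\<close>)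
      then show "s i x = (\<Sum>y\<in>range (s i). y * indicator (s i -` {y}) x)" by simp
    qed
    have "s i -` {y} \<in> sets borel" for y
      using simple_functionD(2)[OF s(1)[of i], of "{y}"] by simp
    then show ?thesis
      by (subst eq) (intro approximable_sum fin approximable_cmult approximable_indicator)
  qed
  then show ?thesis
  proof (rule approximable_dominated[where w = "\<lambda>x. 2 * g x"])
    show "energy cell_measure (\<lambda>x. 2 * g x) < top"
      using fin by (subst energy_cmult) (auto simp: ennreal_mult_less_top)
  qed (use s in \<open>auto simp: norm_mult\<close>)
qed

section \<open>Parseval's identity\<close>

lemma infinite_UNIV_int_vec: "infinite (UNIV :: (int^'n) set)"
proof
  assume "finite (UNIV :: (int^'n) set)"
  then have "finite (range (\<lambda>m::int. (\<chi> i. m) :: int^'n))"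
    by (rule finite_subset[rotated]) simp
  then have "finite (UNIV :: int set)"
    by (rule finite_imageD) (auto simp: inj_on_def vec_eq_iff)
  then show False by simp
qed

lemma nn_integral_count_space_eqI:
  fixes f :: "int^'n \<Rightarrow> ennreal"
  assumes le: "\<And>K. finite K \<Longrightarrow> sum f K \<le> b"
    and ge: "\<And>c. (\<And>K. finite K \<Longrightarrow> sum f K \<le> c) \<Longrightarrow> b \<le> c"
  shows "(\<integral>\<^sup>+k. f k \<partial>count_space UNIV) = b"
proof (rule antisym)
  let ?e = "from_nat_into (UNIV :: (int^'n) set)"
  have bij: "bij_betw ?e UNIV UNIV"
    by (rule bij_betw_from_nat_into) (simp_all add: infinite_UNIV_int_vec)
  have "(\<integral>\<^sup>+k. f k \<partial>count_space UNIV) = (\<Sum>i. f (?e i))"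
    by (simp add: nn_integral_bij_count_space[OF bij, symmetric] nn_integral_count_space_nat)
  also have "\<dots> \<le> b"
  proof (rule suminf_le_const)
    fix m
    have "inj ?e" using bij by (simp add: bij_betw_def)
    then have "(\<Sum>i<m. f (?e i)) = sum f (?e ` {..<m})"
      by (simp add: sum.reindex inj_on_subset)
    then show "(\<Sum>i<m. f (?e i)) \<le> b" by (simp add: le)
  qed simp
  finally show "(\<integral>\<^sup>+k. f k \<partial>count_space UNIV) \<le> b" .
  show "b \<le> (\<integral>\<^sup>+k. f k \<partial>count_space UNIV)"
  proof (rule ge)
    fix K :: "(int^'n) set" assume "finite K"
    have "sum f K = (\<integral>\<^sup>+k. f k \<partial>count_space K)"
      using \<open>finite K\<close> by (simp add: nn_integral_count_space_finite)
    also have "\<dots> = (\<integral>\<^sup>+k. f k * indicator K k \<partial>count_space UNIV)"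
      by (rule nn_integral_count_space_indicator) simp
    also have "\<dots> \<le> (\<integral>\<^sup>+k. f k \<partial>count_space UNIV)"
      by (rule nn_integral_mono) (auto simp: indicator_def)
    finally show "sum f K \<le> (\<integral>\<^sup>+k. f k \<partial>count_space UNIV)" .
  qed
qed

definition fourier_coeff :: "(real^'n \<Rightarrow> complex) \<Rightarrow> int^'n \<Rightarrow> complex" where
  "fourier_coeff g k = (LINT x|cell_measure. g x * character (- k) x)"

lemma cmod_le_1_plus_square: "cmod z \<le> 1 + (cmod z)^2"
  using sum_squares_bound[of "cmod z" 1] by (simp add: power2_eq_square) (smt (verit) norm_ge_zero mult_nonneg_nonneg)

lemma integrable_finite_energy:
  assumes "finite_measure M" and [measurable]: "g \<in> borel_measurable M" and fin: "energy M g < top"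
  shows "integrable M g"
proof -
  interpret finite_measure M by fact
  show ?thesis
  proof (rule Bochner_Integration.integrable_bound[of M "\<lambda>x. 1 + (cmod (g x))^2"])
    show "integrable M (\<lambda>x. 1 + (cmod (g x))^2)"
      using fin by (intro Bochner_Integration.integrable_add) (auto simp: energy_finite_integrable)
    show "AE x in M. cmod (g x) \<le> norm (1 + (cmod (g x))^2)"
      using cmod_le_1_plus_square by (intro AE_I2) (simp add: add_nonneg_nonneg)
  qed measurable
qed

lemma cmod_diff_square:
  "complex_of_real ((cmod (a - b))^2)
    = of_real ((cmod a)^2) - a * cnj b - cnj (a * cnj b) + b * cnj b"
  by (simp only: complex_norm_square) (simp add: algebra_simps)

text \<open>The energy of the distance to a trigonometric polynomial, with a square completed in the
  coefficients. Choosing the optimal coefficients gives Bessel's inequality; dropping the completed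
  square gives the reverse bound once the left-hand side is small.\<close>

lemma energy_trig_poly_distance:
  fixes g :: "real^'n \<Rightarrow> complex"
  defines "V \<equiv> (2 * pi) ^ CARD('n)"
  assumes [measurable]: "g \<in> borel_measurable borel" and fin: "energy cell_measure g < top"
    and K: "finite K"
  shows "(LINT x|cell_measure. (cmod (g x - (\<Sum>k\<in>K. t k * character k x)))^2)
    = (LINT x|cell_measure. (cmod (g x))^2) - (\<Sum>k\<in>K. (cmod (fourier_coeff g k))^2) / V
      + V * (\<Sum>k\<in>K. (cmod (t k - fourier_coeff g k / V))^2)"
proof -
  interpret finite_measure "cell_measure :: (real^'n) measure" by (rule finite_measure_cell_measure)
  let ?T = "\<lambda>x. \<Sum>k\<in>K. t k * character k x"
  let ?c = "fourier_coeff g"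
  have V: "V > 0" by (simp add: V_def)
  have gint: "integrable cell_measure g"
    by (rule integrable_finite_energy) (auto simp: finite_measure_cell_measure fin)
  have gsq: "integrable cell_measure (\<lambda>x. (cmod (g x))^2)"
    using fin by (simp add: energy_finite_integrable)
  have gch: "integrable cell_measure (\<lambda>x. g x * character k x)" for k
    by (rule Bochner_Integration.integrable_bound[OF gint]) (auto simp: norm_mult)
  have ch: "integrable cell_measure (\<lambda>x. character k x)" for k :: "int^'n"
    by (rule integrable_const_bound[of _ 1]) auto
  have gT_eq: "g x * cnj (?T x) = (\<Sum>k\<in>K. cnj (t k) * (g x * character (- k) x))" for x
    by (simp add: sum_distrib_left cnj_character algebra_simps)
  have TT_eq: "?T x * cnj (?T x) = (\<Sum>k\<in>K. \<Sum>l\<in>K. (t k * cnj (t l)) * character (k - l) x)" for x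
    using character_add[of _ "- _" x]
    by (simp add: sum_product cnj_character algebra_simps)
  have gT: "integrable cell_measure (\<lambda>x. g x * cnj (?T x))"
    unfolding gT_eq by (intro Bochner_Integration.integrable_sum integrable_mult_right gch)
  have TT: "integrable cell_measure (\<lambda>x. ?T x * cnj (?T x))"
    unfolding TT_eq by (intro Bochner_Integration.integrable_sum integrable_mult_right ch)
  have I1: "(LINT x|cell_measure. g x * cnj (?T x)) = (\<Sum>k\<in>K. cnj (t k) * ?c k)"
    unfolding gT_eq fourier_coeff_def
    by (subst Bochner_Integration.integral_sum) (auto intro!: integrable_mult_right gch)
  have I3: "(LINT x|cell_measure. cnj (g x * cnj (?T x))) = cnj (\<Sum>k\<in>K. cnj (t k) * ?c k)"
    unfolding I1[symmetric] by (rule integral_bounded_linear[OF bounded_linear_cnj gT])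
  have I2: "(LINT x|cell_measure. ?T x * cnj (?T x)) = (\<Sum>k\<in>K. V * (t k * cnj (t k)))"
  proof -
    have "(LINT x|cell_measure. ?T x * cnj (?T x))
      = (\<Sum>k\<in>K. \<Sum>l\<in>K. (t k * cnj (t l)) * (LINT x|cell_measure. character (k - l) x))"
      unfolding TT_eq
      by (simp add: Bochner_Integration.integral_sum Bochner_Integration.integrable_sum integrable_mult_right ch)
    also have "\<dots> = (\<Sum>k\<in>K. \<Sum>l\<in>K. if k = l then V * (t k * cnj (t k)) else 0)"
      by (intro sum.cong refl) (auto simp: integral_cell_character V_def)
    also have "\<dots> = (\<Sum>k\<in>K. V * (t k * cnj (t k)))"
      using K by simp
    finally show ?thesis .
  qed
  have "complex_of_real (LINT x|cell_measure. (cmod (g x - ?T x))^2)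
    = (LINT x|cell_measure. complex_of_real ((cmod (g x - ?T x))^2))"
    by (rule integral_complex_of_real[symmetric])
  also have "\<dots> = (LINT x|cell_measure. complex_of_real ((cmod (g x))^2) - g x * cnj (?T x)
      - cnj (g x * cnj (?T x)) + ?T x * cnj (?T x))"
    by (simp only: cmod_diff_square)
  also have "\<dots> = (LINT x|cell_measure. complex_of_real ((cmod (g x))^2))
      - (LINT x|cell_measure. g x * cnj (?T x)) - (LINT x|cell_measure. cnj (g x * cnj (?T x)))
      + (LINT x|cell_measure. ?T x * cnj (?T x))"
  proof -
    have i1: "integrable cell_measure (\<lambda>x. complex_of_real ((cmod (g x))^2))"
      using gsq by (rule integrable_of_real)
    have i3: "integrable cell_measure (\<lambda>x. cnj (g x * cnj (?T x)))"
      using gT by (rule integrable_cnj)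
    show ?thesis
      by (simp only: Bochner_Integration.integral_add Bochner_Integration.integral_diff
          Bochner_Integration.integrable_diff i1 i3 gT TT)
  qed
  also have "\<dots> = of_real (LINT x|cell_measure. (cmod (g x))^2)
      - (\<Sum>k\<in>K. cnj (t k) * ?c k) - cnj (\<Sum>k\<in>K. cnj (t k) * ?c k) + (\<Sum>k\<in>K. V * (t k * cnj (t k)))"
    by (simp only: I1 I2 I3 integral_complex_of_real)
  also have "\<dots> = of_real (LINT x|cell_measure. (cmod (g x))^2)
      + (\<Sum>k\<in>K. V * (t k * cnj (t k)) - cnj (t k) * ?c k - t k * cnj (?c k))"
    by (simp add: sum.distrib sum_subtractf algebra_simps)
  also have "(\<Sum>k\<in>K. V * (t k * cnj (t k)) - cnj (t k) * ?c k - t k * cnj (?c k))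
    = (\<Sum>k\<in>K. complex_of_real (V * (cmod (t k - ?c k / V))^2 - (cmod (?c k))^2 / V))"
  proof (rule sum.cong[OF refl])
    fix k
    show "V * (t k * cnj (t k)) - cnj (t k) * ?c k - t k * cnj (?c k)
      = complex_of_real (V * (cmod (t k - ?c k / V))^2 - (cmod (?c k))^2 / V)"
      using V by (simp only: of_real_diff of_real_mult of_real_divide complex_norm_square)
        (simp add: field_simps)
  qed
  finally have "complex_of_real (LINT x|cell_measure. (cmod (g x - ?T x))^2)
    = of_real ((LINT x|cell_measure. (cmod (g x))^2)
      + (\<Sum>k\<in>K. V * (cmod (t k - ?c k / V))^2 - (cmod (?c k))^2 / V))"
    by simp
  then show ?thesis
    by (simp only: of_real_eq_iff) (simp add: sum_subtractf sum_distrib_left sum_divide_distrib)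
qed

text \<open>Bessel's inequality and density, both read off from the distance formula above.\<close>

theorem Parseval:
  fixes g :: "real^'n \<Rightarrow> complex"
  assumes g [measurable]: "g \<in> borel_measurable borel" and fin: "energy cell_measure g < top"
  shows "(\<integral>\<^sup>+k. ennreal ((cmod (fourier_coeff g k))^2) \<partial>count_space UNIV)
    = ennreal ((2 * pi) ^ CARD('n)) * energy cell_measure g"
proof (rule nn_integral_count_space_eqI)
  define V where "V = (2 * pi) ^ CARD('n)"
  have V: "V > 0" by (simp add: V_def)
  define I where "I = (LINT x|cell_measure. (cmod (g x))^2)"
  have I0: "0 \<le> I" by (simp add: I_def)
  have E: "energy cell_measure g = ennreal I"
    using fin unfolding I_def by (intro energy_eq_integral) (simp add: energy_finite_integrable)
  note dist = energy_trig_poly_distance[OF g fin, folded V_def I_def]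
  have VI: "ennreal ((2 * pi) ^ CARD('n)) * energy cell_measure g = ennreal (V * I)"
    using V I0 by (simp only: E V_def[symmetric] ennreal_mult less_imp_le)
  have s: "(\<Sum>k\<in>K. ennreal ((cmod (fourier_coeff g k))^2)) = ennreal (\<Sum>k\<in>K. (cmod (fourier_coeff g k))^2)" for K
    by simp
  show "(\<Sum>k\<in>K. ennreal ((cmod (fourier_coeff g k))^2)) \<le> ennreal ((2 * pi) ^ CARD('n)) * energy cell_measure g"
    if "finite K" for K
  proof -
    have "0 \<le> (LINT x|cell_measure. (cmod (g x - (\<Sum>k\<in>K. (fourier_coeff g k / V) * character k x)))^2)"
      by simp
    then have "(\<Sum>k\<in>K. (cmod (fourier_coeff g k))^2) / V \<le> I"
      unfolding dist[OF that] by simp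
    then show ?thesis unfolding s VI using V by (intro ennreal_leI) (simp add: field_simps)
  qed
  fix c assume c: "\<And>K. finite K \<Longrightarrow> (\<Sum>k\<in>K. ennreal ((cmod (fourier_coeff g k))^2)) \<le> c"
  show "ennreal ((2 * pi) ^ CARD('n)) * energy cell_measure g \<le> c"
    unfolding VI
  proof (rule ennreal_le_epsilon)
    fix \<epsilon> :: real assume \<epsilon>: "0 < \<epsilon>"
    then have "\<epsilon> / V > 0" using V by simp
    then obtain t where t: "t \<in> trig_polys" "energy cell_measure (\<lambda>x. g x - t x) \<le> ennreal (\<epsilon> / V)"
      using trig_polys_dense[OF g fin] unfolding approximable_def by blast
    obtain K a where K: "finite K" and ta: "t = (\<lambda>x. \<Sum>k\<in>K. a k * character k x)"
      using trig_polys_eq_sum[OF t(1)] by blast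
    note [measurable] = borel_measurable_trig_polys[OF t(1)]
    have "energy cell_measure (\<lambda>x. g x - t x) < top"
      using t(2) by (simp add: le_less_trans)
    then have "energy cell_measure (\<lambda>x. g x - t x) = ennreal (LINT x|cell_measure. (cmod (g x - t x))^2)"
      by (intro energy_eq_integral) (simp add: energy_finite_integrable)
    then have "(LINT x|cell_measure. (cmod (g x - t x))^2) \<le> \<epsilon> / V"
      using t(2) \<open>\<epsilon> / V > 0\<close> by (simp add: ennreal_le_iff)
    then have "I - (\<Sum>k\<in>K. (cmod (fourier_coeff g k))^2) / V
        + V * (\<Sum>k\<in>K. (cmod (a k - fourier_coeff g k / V))^2) \<le> \<epsilon> / V"
      unfolding ta dist[OF K] .
    moreover have "0 \<le> V * (\<Sum>k\<in>K. (cmod (a k - fourier_coeff g k / V))^2)"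
      using V by (simp add: sum_nonneg)
    ultimately have "I - (\<Sum>k\<in>K. (cmod (fourier_coeff g k))^2) / V \<le> \<epsilon> / V" by linarith
    from mult_left_mono[OF this, of V]
    have "V * I \<le> (\<Sum>k\<in>K. (cmod (fourier_coeff g k))^2) + \<epsilon>"
      using V by (simp add: right_diff_distrib)
    then have "ennreal (V * I) \<le> ennreal (\<Sum>k\<in>K. (cmod (fourier_coeff g k))^2) + ennreal \<epsilon>"
      using \<epsilon> by (simp add: ennreal_leI sum_nonneg flip: ennreal_plus)
    also have "\<dots> \<le> c + ennreal \<epsilon>"
      using c[OF K] unfolding s by (intro add_right_mono)
    finally show "ennreal (V * I) \<le> c + ennreal \<epsilon>" .
  qed
qed

section \<open>Plancherel's theorem for functions of bounded support\<close>

definition fourier_L1 :: "(real^'n \<Rightarrow> complex) \<Rightarrow> real^'n \<Rightarrow> complex" where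
  "fourier_L1 g \<omega> = (LINT x|lborel. g x * cis (- (x \<bullet> \<omega>)))"

text \<open>On these functions the Fourier integral converges absolutely, so no limit is needed to define their
  transform.\<close>

definition L2_bounded :: "(real^'n \<Rightarrow> complex) set" where
  "L2_bounded = {g \<in> L2. \<exists>R. \<forall>x. norm x > R \<longrightarrow> g x = 0}"

lemma borel_measurable_cnj [measurable (raw)]:
  "f \<in> borel_measurable M \<Longrightarrow> (\<lambda>x. cnj (f x)) \<in> borel_measurable M"
  by (rule borel_measurable_continuous_on[of cnj]) (auto intro!: continuous_intros)

lemma L2_measurable [measurable_dest]: "f \<in> L2 \<Longrightarrow> f \<in> borel_measurable borel"
  by (simp add: L2_def)

lemma L2_energy: "f \<in> L2 \<Longrightarrow> energy lborel f < top"
  by (simp add: L2_iff)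

lemma L2_add: "f \<in> L2 \<Longrightarrow> g \<in> L2 \<Longrightarrow> (\<lambda>x. f x + g x) \<in> L2"
  unfolding L2_iff
  by (auto intro!: le_less_trans[OF energy_add_le] simp: ennreal_mult_less_top)

lemma L2_cmult: "f \<in> L2 \<Longrightarrow> (\<lambda>x. c * f x) \<in> L2"
  unfolding L2_iff by (auto simp: energy_cmult ennreal_mult_less_top)

lemma L2_diff: "f \<in> L2 \<Longrightarrow> g \<in> L2 \<Longrightarrow> (\<lambda>x. f x - g x) \<in> L2"
  using L2_add[OF _ L2_cmult[of g "- 1"]] by simp

lemma L2_zero: "(\<lambda>x. 0) \<in> L2"
  by (simp add: L2_iff energy_def)

lemma L2_sum: "finite I \<Longrightarrow> (\<And>i. i \<in> I \<Longrightarrow> f i \<in> L2) \<Longrightarrow> (\<lambda>x. \<Sum>i\<in>I. f i x) \<in> L2"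
  by (induction I rule: finite_induct) (auto simp: L2_zero L2_add)

lemma L2_dominated:
  "g \<in> L2 \<Longrightarrow> f \<in> borel_measurable borel \<Longrightarrow> (\<And>x. cmod (f x) \<le> cmod (g x)) \<Longrightarrow> f \<in> L2"
  unfolding L2_iff energy_def
  by (auto intro!: le_less_trans[OF nn_integral_mono[where v = "\<lambda>x. ennreal ((cmod (g x))^2)"]]
      ennreal_leI power_mono)

lemma L2_bounded_L2: "g \<in> L2_bounded \<Longrightarrow> g \<in> L2"
  by (simp add: L2_bounded_def)

lemma L2_bounded_diff: "f \<in> L2_bounded \<Longrightarrow> g \<in> L2_bounded \<Longrightarrow> (\<lambda>x. f x - g x) \<in> L2_bounded"
proof -
  assume f: "f \<in> L2_bounded" and g: "g \<in> L2_bounded"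
  obtain R where R: "\<And>x. norm x > R \<Longrightarrow> f x = 0" using f by (auto simp: L2_bounded_def)
  obtain S where S: "\<And>x. norm x > S \<Longrightarrow> g x = 0" using g by (auto simp: L2_bounded_def)
  show ?thesis
    using f g R S by (auto simp: L2_bounded_def intro!: L2_diff exI[of _ "max R S"])
qed

lemma L2_mult_cnj_integrable:
  assumes f: "f \<in> L2" and g: "g \<in> L2"
  shows "integrable lborel (\<lambda>x. f x * cnj (g x))"
proof (rule Bochner_Integration.integrable_bound[of lborel "\<lambda>x. (cmod (f x))^2 + (cmod (g x))^2"])
  note [measurable] = L2_measurable[OF f] L2_measurable[OF g]
  show "integrable lborel (\<lambda>x. (cmod (f x))^2 + (cmod (g x))^2)"
    using f g by (simp add: L2_def)
  show "AE x in lborel. norm (f x * cnj (g x)) \<le> norm ((cmod (f x))^2 + (cmod (g x))^2)"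
  proof (rule AE_I2)
    fix x
    have "2 * (cmod (f x) * cmod (g x)) \<le> (cmod (f x))^2 + (cmod (g x))^2"
      using sum_squares_bound[of "cmod (f x)" "cmod (g x)"] by (simp add: mult.assoc)
    moreover have "0 \<le> cmod (f x) * cmod (g x)" by simp
    ultimately have "cmod (f x) * cmod (g x) \<le> (cmod (f x))^2 + (cmod (g x))^2" by linarith
    then show "norm (f x * cnj (g x)) \<le> norm ((cmod (f x))^2 + (cmod (g x))^2)"
      by (simp add: norm_mult)
  qed
  show "(\<lambda>x. f x * cnj (g x)) \<in> borel_measurable lborel" by measurable
qed

lemma L2_bounded_integrable:
  fixes g :: "real^'n \<Rightarrow> complex"
  assumes g: "g \<in> L2_bounded" shows "integrable lborel g"
proof -
  obtain R where R: "\<And>x. norm x > R \<Longrightarrow> g x = 0" using g by (auto simp: L2_bounded_def)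
  have "(indicator (cball 0 R) :: real^'n \<Rightarrow> complex) \<in> L2"
  proof -
    have "energy lborel (indicator (cball 0 R) :: real^'n \<Rightarrow> complex)
      = (\<integral>\<^sup>+x. indicator (cball 0 R) x \<partial>(lborel :: (real^'n) measure))"
      unfolding energy_def by (rule nn_integral_cong) (simp add: indicator_def)
    also have "\<dots> < top" using emeasure_lborel_cball_finite[of "0 :: real^'n" R] by simp
    finally show ?thesis by (simp add: L2_iff borel_measurable_indicator)
  qed
  then have "integrable lborel (\<lambda>x. g x * cnj (indicator (cball 0 R) x))"
    by (intro L2_mult_cnj_integrable L2_bounded_L2[OF g])
  moreover have "g x * cnj (indicator (cball 0 R) x) = g x" for x
    using R[of x] by (auto simp: indicator_def)
  ultimately show ?thesis by simp
qed

lemma integrable_mult_cis: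
  assumes g: "integrable lborel g" and [measurable]: "h \<in> borel_measurable borel"
  shows "integrable lborel (\<lambda>x :: real^'n. g x * cis (h x))"
  by (rule Bochner_Integration.integrable_bound[OF g]) (use g in \<open>auto simp: norm_mult\<close>)

lemma borel_measurable_fourier_L1 [measurable]:
  assumes [measurable]: "g \<in> borel_measurable borel"
  shows "fourier_L1 g \<in> borel_measurable borel"
  unfolding fourier_L1_def[abs_def] by measurable

lemma fourier_L1_diff:
  assumes "integrable lborel f" "integrable lborel g"
  shows "fourier_L1 (\<lambda>x. f x - g x) \<omega> = fourier_L1 f \<omega> - fourier_L1 g \<omega>"
  unfolding fourier_L1_def left_diff_distrib
  by (intro Bochner_Integration.integral_diff integrable_mult_cis assms) auto

lemma integral_cell_measure:
  fixes f :: "real^'n \<Rightarrow> complex"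
  assumes [measurable]: "f \<in> borel_measurable borel" and f: "\<And>x. x \<notin> period_cell \<Longrightarrow> f x = 0"
  shows "(LINT x|cell_measure. f x) = (LINT x|lborel. f x)"
proof -
  have "(LINT x|cell_measure. f x) = (LINT x|lborel. indicator period_cell x *\<^sub>R f x)"
    unfolding cell_measure_def by (rule integral_density) auto
  also have "\<dots> = (LINT x|lborel. f x)"
    by (rule Bochner_Integration.integral_cong) (auto simp: indicator_def f)
  finally show ?thesis .
qed

text \<open>The Fourier integral at the shifted lattice points \<open>k + \<tau>\<close> consists of the Fourier
  coefficients of a modulation of \<open>g\<close>. Parseval's identity therefore gives the same value for every
  \<open>\<tau>\<close>, and averaging over \<open>\<tau>\<close> unfolds to the integral over the whole space.\<close>

lemma Plancherel_cell:
  fixes g :: "real^'n \<Rightarrow> complex"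
  assumes g: "g \<in> L2" and supp: "\<And>x. x \<notin> period_cell \<Longrightarrow> g x = 0"
  shows "energy lborel (fourier_L1 g) = ennreal ((2 * pi) ^ CARD('n)) * energy lborel g"
proof -
  define V where "V = (2 * pi) ^ CARD('n)"
  have V: "V > 0" by (simp add: V_def)
  note [measurable] = L2_measurable[OF g]
  have P: "(\<integral>\<^sup>+k. ennreal ((cmod (fourier_L1 g (\<tau> + real_vec k)))^2) \<partial>count_space UNIV)
    = ennreal V * energy lborel g" for \<tau>
  proof -
    define h where "h x = g x * cis (- (x \<bullet> \<tau>))" for x
    have [measurable]: "h \<in> borel_measurable borel" unfolding h_def by measurable
    have "energy cell_measure h = energy lborel h"
      unfolding energy_def
      by (simp add: nn_integral_cell_measure) (rule nn_integral_cong, auto simp: h_def supp indicator_def)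
    also have "\<dots> = energy lborel g"
      by (simp add: energy_def h_def norm_mult)
    finally have E: "energy cell_measure h = energy lborel g" .
    have c: "fourier_coeff h k = fourier_L1 g (\<tau> + real_vec k)" for k
    proof -
      have "fourier_coeff h k = (LINT x|lborel. h x * character (- k) x)"
        unfolding fourier_coeff_def by (rule integral_cell_measure) (auto simp: h_def supp)
      also have "\<dots> = fourier_L1 g (\<tau> + real_vec k)"
        unfolding fourier_L1_def h_def character_def
        by (rule Bochner_Integration.integral_cong)
          (simp_all add: mult.assoc cis_mult real_vec_simps inner_add_right inner_commute algebra_simps)
      finally show ?thesis .
    qed
    show ?thesis
      using Parseval[of h] L2_energy[OF g] by (simp only: E c V_def) simp
  qed
  have emV: "emeasure cell_measure (UNIV :: (real^'n) set) = ennreal V"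
    by (simp only: emeasure_cell_measure V_def)
  let ?B = "(1 / (2 * pi)) *\<^sub>R mat 1 :: real^'n^'n"
  have B: "?B *v x = (1 / (2 * pi)) *\<^sub>R x" for x :: "real^'n"
    by (simp add: scaleR_matrix_vector_assoc[symmetric])
  have "energy lborel (fourier_L1 g) = ennreal ((1 / (2 * pi)) ^ CARD('n)) *
     (\<integral>\<^sup>+x. (\<integral>\<^sup>+k. ennreal ((cmod (fourier_L1 g (?B *v x + dual_shift ?B k)))^2)
       \<partial>count_space UNIV) \<partial>cell_measure)"
    unfolding energy_def
    by (rule nn_integral_unfold_lattice[where R = "mat 1"]) (auto simp: orthogonal_matrix_id)
  also have "\<dots> = ennreal (1 / V) * (\<integral>\<^sup>+x. ennreal V * energy lborel g \<partial>(cell_measure :: (real^'n) measure))"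
    unfolding dual_shift_def B by (simp add: P V_def power_divide)
  also have "\<dots> = (ennreal (1 / V) * ennreal V) * (ennreal V * energy lborel g)"
    by (simp only: nn_integral_const space_cell_measure emV ac_simps)
  also have "ennreal (1 / V) * ennreal V = 1"
    using V by (simp add: ennreal_mult[symmetric])
  finally show ?thesis by (simp add: V_def)
qed

lemma integral_lborel_scaleR:
  fixes f :: "real^'n \<Rightarrow> complex"
  assumes [measurable]: "f \<in> borel_measurable borel" and "c > 0"
  shows "(LINT x|lborel. f x) = of_real (c ^ CARD('n)) * (LINT x|lborel. f (c *\<^sub>R x))"
proof -
  have "(LINT x|lborel. f x)
    = (LINT x|density (distr lborel borel (\<lambda>x. 0 + c *\<^sub>R x)) (\<lambda>_. ennreal (\<bar>c\<bar> ^ DIM(real^'n))). f x)"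
    using \<open>c > 0\<close> lborel_affine[of c "0::real^'n"] by simp
  also have "\<dots> = (LINT x|distr lborel borel (\<lambda>x. 0 + c *\<^sub>R x). (\<bar>c\<bar> ^ DIM(real^'n)) *\<^sub>R f x)"
    by (rule integral_density) auto
  also have "\<dots> = (LINT x|lborel. (\<bar>c\<bar> ^ DIM(real^'n)) *\<^sub>R f (0 + c *\<^sub>R x))"
    by (rule integral_distr) auto
  also have "\<dots> = of_real (c ^ CARD('n)) * (LINT x|lborel. f (c *\<^sub>R x))"
    using \<open>c > 0\<close> by (simp add: scaleR_conv_of_real)
  finally show ?thesis .
qed

text \<open>A dilation shrinks the support into the cell.\<close>

theorem Plancherel_bounded:
  fixes g :: "real^'n \<Rightarrow> complex"
  assumes g: "g \<in> L2_bounded"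
  shows "energy lborel (fourier_L1 g) = ennreal ((2 * pi) ^ CARD('n)) * energy lborel g"
proof -
  note [measurable] = L2_measurable[OF L2_bounded_L2[OF g]]
  obtain R where R: "\<And>x. norm x > R \<Longrightarrow> g x = 0" using g by (auto simp: L2_bounded_def)
  define c where "c = \<bar>R\<bar> + 1"
  define q where "q = c ^ CARD('n)"
  have c: "c > 0" "c > R" and q: "q > 0" by (auto simp: c_def q_def)
  define h where "h x = g (c *\<^sub>R x)" for x
  have [measurable]: "h \<in> borel_measurable borel" unfolding h_def by measurable
  have Eg: "energy lborel g = ennreal q * energy lborel h"
    unfolding energy_def h_def q_def using c
    by (subst nn_integral_lborel_scaleR[of _ c]) auto
  have supp: "h x = 0" if out: "x \<notin> period_cell" for x
  proof -
    obtain i where "x $ i \<le> - pi \<or> pi < x $ i"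
      using out unfolding period_cell_def mem_Collect_eq by (meson not_le)
    then have "pi \<le> \<bar>x $ i\<bar>" by linarith
    then have "1 \<le> norm x" using component_le_norm_cart[of x i] pi_gt3 by linarith
    then have "c * 1 \<le> c * norm x" using c by (intro mult_left_mono) auto
    then have "R < c * norm x" using c by linarith
    then have "R < norm (c *\<^sub>R x)" using c by simp
    then show ?thesis unfolding h_def by (rule R)
  qed
  have hL2: "h \<in> L2"
    using L2_energy[OF L2_bounded_L2[OF g]] q unfolding L2_iff Eg
    by (auto simp: ennreal_mult_less_top)
  have F: "fourier_L1 g \<omega> = of_real q * fourier_L1 h (c *\<^sub>R \<omega>)" for \<omega>
    unfolding fourier_L1_def h_def q_def using c
    by (subst integral_lborel_scaleR[of _ c]) auto
  have "energy lborel (fourier_L1 g) = ennreal (q^2) * energy lborel (\<lambda>\<omega>. fourier_L1 h (c *\<^sub>R \<omega>))"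
    unfolding F using q by (subst energy_cmult) auto
  also have "\<dots> = ennreal q * (ennreal q * energy lborel (\<lambda>\<omega>. fourier_L1 h (c *\<^sub>R \<omega>)))"
    using q by (simp add: power2_eq_square ennreal_mult mult.assoc)
  also have "ennreal q * energy lborel (\<lambda>\<omega>. fourier_L1 h (c *\<^sub>R \<omega>)) = energy lborel (fourier_L1 h)"
    unfolding energy_def q_def using c by (subst nn_integral_lborel_scaleR[of _ c]) auto
  also have "\<dots> = ennreal ((2 * pi) ^ CARD('n)) * energy lborel h"
    by (rule Plancherel_cell[OF hL2 supp])
  finally show ?thesis by (simp add: Eg ac_simps)
qed

section \<open>The Fourier transform and its inverse on square-integrable functions\<close>

definition truncate :: "real \<Rightarrow> (real^'n \<Rightarrow> complex) \<Rightarrow> real^'n \<Rightarrow> complex" where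
  "truncate R f x = indicator (cball 0 R) x * f x"

lemma truncate_measurable [measurable (raw)]:
  "f \<in> borel_measurable borel \<Longrightarrow> truncate R f \<in> borel_measurable borel"
  unfolding truncate_def[abs_def]
  by (intro borel_measurable_times borel_measurable_indicator) auto

lemma truncate_L2_bounded: "f \<in> L2 \<Longrightarrow> truncate R f \<in> L2_bounded"
  unfolding L2_bounded_def
  by (auto intro!: L2_dominated[of f] exI[of _ R]) (auto simp: truncate_def indicator_def)

lemma energy_truncate_tail:
  fixes f :: "real^'n \<Rightarrow> complex"
  assumes f: "f \<in> L2"
  shows "((\<lambda>R. energy lborel (\<lambda>x. f x - truncate R f x)) \<longlongrightarrow> 0) at_top"
proof -
  note [measurable] = L2_measurable[OF f]
  define T where "T R = energy lborel (\<lambda>x. f x - truncate R f x)" for R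
  have "(\<lambda>m::nat. \<integral>\<^sup>+x. ennreal ((cmod (f x - truncate (real m) f x))^2) \<partial>lborel) \<longlonglongrightarrow> (\<integral>\<^sup>+x. 0 \<partial>(lborel :: (real^'n) measure))"
  proof (rule nn_integral_dominated_convergence[where w = "\<lambda>x. ennreal ((cmod (f x))^2)"])
    show "(\<integral>\<^sup>+x. ennreal ((cmod (f x))^2) \<partial>lborel) < \<infinity>"
      using L2_energy[OF f] by (simp add: energy_def)
    show "AE x in lborel. (\<lambda>m::nat. ennreal ((cmod (f x - truncate (real m) f x))^2)) \<longlonglongrightarrow> 0"
    proof (rule AE_I2)
      fix x :: "real^'n"
      obtain m0 :: nat where m0: "norm x \<le> real m0" using real_arch_simple by blast
      have "\<forall>\<^sub>F m :: nat in sequentially. ennreal ((cmod (f x - truncate (real m) f x))^2) = 0"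
        by (rule eventually_sequentiallyI[of m0]) (use m0 in \<open>auto simp: truncate_def indicator_def\<close>)
      then show "(\<lambda>m::nat. ennreal ((cmod (f x - truncate (real m) f x))^2)) \<longlonglongrightarrow> 0"
        by (rule tendsto_eventually)
    qed
  qed (auto simp: truncate_def indicator_def)
  then have seq: "(\<lambda>m::nat. T (real m)) \<longlonglongrightarrow> 0" by (simp add: T_def energy_def)
  have mono: "T S \<le> T R" if "R \<le> S" for R S
    unfolding T_def energy_def using that
    by (intro nn_integral_mono ennreal_leI power_mono) (auto simp: truncate_def indicator_def)
  have "(T \<longlongrightarrow> 0) at_top"
  proof (rule order_tendstoI)
    fix a :: ennreal assume "0 < a"
    then obtain m :: nat where m: "T (real m) < a"
      using order_tendstoD(2)[OF seq] by (auto simp: eventually_sequentially)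
    then show "\<forall>\<^sub>F R in at_top. T R < a"
      using mono by (auto simp: eventually_at_top_linorder intro!: exI[of _ "real m"] intro: le_less_trans)
  qed simp
  then show ?thesis by (simp add: T_def[abs_def])
qed

lemma L2_tendsto_energy: "L2_tendsto u f F \<longleftrightarrow> ((\<lambda>i. energy lborel (\<lambda>x. u i x - f x)) \<longlongrightarrow> 0) F"
  by (simp add: L2_tendsto_def energy_def)

text \<open>By Plancherel's theorem the truncated transforms are a Cauchy family; a rapidly converging
  subsequence has an almost everywhere limit, and Fatou's lemma shows that the whole family converges
  to it.\<close>

lemma truncated_transforms_converge:
  fixes f :: "real^'n \<Rightarrow> complex"
  assumes f: "f \<in> L2"
  shows "\<exists>F\<in>L2. L2_tendsto (\<lambda>R. fourier_L1 (truncate R f)) F at_top"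
proof -
  note [measurable] = L2_measurable[OF f]
  define V where "V = (2 * pi) ^ CARD('n)"
  have V: "V > 0" by (simp add: V_def)
  define T where "T R = energy lborel (\<lambda>x. f x - truncate R f x)" for R
  have T0: "(T \<longlongrightarrow> 0) at_top"
    using energy_truncate_tail[OF f] by (simp add: T_def[abs_def])
  have diff: "energy lborel (\<lambda>\<omega>. fourier_L1 (truncate S f) \<omega> - fourier_L1 (truncate R f) \<omega>)
    \<le> ennreal V * T R" if "R \<le> S" for R S
  proof -
    have "energy lborel (\<lambda>\<omega>. fourier_L1 (truncate S f) \<omega> - fourier_L1 (truncate R f) \<omega>)
      = energy lborel (fourier_L1 (\<lambda>x. truncate S f x - truncate R f x))"
      by (simp add: energy_def fourier_L1_diff L2_bounded_integrable truncate_L2_bounded f)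
    also have "\<dots> = ennreal V * energy lborel (\<lambda>x. truncate S f x - truncate R f x)"
      unfolding V_def by (intro Plancherel_bounded L2_bounded_diff truncate_L2_bounded f)
    also have "\<dots> \<le> ennreal V * T R"
      unfolding T_def energy_def using that
      by (intro mult_left_mono nn_integral_mono ennreal_leI power_mono) (auto simp: truncate_def indicator_def)
    finally show ?thesis .
  qed
  have "\<exists>R. \<forall>S\<ge>R. T S \<le> ennreal ((1/4)^m)" for m :: nat
  proof -
    have "\<forall>\<^sub>F S in at_top. T S < ennreal ((1/4)^m)"
      by (rule order_tendstoD(2)[OF T0]) simp
    then show ?thesis by (auto simp: eventually_at_top_linorder intro: less_imp_le)
  qed
  then obtain \<rho> where \<rho>: "\<And>m S. \<rho> m \<le> S \<Longrightarrow> T S \<le> ennreal ((1/4)^m)" by metis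
  (* Increasing radii, large enough for the m-th tail bound and tending to infinity. *)
  define s where "s m = real m + (\<Sum>i\<le>m. \<bar>\<rho> i\<bar>)" for m
  have s_ge: "\<rho> m \<le> s m" and s_ge': "real m \<le> s m" for m
  proof -
    have "\<bar>\<rho> m\<bar> \<le> (\<Sum>i\<le>m. \<bar>\<rho> i\<bar>)" by (rule member_le_sum) auto
    then show "\<rho> m \<le> s m" "real m \<le> s m" by (auto simp: s_def sum_nonneg)
  qed
  have s_mono: "s m \<le> s (Suc m)" for m by (simp add: s_def)
  define u where "u m = fourier_L1 (truncate (s m) f)" for m
  have [measurable]: "u m \<in> borel_measurable borel" for m unfolding u_def by measurable
  have "\<exists>F\<in>borel_measurable lborel. AE \<omega> in lborel. (\<lambda>m. u m \<omega>) \<longlonglongrightarrow> F \<omega>"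
  proof (rule fast_Cauchy_AE_convergent)
    fix m
    have "energy lborel (\<lambda>\<omega>. u (Suc m) \<omega> - u m \<omega>) \<le> ennreal V * T (s m)"
      unfolding u_def by (rule diff[OF s_mono])
    also have "\<dots> \<le> ennreal V * ennreal ((1/4)^m)"
      by (intro mult_left_mono \<rho> s_ge) auto
    also have "\<dots> = ennreal (V * (1/4)^m)"
      using V by (intro ennreal_mult[symmetric]) auto
    finally show "energy lborel (\<lambda>\<omega>. u (Suc m) \<omega> - u m \<omega>) \<le> ennreal (V * (1/4)^m)" .
  qed (use V in auto)
  then obtain F where F: "F \<in> borel_measurable lborel" and lim: "AE \<omega> in lborel. (\<lambda>m. u m \<omega>) \<longlonglongrightarrow> F \<omega>"
    by blast
  note [measurable] = F
  have le: "energy lborel (\<lambda>\<omega>. fourier_L1 (truncate R f) \<omega> - F \<omega>) \<le> ennreal V * T R" for R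
  proof -
    obtain m0 :: nat where m0: "R \<le> real m0" using real_arch_simple by blast
    show ?thesis
    proof (rule energy_Fatou[OF _ _ lim, where k = m0])
      fix m assume "m \<ge> m0"
      then have "R \<le> s m" using m0 s_ge'[of m] by linarith
      then show "energy lborel (\<lambda>\<omega>. fourier_L1 (truncate R f) \<omega> - u m \<omega>) \<le> ennreal V * T R"
        using diff[of R "s m"] unfolding u_def by (simp add: energy_minus_commute)
    qed measurable
  qed
  have tend: "L2_tendsto (\<lambda>R. fourier_L1 (truncate R f)) F at_top"
    unfolding L2_tendsto_energy
  proof (rule tendsto_sandwich[OF _ _ tendsto_const])
    show "((\<lambda>R. ennreal V * T R) \<longlongrightarrow> 0) at_top"
      using tendsto_mult_ennreal[OF tendsto_const T0, of "ennreal V"] by simp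
  qed (use le in auto)
  have "F \<in> L2"
  proof -
    have "energy lborel (\<lambda>\<omega>. fourier_L1 (truncate 0 f) \<omega> - F \<omega>) \<le> ennreal V * T 0" by (rule le)
    also have "T 0 < top"
      unfolding T_def by (intro L2_energy L2_diff f L2_bounded_L2 truncate_L2_bounded)
    then have "ennreal V * T 0 < top" by (simp add: ennreal_mult_less_top)
    finally have "(\<lambda>\<omega>. fourier_L1 (truncate 0 f) \<omega> - F \<omega>) \<in> L2" by (simp add: L2_iff)
    moreover have "fourier_L1 (truncate 0 f) \<in> L2"
      using L2_energy[OF L2_bounded_L2[OF truncate_L2_bounded[OF f]], of 0]
      by (simp add: L2_iff Plancherel_bounded[OF truncate_L2_bounded[OF f]] ennreal_mult_less_top
          del: ennreal_power)
    ultimately show ?thesis using L2_diff by fastforce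
  qed
  then show ?thesis using tend by blast
qed

definition inv_fourier_L1 :: "(real^'n \<Rightarrow> complex) \<Rightarrow> real^'n \<Rightarrow> complex" where
  "inv_fourier_L1 g x = of_real (1 / (2 * pi) ^ CARD('n)) * fourier_L1 g (- x)"

lemma borel_measurable_inv_fourier_L1 [measurable]:
  assumes [measurable]: "g \<in> borel_measurable borel"
  shows "inv_fourier_L1 g \<in> borel_measurable borel"
  unfolding inv_fourier_L1_def[abs_def] by measurable

lemma energy_reflect:
  fixes f :: "real^'n \<Rightarrow> complex"
  assumes [measurable]: "f \<in> borel_measurable borel"
  shows "energy lborel (\<lambda>x. f (- x)) = energy lborel f"
proof -
  have "orthogonal_matrix (- mat 1 :: real^'n^'n)"
    by (simp add: orthogonal_matrix_def transpose_def matrix_matrix_mult_def mat_def vec_eq_iff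
        if_distrib[of "\<lambda>x. x * _"] cong: if_cong)
  then have "(\<integral>\<^sup>+x. ennreal ((cmod (f (- mat 1 *v x)))^2) \<partial>lborel) = energy lborel f"
    unfolding energy_def by (rule nn_integral_lborel_orthogonal[rotated]) measurable
  moreover have "- mat 1 *v x = - x" for x :: "real^'n"
  proof -
    have "- mat 1 *v x = ((- 1) *\<^sub>R mat 1) *v x" by simp
    also have "\<dots> = - x" by (simp only: scaleR_matrix_vector_assoc[symmetric]) simp
    finally show ?thesis .
  qed
  ultimately show ?thesis by (simp add: energy_def)
qed

lemma energy_inv_fourier_L1:
  fixes g :: "real^'n \<Rightarrow> complex"
  assumes g: "g \<in> L2_bounded"
  shows "energy lborel (inv_fourier_L1 g) = ennreal (1 / (2 * pi) ^ CARD('n)) * energy lborel g"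
proof -
  define V where "V = (2 * pi) ^ CARD('n)"
  have V: "V > 0" by (simp add: V_def)
  note [measurable] = L2_measurable[OF L2_bounded_L2[OF g]]
  have "energy lborel (inv_fourier_L1 g) = ennreal ((1 / V)^2) * energy lborel (\<lambda>x. fourier_L1 g (- x))"
    unfolding inv_fourier_L1_def V_def[symmetric] using V by (subst energy_cmult) (auto simp: norm_divide)
  also have "\<dots> = ennreal ((1 / V)^2) * (ennreal V * energy lborel g)"
    by (simp only: energy_reflect borel_measurable_fourier_L1 L2_measurable L2_bounded_L2 g
        Plancherel_bounded V_def)
  also have "\<dots> = ennreal ((1 / V)^2 * V) * energy lborel g"
    using V by (simp add: ennreal_mult mult.assoc)
  also have "(1 / V)^2 * V = 1 / V"
    using V by (simp add: power2_eq_square)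
  finally show ?thesis by (simp only: V_def)
qed

lemma set_integral_cball_cis:
  "(LINT x:cball 0 R|lborel. f x * cis (- (x \<bullet> \<omega>))) = fourier_L1 (truncate R f) \<omega>"
  unfolding set_lebesgue_integral_def fourier_L1_def truncate_def
  by (rule Bochner_Integration.integral_cong) (auto simp: indicator_def)

lemma set_integral_cball_inv_cis:
  "of_real (1 / (2 * pi) ^ CARD('n)) * (LINT \<omega>:cball 0 R|lborel. g \<omega> * cis (x \<bullet> \<omega>))
    = inv_fourier_L1 (truncate R g) x" for x :: "real^'n"
  using set_integral_cball_cis[of R g "- x"] by (simp add: inv_fourier_L1_def inner_commute)

text \<open>The limits that \<open>fourier\<close> and \<open>inv_fourier\<close> choose exist, so both choices have their defining
  properties.\<close>

lemma fourier_L2: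
  assumes "f \<in> L2"
  shows "fourier f \<in> L2" "L2_tendsto (\<lambda>R. fourier_L1 (truncate R f)) (fourier f) at_top"
proof -
  have "\<exists>F. F \<in> L2 \<and> L2_tendsto (\<lambda>R \<omega>. LINT x:cball 0 R|lborel. f x * cis (- (x \<bullet> \<omega>))) F at_top"
    using truncated_transforms_converge[OF assms] by (auto simp: set_integral_cball_cis)
  from someI_ex[OF this]
  show "fourier f \<in> L2" "L2_tendsto (\<lambda>R. fourier_L1 (truncate R f)) (fourier f) at_top"
    by (simp_all add: fourier_def set_integral_cball_cis)
qed

lemma tendsto_ennreal_mult_0:
  assumes "((f :: _ \<Rightarrow> ennreal) \<longlongrightarrow> 0) F" "c < top"
  shows "((\<lambda>x. c * f x) \<longlongrightarrow> 0) F"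
  using ennreal_tendsto_cmult[OF assms(2,1)] by simp

lemma tendsto_ennreal_le_0:
  assumes "((g :: _ \<Rightarrow> ennreal) \<longlongrightarrow> 0) F" "\<And>x. f x \<le> g x"
  shows "(f \<longlongrightarrow> 0) F"
  by (rule tendsto_sandwich[OF _ _ tendsto_const assms(1)]) (use assms(2) in auto)

lemma inv_fourier_L2:
  fixes g :: "real^'n \<Rightarrow> complex"
  assumes g: "g \<in> L2"
  shows "inv_fourier g \<in> L2" "L2_tendsto (\<lambda>R. inv_fourier_L1 (truncate R g)) (inv_fourier g) at_top"
proof -
  define c :: complex where "c = of_real (1 / (2 * pi) ^ CARD('n))"
  note [measurable] = L2_measurable[OF g]
  obtain F where F: "F \<in> L2" and lim: "L2_tendsto (\<lambda>R. fourier_L1 (truncate R g)) F at_top"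
    using truncated_transforms_converge[OF g] by blast
  note [measurable] = L2_measurable[OF F]
  define G where "G x = c * F (- x)" for x
  have "(\<lambda>x. F (- x)) \<in> L2"
    using F by (simp add: L2_iff energy_reflect)
  then have "G \<in> L2" unfolding G_def by (rule L2_cmult)
  have "energy lborel (\<lambda>x. inv_fourier_L1 (truncate R g) x - G x)
    = ennreal ((cmod c)^2) * energy lborel (\<lambda>x. fourier_L1 (truncate R g) x - F x)" for R
  proof -
    have "energy lborel (\<lambda>x. inv_fourier_L1 (truncate R g) x - G x)
      = energy lborel (\<lambda>x. c * (fourier_L1 (truncate R g) (- x) - F (- x)))"
      by (simp only: inv_fourier_L1_def G_def c_def right_diff_distrib)
    also have "\<dots> = ennreal ((cmod c)^2) * energy lborel (\<lambda>x. fourier_L1 (truncate R g) (- x) - F (- x))"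
      by (rule energy_cmult) measurable
    also have "energy lborel (\<lambda>x. fourier_L1 (truncate R g) (- x) - F (- x))
      = energy lborel (\<lambda>x. fourier_L1 (truncate R g) x - F x)"
      by (rule energy_reflect) measurable
    finally show ?thesis .
  qed
  then have "L2_tendsto (\<lambda>R. inv_fourier_L1 (truncate R g)) G at_top"
    using lim unfolding L2_tendsto_energy by (simp add: tendsto_ennreal_mult_0)
  then have "\<exists>f. f \<in> L2 \<and> L2_tendsto (\<lambda>R x. of_real (1 / (2 * pi) ^ CARD('n)) *
        (LINT \<omega>:cball 0 R|lborel. g \<omega> * cis (x \<bullet> \<omega>))) f at_top"
    using \<open>G \<in> L2\<close> unfolding set_integral_cball_inv_cis by blast
  from someI_ex[OF this]
  show "inv_fourier g \<in> L2" "L2_tendsto (\<lambda>R. inv_fourier_L1 (truncate R g)) (inv_fourier g) at_top"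
    unfolding inv_fourier_def set_integral_cball_inv_cis by blast+
qed

text \<open>Fubini's theorem moves the exponential from one factor to the other.\<close>

lemma inv_fourier_L1_adjoint:
  fixes g h :: "real^'n \<Rightarrow> complex"
  assumes g: "integrable lborel g" and h: "integrable lborel h"
  shows "(LINT x|lborel. g x * cnj (inv_fourier_L1 h x))
    = of_real (1 / (2 * pi) ^ CARD('n)) * (LINT \<omega>|lborel. fourier_L1 g \<omega> * cnj (h \<omega>))"
proof -
  define c :: complex where "c = of_real (1 / (2 * pi) ^ CARD('n))"
  have [measurable]: "g \<in> borel_measurable borel" "h \<in> borel_measurable borel"
    using g h by auto
  have hc: "integrable lborel (\<lambda>\<omega>. cnj (h \<omega>))"
    using h by (rule integrable_bounded_linear[OF bounded_linear_cnj])
  have inner: "g x * cnj (inv_fourier_L1 h x)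
    = c * (LINT \<omega>|lborel. g x * cnj (h \<omega>) * cis (- (x \<bullet> \<omega>)))" for x
  proof -
    have "cnj (fourier_L1 h (- x)) = (LINT \<omega>|lborel. cnj (h \<omega> * cis (- (\<omega> \<bullet> - x))))"
      unfolding fourier_L1_def
      by (rule integral_bounded_linear[OF bounded_linear_cnj, symmetric]) (intro integrable_mult_cis h, measurable)
    also have "\<dots> = (LINT \<omega>|lborel. cnj (h \<omega>) * cis (- (x \<bullet> \<omega>)))"
      by (rule Bochner_Integration.integral_cong) (simp_all add: cis_cnj inner_commute)
    finally show ?thesis
      by (simp add: inv_fourier_L1_def c_def mult.assoc)
  qed
  have "(LINT x|lborel. g x * cnj (inv_fourier_L1 h x))
    = c * (LINT x|lborel. (LINT \<omega>|lborel. g x * cnj (h \<omega>) * cis (- (x \<bullet> \<omega>))))"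
    unfolding inner by simp
  also have "(LINT x|lborel. (LINT \<omega>|lborel. g x * cnj (h \<omega>) * cis (- (x \<bullet> \<omega>))))
    = (LINT \<omega>|lborel. (LINT x|lborel. g x * cnj (h \<omega>) * cis (- (x \<bullet> \<omega>))))"
  proof (rule lborel_pair.Fubini_integral[symmetric])
    show "integrable (lborel \<Otimes>\<^sub>M lborel) (\<lambda>(x, \<omega>). g x * cnj (h \<omega>) * cis (- (x \<bullet> \<omega>)))"
    proof (rule lborel_pair.Fubini_integrable)
      show "integrable lborel (\<lambda>x. LINT \<omega>|lborel. norm (case (x, \<omega>) of (x, \<omega>) \<Rightarrow> g x * cnj (h \<omega>) * cis (- (x \<bullet> \<omega>))))"
        using g by (simp add: norm_mult)
      show "AE x in lborel. integrable lborel (\<lambda>\<omega>. case (x, \<omega>) of (x, \<omega>) \<Rightarrow> g x * cnj (h \<omega>) * cis (- (x \<bullet> \<omega>)))"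
        by (simp, intro AE_I2 integrable_mult_cis integrable_mult_right hc, measurable)
      have "(\<lambda>(x, \<omega>). g x * cnj (h \<omega>) * cis (- (x \<bullet> \<omega>))) \<in> borel_measurable (borel \<Otimes>\<^sub>M borel)"
        by measurable
      also have "borel_measurable (borel \<Otimes>\<^sub>M borel) = borel_measurable (lborel \<Otimes>\<^sub>M (lborel :: (real^'n) measure))"
        by (intro measurable_cong_sets sets_pair_measure_cong) auto
      finally show "(\<lambda>(x, \<omega>). g x * cnj (h \<omega>) * cis (- (x \<bullet> \<omega>))) \<in> borel_measurable (lborel \<Otimes>\<^sub>M lborel)" .
    qed
  qed
  also have "\<dots> = (LINT \<omega>|lborel. fourier_L1 g \<omega> * cnj (h \<omega>))"
    unfolding fourier_L1_def
    by (rule Bochner_Integration.integral_cong)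
      (simp_all add: mult.assoc mult.commute[of "cnj (h _)"] flip: Bochner_Integration.integral_mult_left_zero)
  finally show ?thesis by (simp only: c_def)
qed

text \<open>For bounded support the error of the truncated inverse transform can be computed: expanding the
  square, all terms reduce to energies of the truncated transform.\<close>

lemma energy_truncated_inversion_bounded:
  fixes g :: "real^'n \<Rightarrow> complex"
  assumes g: "g \<in> L2_bounded"
  defines "G \<equiv> fourier_L1 g"
  shows "energy lborel (\<lambda>x. g x - inv_fourier_L1 (truncate R G) x)
    = ennreal (1 / (2 * pi) ^ CARD('n)) * energy lborel (\<lambda>\<omega>. G \<omega> - truncate R G \<omega>)"
proof -
  define V where "V = (2 * pi) ^ CARD('n)"
  have V: "V > 0" by (simp add: V_def)
  have gL2: "g \<in> L2" using g by (rule L2_bounded_L2)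
  note [measurable] = L2_measurable[OF gL2]
  have [measurable]: "G \<in> borel_measurable borel" unfolding G_def by measurable
  have EG: "energy lborel G = ennreal V * energy lborel g"
    unfolding G_def V_def by (rule Plancherel_bounded[OF g])
  then have GL2: "G \<in> L2"
    using L2_energy[OF gL2] by (simp add: L2_iff ennreal_mult_less_top)
  define h where "h = truncate R G"
  have hb: "h \<in> L2_bounded" unfolding h_def by (rule truncate_L2_bounded[OF GL2])
  have hL2: "h \<in> L2" using hb by (rule L2_bounded_L2)
  note [measurable] = L2_measurable[OF hL2]
  define b where "b = inv_fourier_L1 h"
  have Eb: "energy lborel b = ennreal (1 / V) * energy lborel h"
    unfolding b_def V_def by (rule energy_inv_fourier_L1[OF hb])
  have [measurable]: "b \<in> borel_measurable borel" unfolding b_def by measurable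
  have bL2: "b \<in> L2"
    using Eb L2_energy[OF hL2] by (simp add: L2_iff ennreal_mult_less_top)
  define N where "N f = (LINT x|lborel. (cmod (f x))^2)" for f :: "real^'n \<Rightarrow> complex"
  have N: "energy lborel f = ennreal (N f)" "0 \<le> N f" if "f \<in> L2" for f
    using that by (simp_all add: N_def energy_eq_integral L2_def)
  have NG: "N G = V * N g"
    using EG V by (simp add: N gL2 GL2 ennreal_mult[symmetric])
  have Nb: "N b = N h / V"
    using Eb V by (simp add: N hL2 bL2 ennreal_mult[symmetric])
  have sq: "(LINT x|lborel. f x * cnj (f x)) = complex_of_real (N f)" for f :: "real^'n \<Rightarrow> complex"
    unfolding N_def complex_norm_square[symmetric] by (rule integral_complex_of_real)
  have gb: "(LINT x|lborel. g x * cnj (b x)) = of_real (N h / V)"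
  proof -
    have "(LINT x|lborel. g x * cnj (b x)) = of_real (1 / V) * (LINT \<omega>|lborel. G \<omega> * cnj (h \<omega>))"
      unfolding b_def G_def V_def
      by (rule inv_fourier_L1_adjoint) (intro L2_bounded_integrable g hb)+
    also have "(LINT \<omega>|lborel. G \<omega> * cnj (h \<omega>)) = (LINT \<omega>|lborel. h \<omega> * cnj (h \<omega>))"
      by (rule Bochner_Integration.integral_cong) (auto simp: h_def truncate_def indicator_def)
    finally show ?thesis by (simp add: sq)
  qed
  have dist: "N (\<lambda>x. u x - v x) = N u + N v - 2 * c"
    if u: "u \<in> L2" and v: "v \<in> L2" and c: "(LINT x|lborel. u x * cnj (v x)) = complex_of_real c" for u v c
  proof -
    note iu = L2_mult_cnj_integrable[OF u u] and iv = L2_mult_cnj_integrable[OF v v]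
      and iuv = L2_mult_cnj_integrable[OF u v]
    have iuv': "integrable lborel (\<lambda>x. cnj (u x * cnj (v x)))"
      using iuv by (rule integrable_bounded_linear[OF bounded_linear_cnj])
    have c': "(LINT x|lborel. cnj (u x * cnj (v x))) = complex_of_real c"
      using integral_bounded_linear[OF bounded_linear_cnj iuv] by (simp add: c)
    have "complex_of_real (N (\<lambda>x. u x - v x))
      = (LINT x|lborel. u x * cnj (u x) - u x * cnj (v x) - cnj (u x * cnj (v x)) + v x * cnj (v x))"
      unfolding sq[symmetric] by (rule Bochner_Integration.integral_cong) (simp_all add: algebra_simps)
    also have "\<dots> = of_real (N u) - of_real c - of_real c + of_real (N v)"
      by (simp only: Bochner_Integration.integral_add Bochner_Integration.integral_diff
          Bochner_Integration.integrable_diff iu iv iuv iuv' sq c c')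
    also have "\<dots> = of_real (N u + N v - 2 * c)" by simp
    finally show ?thesis by (simp only: of_real_eq_iff)
  qed
  have "N (\<lambda>x. g x - b x) = N g - N h / V"
    using dist[OF gL2 bL2 gb] Nb by simp
  also have "\<dots> = (1 / V) * (N G - N h)"
    using V NG by (simp add: field_simps)
  also have "N G - N h = N (\<lambda>\<omega>. G \<omega> - h \<omega>)"
  proof -
    have "(LINT \<omega>|lborel. G \<omega> * cnj (h \<omega>)) = (LINT \<omega>|lborel. h \<omega> * cnj (h \<omega>))"
      by (rule Bochner_Integration.integral_cong) (auto simp: h_def truncate_def indicator_def)
    then show ?thesis using dist[OF GL2 hL2, of "N h"] by (simp add: sq)
  qed
  finally have "ennreal (N (\<lambda>x. g x - b x)) = ennreal (1 / V) * ennreal (N (\<lambda>\<omega>. G \<omega> - h \<omega>))"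
    using V N(2)[OF L2_diff[OF GL2 hL2]] by (simp add: ennreal_mult[symmetric])
  then show ?thesis
    unfolding V_def[symmetric] h_def[symmetric] b_def[symmetric]
    by (simp only: N(1) L2_diff gL2 bL2 GL2 hL2)
qed

lemma inv_fourier_L1_diff:
  assumes "integrable lborel f" "integrable lborel g"
  shows "inv_fourier_L1 (\<lambda>x. f x - g x) x = inv_fourier_L1 f x - inv_fourier_L1 g x"
  by (simp add: inv_fourier_L1_def fourier_L1_diff assms right_diff_distrib)

lemma energy_truncate_le: "energy lborel (truncate R f) \<le> energy lborel f"
  unfolding energy_def truncate_def
  by (intro nn_integral_mono ennreal_leI power_mono) (auto simp: indicator_def)

text \<open>For truncations of \<open>f\<close> the error formula above applies; the passage to \<open>f\<close> uses that the truncated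
  inverse transform does not increase energies.\<close>

theorem Fourier_inversion:
  fixes f :: "real^'n \<Rightarrow> complex"
  assumes f: "f \<in> L2"
  shows "L2_tendsto (\<lambda>R. inv_fourier_L1 (truncate R (fourier f))) f at_top"
  unfolding L2_tendsto_energy
proof (rule order_tendstoI)
  define V where "V = (2 * pi) ^ CARD('n)"
  have V: "V \<ge> 1" unfolding V_def using pi_gt3 by (intro one_le_power) linarith
  define F where "F = fourier f"
  have FL2: "F \<in> L2" and lim: "L2_tendsto (\<lambda>R. fourier_L1 (truncate R f)) F at_top"
    using fourier_L2[OF f] by (simp_all add: F_def)
  note [measurable] = L2_measurable[OF f] L2_measurable[OF FL2]
  fix a :: ennreal assume "0 < a"
  (* The three errors below enter with the weights 2, 4 and 4. *)
  obtain e :: real where e: "e > 0" "10 * ennreal e < a"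
  proof -
    obtain b where b: "0 < b" "b < a" using dense[OF \<open>0 < a\<close>] by blast
    then obtain r where r: "b = ennreal r" "0 \<le> r" by (cases b) auto
    then have "0 < r" using b(1) by simp
    have "10 * ennreal (r / 10) = ennreal (10 * (r / 10))"
      using r(2) by (subst ennreal_mult) auto
    then have "10 * ennreal (r / 10) = b" using r(1) by simp
    then show thesis using that[of "r / 10"] \<open>0 < r\<close> b(2) by simp
  qed
  have "\<forall>\<^sub>F S in at_top. energy lborel (\<lambda>x. f x - truncate S f x) < ennreal e"
    using e by (intro order_tendstoD(2)[OF energy_truncate_tail[OF f]]) simp
  moreover have "\<forall>\<^sub>F S in at_top. energy lborel (\<lambda>\<omega>. fourier_L1 (truncate S f) \<omega> - F \<omega>) < ennreal e"
    using e lim unfolding L2_tendsto_energy by (intro order_tendstoD(2)) auto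
  ultimately have "\<forall>\<^sub>F S in at_top. energy lborel (\<lambda>x. f x - truncate S f x) < ennreal e
      \<and> energy lborel (\<lambda>\<omega>. fourier_L1 (truncate S f) \<omega> - F \<omega>) < ennreal e"
    by eventually_elim simp
  then obtain S where S: "energy lborel (\<lambda>x. f x - truncate S f x) < ennreal e"
      "energy lborel (\<lambda>\<omega>. fourier_L1 (truncate S f) \<omega> - F \<omega>) < ennreal e"
    by (auto simp: eventually_at_top_linorder)
  define g where "g = truncate S f"
  define G where "G = fourier_L1 g"
  have gb: "g \<in> L2_bounded" unfolding g_def by (rule truncate_L2_bounded[OF f])
  note [measurable] = L2_measurable[OF L2_bounded_L2[OF gb]]
  have GL2: "G \<in> L2"
    using L2_energy[OF L2_bounded_L2[OF gb]] Plancherel_bounded[OF gb]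
    by (simp add: L2_iff G_def ennreal_mult_less_top del: ennreal_power)
  note [measurable] = L2_measurable[OF GL2]
  have "\<forall>\<^sub>F R in at_top. energy lborel (\<lambda>\<omega>. G \<omega> - truncate R G \<omega>) < ennreal e"
    using e by (intro order_tendstoD(2)[OF energy_truncate_tail[OF GL2]]) simp
  then show "\<forall>\<^sub>F R in at_top. energy lborel (\<lambda>x. inv_fourier_L1 (truncate R (fourier f)) x - f x) < a"
  proof eventually_elim
    fix R assume R: "energy lborel (\<lambda>\<omega>. G \<omega> - truncate R G \<omega>) < ennreal e"
    have V1: "ennreal (1 / V) \<le> 1" using V by simp
    have 1: "energy lborel (\<lambda>x. g x - inv_fourier_L1 (truncate R G) x) \<le> ennreal e"
    proof -
      have "energy lborel (\<lambda>x. g x - inv_fourier_L1 (truncate R G) x)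
        = ennreal (1 / V) * energy lborel (\<lambda>\<omega>. G \<omega> - truncate R G \<omega>)"
        unfolding G_def V_def by (rule energy_truncated_inversion_bounded[OF gb])
      also have "\<dots> \<le> 1 * ennreal e" using R V1 by (intro mult_mono) auto
      finally show ?thesis by simp
    qed
    have 2: "energy lborel (\<lambda>x. inv_fourier_L1 (truncate R G) x - inv_fourier_L1 (truncate R F) x) \<le> ennreal e"
    proof -
      have "energy lborel (\<lambda>x. inv_fourier_L1 (truncate R G) x - inv_fourier_L1 (truncate R F) x)
        = energy lborel (inv_fourier_L1 (truncate R (\<lambda>\<omega>. G \<omega> - F \<omega>)))"
      proof -
        have "truncate R (\<lambda>\<omega>. G \<omega> - F \<omega>) = (\<lambda>\<omega>. truncate R G \<omega> - truncate R F \<omega>)"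
          by (simp add: truncate_def fun_eq_iff right_diff_distrib)
        then show ?thesis
          by (simp add: inv_fourier_L1_diff L2_bounded_integrable truncate_L2_bounded GL2 FL2 energy_def)
      qed
      also have "\<dots> = ennreal (1 / V) * energy lborel (truncate R (\<lambda>\<omega>. G \<omega> - F \<omega>))"
        unfolding V_def by (intro energy_inv_fourier_L1 truncate_L2_bounded L2_diff GL2 FL2)
      also have "\<dots> \<le> 1 * energy lborel (\<lambda>\<omega>. G \<omega> - F \<omega>)"
        using V1 energy_truncate_le by (intro mult_mono) auto
      also have "\<dots> \<le> ennreal e" using S(2) by (simp add: G_def g_def)
      finally show ?thesis .
    qed
    have "energy lborel (\<lambda>x. inv_fourier_L1 (truncate R F) x - f x)
      = energy lborel (\<lambda>x. f x - inv_fourier_L1 (truncate R F) x)"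
      by (rule energy_minus_commute)
    also have "\<dots> \<le> 2 * energy lborel (\<lambda>x. f x - g x) + 2 * energy lborel (\<lambda>x. g x - inv_fourier_L1 (truncate R F) x)"
      by (rule energy_diff_le) measurable
    also have "\<dots> \<le> 2 * ennreal e + 2 * (2 * ennreal e + 2 * ennreal e)"
    proof (intro add_mono mult_left_mono)
      show "energy lborel (\<lambda>x. f x - g x) \<le> ennreal e" using S(1) by (simp add: g_def)
      have "energy lborel (\<lambda>x. g x - inv_fourier_L1 (truncate R F) x)
        \<le> 2 * energy lborel (\<lambda>x. g x - inv_fourier_L1 (truncate R G) x)
          + 2 * energy lborel (\<lambda>x. inv_fourier_L1 (truncate R G) x - inv_fourier_L1 (truncate R F) x)"
        by (rule energy_diff_le) measurable
      also have "\<dots> \<le> 2 * ennreal e + 2 * ennreal e"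
        by (intro add_mono mult_left_mono 1 2) auto
      finally show "energy lborel (\<lambda>x. g x - inv_fourier_L1 (truncate R F) x) \<le> 2 * ennreal e + 2 * ennreal e" .
    qed auto
    also have "\<dots> = 10 * ennreal e"
    proof -
      have "2 * x + 2 * (2 * x + 2 * x) = 10 * x" for x :: ennreal
        by (simp add: distrib_left mult.assoc[symmetric] flip: distrib_right)
      then show ?thesis .
    qed
    also have "\<dots> < a" by (rule e)
    finally show "energy lborel (\<lambda>x. inv_fourier_L1 (truncate R (fourier f)) x - f x) < a"
      by (simp add: F_def)
  qed
qed simp

section \<open>Splines in the Fourier domain\<close>

lemma L2_tendsto_add:
  assumes u: "L2_tendsto u f F" and v: "L2_tendsto v g F"
    and [measurable]: "\<And>i. u i \<in> borel_measurable borel" "\<And>i. v i \<in> borel_measurable borel"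
      "f \<in> borel_measurable borel" "g \<in> borel_measurable borel"
  shows "L2_tendsto (\<lambda>i x. u i x + v i x) (\<lambda>x. f x + g x) F"
  unfolding L2_tendsto_energy
proof (rule tendsto_ennreal_le_0)
  have "((\<lambda>i. 2 * energy lborel (\<lambda>x. u i x - f x) + 2 * energy lborel (\<lambda>x. v i x - g x)) \<longlongrightarrow> 0 + 0) F"
    using u v unfolding L2_tendsto_energy by (intro tendsto_add tendsto_ennreal_mult_0) auto
  then show "((\<lambda>i. 2 * energy lborel (\<lambda>x. u i x - f x) + 2 * energy lborel (\<lambda>x. v i x - g x)) \<longlongrightarrow> 0) F"
    by simp
  show "energy lborel (\<lambda>x. u i x + v i x - (f x + g x))
    \<le> 2 * energy lborel (\<lambda>x. u i x - f x) + 2 * energy lborel (\<lambda>x. v i x - g x)" for i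
    using energy_add_le[of "\<lambda>x. u i x - f x" lborel "\<lambda>x. v i x - g x"] by (simp add: add_diff_add)
qed

lemma L2_tendsto_cmult:
  assumes u: "L2_tendsto u f F"
    and [measurable]: "\<And>i. u i \<in> borel_measurable borel" "f \<in> borel_measurable borel"
  shows "L2_tendsto (\<lambda>i x. c * u i x) (\<lambda>x. c * f x) F"
proof -
  have "energy lborel (\<lambda>x. c * u i x - c * f x) = ennreal ((cmod c)^2) * energy lborel (\<lambda>x. u i x - f x)" for i
    by (subst energy_cmult[symmetric]) (auto simp: right_diff_distrib)
  then show ?thesis
    using u unfolding L2_tendsto_energy by (simp add: tendsto_ennreal_mult_0)
qed

lemma energy_translate:
  fixes f :: "real^'n \<Rightarrow> complex"
  assumes [measurable]: "f \<in> borel_measurable borel"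
  shows "energy lborel (\<lambda>x. f (x - a)) = energy lborel f"
  using nn_integral_lborel_translate[of "\<lambda>x. ennreal ((cmod (f x))^2)" "- a"] by (simp add: energy_def)

lemma L2_translate: "f \<in> L2 \<Longrightarrow> (\<lambda>x. f (x - a)) \<in> L2"
proof -
  assume f: "f \<in> L2"
  note [measurable] = L2_measurable[OF f]
  show ?thesis using L2_energy[OF f] by (simp add: L2_iff energy_translate)
qed

lemma L2_tendsto_translate:
  fixes u :: "'i \<Rightarrow> real^'n \<Rightarrow> complex"
  assumes u: "L2_tendsto u f F"
    and [measurable]: "\<And>i. u i \<in> borel_measurable borel" "f \<in> borel_measurable borel"
  shows "L2_tendsto (\<lambda>i x. u i (x - a)) (\<lambda>x. f (x - a)) F"
proof -
  have "energy lborel (\<lambda>x. u i (x - a) - f (x - a)) = energy lborel (\<lambda>x. u i x - f x)" for i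
    by (rule energy_translate) measurable
  then show ?thesis using u unfolding L2_tendsto_energy by simp
qed

lemma L2_tendsto_sum:
  assumes "finite K" "\<And>k. k \<in> K \<Longrightarrow> L2_tendsto (u k) (f k) F"
    and "\<And>k i. u k i \<in> borel_measurable borel" "\<And>k. f k \<in> borel_measurable borel"
  shows "L2_tendsto (\<lambda>i x. \<Sum>k\<in>K. u k i x) (\<lambda>x. \<Sum>k\<in>K. f k x) F"
  using assms(1,2)
proof (induction K rule: finite_induct)
  case empty
  then show ?case by (simp add: L2_tendsto_energy energy_def)
next
  case (insert k K)
  note [measurable] = assms(3,4)
  have "L2_tendsto (\<lambda>i x. u k i x + (\<Sum>k\<in>K. u k i x)) (\<lambda>x. f k x + (\<Sum>k\<in>K. f k x)) F"
    by (rule L2_tendsto_add) (use insert in auto)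
  then show ?case using insert by simp
qed

lemma inv_fourier_L1_sum_translates:
  fixes \<phi>' :: "real^'n \<Rightarrow> complex" and a :: "'k \<Rightarrow> real^'n"
  assumes K: "finite K" and int: "integrable lborel \<phi>'"
  shows "inv_fourier_L1 (\<lambda>\<omega>. (\<Sum>k\<in>K. c k * cis (- (\<omega> \<bullet> a k))) * \<phi>' \<omega>) x
    = (\<Sum>k\<in>K. c k * inv_fourier_L1 \<phi>' (x - a k))"
proof -
  have "fourier_L1 (\<lambda>\<omega>. (\<Sum>k\<in>K. c k * cis (- (\<omega> \<bullet> a k))) * \<phi>' \<omega>) (- x)
    = (LINT \<omega>|lborel. (\<Sum>k\<in>K. c k * (\<phi>' \<omega> * cis (- (\<omega> \<bullet> (- (x - a k)))))))"
    unfolding fourier_L1_def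
    by (rule Bochner_Integration.integral_cong)
      (simp_all add: sum_distrib_left sum_distrib_right cis_mult algebra_simps inner_diff_right inner_add_right
        flip: mult.assoc[of "cis _" "cis _"])
  also have "\<dots> = (\<Sum>k\<in>K. c k * fourier_L1 \<phi>' (- (x - a k)))"
    unfolding fourier_L1_def
    by (subst Bochner_Integration.integral_sum) (auto intro!: integrable_mult_right integrable_mult_cis int)
  finally show ?thesis
    unfolding inv_fourier_L1_def by (simp only: sum_distrib_left mult.left_commute)
qed

text \<open>The truncated inverse transforms of the difference on the right have at most its energy, and they
  converge to the difference on the left: by the inversion theorem for \<open>f\<close>, by definition for the
  generator, and because modulations of the transform are translations of the function.\<close>

lemma energy_spline_error_le:
  fixes f \<phi>' :: "real^'n \<Rightarrow> complex" and a :: "'k \<Rightarrow> real^'n"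
  assumes f: "f \<in> L2" and \<phi>': "\<phi>' \<in> L2" and K: "finite K"
  shows "energy lborel (\<lambda>x. f x - (\<Sum>k\<in>K. c k * inv_fourier \<phi>' (x - a k)))
    \<le> 2 * energy lborel (\<lambda>\<omega>. fourier f \<omega> - (\<Sum>k\<in>K. c k * cis (- (\<omega> \<bullet> a k))) * \<phi>' \<omega>)"
proof -
  define V where "V = (2 * pi) ^ CARD('n)"
  have V: "V \<ge> 1" unfolding V_def using pi_gt3 by (intro one_le_power) linarith
  define T where "T \<omega> = (\<Sum>k\<in>K. c k * cis (- (\<omega> \<bullet> a k)))" for \<omega> :: "real^'n"
  define \<psi> where "\<psi> \<omega> = fourier f \<omega> - T \<omega> * \<phi>' \<omega>" for \<omega>
  define s where "s x = (\<Sum>k\<in>K. c k * inv_fourier \<phi>' (x - a k))" for x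
  note [measurable] = L2_measurable[OF f] L2_measurable[OF \<phi>'] L2_measurable[OF fourier_L2(1)[OF f]]
    L2_measurable[OF inv_fourier_L2(1)[OF \<phi>']]
  have [measurable]: "T \<in> borel_measurable borel" unfolding T_def by measurable
  have [measurable]: "\<psi> \<in> borel_measurable borel" unfolding \<psi>_def by measurable
  have [measurable]: "s \<in> borel_measurable borel" unfolding s_def by measurable
  have T\<phi>: "(\<lambda>\<omega>. T \<omega> * \<phi>' \<omega>) \<in> L2"
  proof -
    have "(\<lambda>\<omega>. \<Sum>k\<in>K. c k * (cis (- (\<omega> \<bullet> a k)) * \<phi>' \<omega>)) \<in> L2"
      by (intro L2_sum K L2_cmult L2_dominated[OF \<phi>']) (auto simp: norm_mult)
    then show ?thesis by (simp add: T_def sum_distrib_right mult.assoc)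
  qed
  have \<psi>: "\<psi> \<in> L2" unfolding \<psi>_def by (intro L2_diff fourier_L2 f T\<phi>)
  define u where "u R = inv_fourier_L1 (truncate R \<psi>)" for R
  have [measurable]: "u R \<in> borel_measurable borel" for R unfolding u_def by measurable
  have u_eq: "u R x = inv_fourier_L1 (truncate R (fourier f)) x
      + (- 1) * (\<Sum>k\<in>K. c k * inv_fourier_L1 (truncate R \<phi>') (x - a k))" for R x
  proof -
    have "truncate R \<psi> = (\<lambda>\<omega>. truncate R (fourier f) \<omega> - T \<omega> * truncate R \<phi>' \<omega>)"
      by (simp add: truncate_def \<psi>_def fun_eq_iff algebra_simps)
    moreover have "integrable lborel (\<lambda>\<omega>. T \<omega> * truncate R \<phi>' \<omega>)"
    proof -
      have "(\<lambda>\<omega>. T \<omega> * truncate R \<phi>' \<omega>) = truncate R (\<lambda>\<omega>. T \<omega> * \<phi>' \<omega>)"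
        by (simp add: truncate_def fun_eq_iff)
      then show ?thesis by (simp add: L2_bounded_integrable truncate_L2_bounded T\<phi>)
    qed
    moreover have "inv_fourier_L1 (\<lambda>\<omega>. T \<omega> * truncate R \<phi>' \<omega>) x
      = (\<Sum>k\<in>K. c k * inv_fourier_L1 (truncate R \<phi>') (x - a k))"
      unfolding T_def
      by (rule inv_fourier_L1_sum_translates[OF K]) (intro L2_bounded_integrable truncate_L2_bounded \<phi>')
    ultimately show ?thesis
      by (simp add: u_def inv_fourier_L1_diff L2_bounded_integrable truncate_L2_bounded fourier_L2 f)
  qed
  have "L2_tendsto u (\<lambda>x. f x + (- 1) * s x) at_top"
    unfolding u_eq[abs_def] s_def
    by (intro L2_tendsto_add L2_tendsto_cmult L2_tendsto_sum L2_tendsto_translate K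
        Fourier_inversion f inv_fourier_L2 \<phi>') measurable
  then have lim: "((\<lambda>R. energy lborel (\<lambda>x. u R x - (f x - s x))) \<longlongrightarrow> 0) at_top"
    by (simp add: L2_tendsto_energy)
  have u_le: "energy lborel (u R) \<le> energy lborel \<psi>" for R
  proof -
    have "energy lborel (u R) = ennreal (1 / V) * energy lborel (truncate R \<psi>)"
      unfolding u_def V_def by (intro energy_inv_fourier_L1 truncate_L2_bounded \<psi>)
    also have "\<dots> \<le> 1 * energy lborel \<psi>"
      using V by (intro mult_mono energy_truncate_le) auto
    finally show ?thesis by simp
  qed
  have "energy lborel (\<lambda>x. f x - s x) \<le> 2 * energy lborel (\<lambda>x. u R x - (f x - s x)) + 2 * energy lborel \<psi>" for R
  proof -
    have "energy lborel (\<lambda>x. (f x - s x) - 0)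
      \<le> 2 * energy lborel (\<lambda>x. (f x - s x) - u R x) + 2 * energy lborel (\<lambda>x. u R x - 0)"
      by (rule energy_diff_le) measurable
    also have "\<dots> \<le> 2 * energy lborel (\<lambda>x. u R x - (f x - s x)) + 2 * energy lborel \<psi>"
      using u_le[of R] by (intro add_mono mult_left_mono) (auto simp: energy_minus_commute)
    finally show ?thesis by simp
  qed
  moreover have "((\<lambda>R. 2 * energy lborel (\<lambda>x. u R x - (f x - s x)) + 2 * energy lborel \<psi>)
      \<longlongrightarrow> 0 + 2 * energy lborel \<psi>) at_top"
    by (intro tendsto_add tendsto_ennreal_mult_0 lim tendsto_const) simp
  ultimately have "energy lborel (\<lambda>x. f x - s x) \<le> 0 + 2 * energy lborel \<psi>"
    by (intro tendsto_lowerbound[of _ _ at_top]) auto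
  then show ?thesis unfolding s_def \<psi>_def T_def by simp
qed

lemma finite_spline_in_spline_space:
  assumes K: "finite K" and \<phi>: "bspline_hat L D j p \<in> L2"
  shows "(\<lambda>x. \<Sum>k\<in>K. c k * bspline L D j p (x - lattice_pt D j k)) \<in> spline_space L D j p"
proof -
  let ?c = "\<lambda>k. if k \<in> K then c k else 0"
  let ?\<phi> = "bspline L D j p"
  let ?s = "\<lambda>x. \<Sum>k\<in>K. c k * ?\<phi> (x - lattice_pt D j k)"
  have "?\<phi> \<in> L2" unfolding bspline_def by (rule inv_fourier_L2(1)[OF \<phi>])
  then have "?s \<in> L2" by (intro L2_sum K L2_cmult L2_translate)
  moreover have "(\<lambda>k. (cmod (?c k))^2) summable_on UNIV"
  proof -
    have "(\<lambda>k. (cmod (?c k))^2) summable_on K" using K by simp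
    then show ?thesis by (rule summable_on_cong_neutral[THEN iffD1, rotated -1]) auto
  qed
  moreover have "L2_tendsto (\<lambda>M x. \<Sum>k\<in>M. ?c k * ?\<phi> (x - lattice_pt D j k)) ?s (finite_subsets_at_top UNIV)"
    unfolding L2_tendsto_energy
  proof (rule tendsto_eventually, rule eventually_finite_subsets_at_top[THEN iffD2],
      intro exI[of _ K] conjI allI impI)
    fix M assume M: "finite M \<and> K \<subseteq> M \<and> M \<subseteq> UNIV"
    have "(\<Sum>k\<in>M. ?c k * ?\<phi> (x - lattice_pt D j k)) = ?s x" for x
      by (rule sum.mono_neutral_cong_right) (use M in auto)
    then show "energy lborel (\<lambda>x. (\<Sum>k\<in>M. ?c k * ?\<phi> (x - lattice_pt D j k)) - ?s x) = 0"
      by (simp add: energy_def)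
  qed (use K in auto)
  ultimately show ?thesis
    unfolding spline_space_def by (intro CollectI conjI exI[of _ ?c])
qed

section \<open>Powers of the dilation matrix\<close>

lemma scaleR_matrix_mult_scaleR:
  fixes A B :: "real^'n^'n"
  shows "(x *\<^sub>R A) ** (y *\<^sub>R B) = (x * y) *\<^sub>R (A ** B)"
  by (simp add: matrix_matrix_mult_def vec_eq_iff sum_distrib_left ac_simps)

lemma matrix_inv_scaled_orthogonal:
  fixes R :: "real^'n^'n"
  assumes R: "orthogonal_matrix R" and a: "a \<noteq> 0"
  shows "matrix_inv (a *\<^sub>R R) = (1 / a) *\<^sub>R transpose R"
proof -
  let ?A = "a *\<^sub>R R" and ?B = "(1 / a) *\<^sub>R transpose R"
  have AB: "?A ** ?B = mat 1" and BA: "?B ** ?A = mat 1"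
    using R a by (simp_all add: scaleR_matrix_mult_scaleR orthogonal_matrix_def)
  have "\<exists>B. ?A ** B = mat 1 \<and> B ** ?A = mat 1" using AB BA by blast
  from someI_ex[OF this] have inv: "?A ** matrix_inv ?A = mat 1"
    by (simp add: matrix_inv_def)
  have "matrix_inv ?A = (?B ** ?A) ** matrix_inv ?A" by (simp only: BA matrix_mul_lid)
  also have "\<dots> = ?B ** (?A ** matrix_inv ?A)" by (simp only: matrix_mul_assoc)
  also have "\<dots> = ?B" by (simp only: inv matrix_mul_rid)
  finally show ?thesis .
qed

lemma iterate_scaled_orthogonal:
  fixes R :: "real^'n^'n"
  assumes R: "orthogonal_matrix R"
  shows "(((**) (c *\<^sub>R R)) ^^ n) (mat 1) = c ^ n *\<^sub>R (((**) R) ^^ n) (mat 1)"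
    and "orthogonal_matrix ((((**) R) ^^ n) (mat 1))"
proof -
  show "(((**) (c *\<^sub>R R)) ^^ n) (mat 1) = c ^ n *\<^sub>R (((**) R) ^^ n) (mat 1)"
    by (induction n) (simp_all add: scaleR_matrix_mult_scaleR)
  show "orthogonal_matrix ((((**) R) ^^ n) (mat 1))"
    by (induction n) (simp_all add: orthogonal_matrix_id orthogonal_matrix_mul R)
qed

text \<open>Transposition followed by inversion fixes orthogonal matrices, so between \<open>D\<^sup>j\<close> and \<open>(D\<^sup>T)\<^sup>-\<^sup>j\<close> only the
  scale changes.\<close>

lemma matrix_zpow_scaled_orthogonal:
  fixes R D :: "real^'n^'n"
  assumes R: "orthogonal_matrix R" and a: "a > 0" and D: "D = a *\<^sub>R R"
  obtains Q where "orthogonal_matrix Q" "matrix_zpow D j = (a powr j) *\<^sub>R Q"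
    "matrix_zpow (transpose D) (- j) = (1 / a powr j) *\<^sub>R Q"
proof -
  have RT: "orthogonal_matrix (transpose R)" using R by simp
  have DT: "transpose D = a *\<^sub>R transpose R" by (simp add: D transpose_def vec_eq_iff)
  have invD: "matrix_inv D = (1 / a) *\<^sub>R transpose R"
    unfolding D using R a by (intro matrix_inv_scaled_orthogonal) auto
  have invDT: "matrix_inv (transpose D) = (1 / a) *\<^sub>R R"
    unfolding DT using RT a by (subst matrix_inv_scaled_orthogonal) auto
  show thesis
  proof (cases "0 \<le> j")
    case True
    define n where "n = nat j"
    have j: "j = int n" using True by (simp add: n_def)
    let ?Q = "(((**) R) ^^ n) (mat 1)"
    have "matrix_zpow D j = (a powr j) *\<^sub>R ?Q"
      using a by (simp add: matrix_zpow_def j D iterate_scaled_orthogonal[OF R] powr_realpow)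
    moreover have "matrix_zpow (transpose D) (- j) = (1 / a powr j) *\<^sub>R ?Q"
      using a by (cases "n = 0") (simp_all add: matrix_zpow_def j invDT iterate_scaled_orthogonal[OF R]
          powr_realpow power_divide)
    ultimately show thesis using that iterate_scaled_orthogonal(2)[OF R] by blast
  next
    case False
    define n where "n = nat (- j)"
    have j: "j = - int n" "n \<noteq> 0" using False by (simp_all add: n_def)
    let ?Q = "(((**) (transpose R)) ^^ n) (mat 1)"
    have "matrix_zpow D j = (a powr j) *\<^sub>R ?Q"
      using a j(2) by (simp add: matrix_zpow_def j(1) invD iterate_scaled_orthogonal[OF RT]
          powr_realpow powr_minus power_divide inverse_eq_divide)
    moreover have "matrix_zpow (transpose D) (- j) = (1 / a powr j) *\<^sub>R ?Q"
      using a by (simp add: matrix_zpow_def j(1) DT iterate_scaled_orthogonal[OF RT]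
          powr_realpow powr_minus divide_inverse)
    ultimately show thesis using that iterate_scaled_orthogonal(2)[OF RT] by blast
  qed
qed

lemma abs_det_scaled_orthogonal:
  fixes R :: "real^'n^'n"
  assumes R: "orthogonal_matrix R" and a: "a > 0"
  shows "\<bar>det (a *\<^sub>R R)\<bar> = a ^ CARD('n)"
proof -
  have "a *\<^sub>R R = mat a ** R"
    by (simp add: matrix_matrix_mult_def mat_def vec_eq_iff if_distrib[of "\<lambda>x. x * _"] cong: if_cong)
  moreover have "det (mat a :: real^'n^'n) = a ^ CARD('n)"
    by (subst det_diagonal) (auto simp: mat_def)
  ultimately show ?thesis
    using det_orthogonal_matrix[OF R] a by (auto simp: det_mul abs_mult)
qed

section \<open>Best approximation on the fibres of the dual lattice\<close>

lemma nn_integral_count_space_eq_infsum: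
  fixes f :: "int^'n \<Rightarrow> real"
  assumes sm: "f summable_on UNIV" and nn: "\<And>k. 0 \<le> f k"
  shows "(\<integral>\<^sup>+k. ennreal (f k) \<partial>count_space UNIV) = ennreal (\<Sum>\<^sub>\<infinity>k. f k)"
proof (rule nn_integral_count_space_eqI)
  fix K :: "(int^'n) set" assume "finite K"
  then show "(\<Sum>k\<in>K. ennreal (f k)) \<le> ennreal (\<Sum>\<^sub>\<infinity>k. f k)"
    using nn by (auto intro!: ennreal_leI finite_sum_le_infsum sm)
next
  fix c assume c: "\<And>K. finite K \<Longrightarrow> (\<Sum>k\<in>K. ennreal (f k)) \<le> c"
  show "ennreal (\<Sum>\<^sub>\<infinity>k. f k) \<le> c"
  proof (cases c)
    case (real r)
    have "sum f K \<le> r" if "finite K" for K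
      using c[OF that] real nn by (simp add: sum_nonneg)
    then show ?thesis
      using sm real by (auto intro!: ennreal_leI infsum_le_finite_sums)
  qed simp
qed

text \<open>On a fibre, the sequence \<open>x e\<^sub>0\<close> is approximated by a multiple \<open>t b\<close> of the sequence \<open>b\<close>, whose
  squared norm is \<open>\<Phi>\<close> and whose entry at \<open>0\<close> is \<open>b\<^sub>0\<close>. Completing the square exhibits the projection
  coefficient and the relative error \<open>1 - |b\<^sub>0|\<^sup>2 / \<Phi>\<close>.\<close>

lemma fibre_square_completion:
  fixes x t b :: complex and \<Phi> :: real
  assumes "\<Phi> > 0"
  shows "(cmod (x - t * b))^2 + (cmod t)^2 * (\<Phi> - (cmod b)^2)
    = (cmod x)^2 * (1 - (cmod b)^2 / \<Phi>) + \<Phi> * (cmod (x * cnj b / of_real \<Phi> - t))^2"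
proof -
  have "complex_of_real ((cmod (x - t * b))^2 + (cmod t)^2 * (\<Phi> - (cmod b)^2))
    = complex_of_real ((cmod x)^2 * (1 - (cmod b)^2 / \<Phi>) + \<Phi> * (cmod (x * cnj b / of_real \<Phi> - t))^2)"
    using assms
    by (simp only: of_real_add of_real_mult of_real_diff of_real_divide of_real_1 complex_norm_square)
      (simp add: field_simps)
  then show ?thesis by (simp only: of_real_eq_iff)
qed

text \<open>Only the entry at \<open>0\<close> differs from the multiple \<open>t b\<close>. Adding \<open>|t b\<^sub>0|\<^sup>2\<close> to both sides avoids the
  subtraction of extended reals.\<close>

lemma fibre_energy:
  fixes b :: "int^'n \<Rightarrow> complex" and x t :: complex
  assumes \<Phi>: "(\<integral>\<^sup>+l. ennreal ((cmod (b l))^2) \<partial>count_space UNIV) = ennreal \<Phi>" "\<Phi> > 0"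
  shows "(cmod (b 0))^2 \<le> \<Phi>"
    and "(\<integral>\<^sup>+l. ennreal ((cmod ((if l = 0 then x else 0) - t * b l))^2) \<partial>count_space UNIV)
      = ennreal ((cmod x)^2 * (1 - (cmod (b 0))^2 / \<Phi>) + \<Phi> * (cmod (x * cnj (b 0) / of_real \<Phi> - t))^2)"
proof -
  have "ennreal ((cmod (b 0))^2) = (\<integral>\<^sup>+l. ennreal ((cmod (b l))^2) * indicator {0} l \<partial>count_space UNIV)"
    by simp
  also have "\<dots> \<le> (\<integral>\<^sup>+l. ennreal ((cmod (b l))^2) \<partial>count_space UNIV)"
    by (rule nn_integral_mono) (auto simp: indicator_def)
  finally show le: "(cmod (b 0))^2 \<le> \<Phi>" using \<Phi> by (simp add: ennreal_le_iff)
  let ?I = "\<integral>\<^sup>+l. ennreal ((cmod ((if l = 0 then x else 0) - t * b l))^2) \<partial>count_space UNIV"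
  let ?A = "ennreal ((cmod (t * b 0))^2)"
  have "?I + ?A = (\<integral>\<^sup>+l. ennreal ((cmod ((if l = 0 then x else 0) - t * b l))^2)
      + ?A * indicator {0} l \<partial>count_space UNIV)"
    by (subst nn_integral_add) simp_all
  also have "\<dots> = (\<integral>\<^sup>+l. ennreal ((cmod (x - t * b 0))^2) * indicator {0} l
      + ennreal ((cmod t)^2) * ennreal ((cmod (b l))^2) \<partial>count_space UNIV)"
    by (rule nn_integral_cong)
      (auto simp: indicator_def norm_mult power_mult_distrib ennreal_mult[symmetric])
  also have "\<dots> = ennreal ((cmod (x - t * b 0))^2) + ennreal ((cmod t)^2) * ennreal \<Phi>"
    by (subst nn_integral_add) (simp_all add: nn_integral_cmult \<Phi>(1))
  also have "\<dots> = ennreal ((cmod (x - t * b 0))^2 + (cmod t)^2 * (\<Phi> - (cmod (b 0))^2)) + ?A"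
  proof -
    let ?u = "(cmod (x - t * b 0))^2" and ?w = "(cmod t)^2 * (\<Phi> - (cmod (b 0))^2)"
    have w: "0 \<le> ?w" using le by simp
    have "ennreal ?u + ennreal ((cmod t)^2) * ennreal \<Phi> = ennreal (?u + (cmod t)^2 * \<Phi>)"
      using \<Phi>(2) by (simp add: ennreal_mult)
    also have "?u + (cmod t)^2 * \<Phi> = (?u + ?w) + (cmod (t * b 0))^2"
      by (simp add: norm_mult power_mult_distrib right_diff_distrib)
    also have "ennreal \<dots> = ennreal (?u + ?w) + ?A"
      using w by (intro ennreal_plus add_nonneg_nonneg) auto
    finally show ?thesis .
  qed
  finally have "?I = ennreal ((cmod (x - t * b 0))^2 + (cmod t)^2 * (\<Phi> - (cmod (b 0))^2))"
    by (simp only: add.commute[of _ ?A] ennreal_add_left_cancel) simp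
  then show "?I = ennreal ((cmod x)^2 * (1 - (cmod (b 0))^2 / \<Phi>) + \<Phi> * (cmod (x * cnj (b 0) / of_real \<Phi> - t))^2)"
    by (simp only: fibre_square_completion[OF \<Phi>(2)])
qed

abbreviation periodization :: "(real^'n \<Rightarrow> complex) \<Rightarrow> real^'n^'n \<Rightarrow> real^'n \<Rightarrow> ennreal" where
  "periodization b B \<theta> \<equiv> \<integral>\<^sup>+l. ennreal ((cmod (b (B *v \<theta> + dual_shift B l)))^2) \<partial>count_space UNIV"

text \<open>Unfolding over the dual lattice turns the energy into an integral of fibre energies. The approximating
  function multiplies \<open>b\<close> by the periodic function \<open>T\<close>, which is constant on each fibre.\<close>

lemma fibre_projection_energy:
  fixes F b :: "real^'n \<Rightarrow> complex" and B R :: "real^'n^'n"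
  assumes B: "B = c *\<^sub>R R" "orthogonal_matrix R" "c > 0"
    and [measurable]: "F \<in> borel_measurable borel" "b \<in> borel_measurable borel"
      "T \<in> borel_measurable borel" "\<Phi> \<in> borel_measurable borel"
    and \<Phi>: "AE \<theta> in cell_measure. \<Phi> \<theta> > 0 \<and>
      periodization b B \<theta> = ennreal (\<Phi> \<theta>)"
    and T: "\<And>\<theta> l. T (B *v \<theta> + dual_shift B l) = t \<theta>"
    and F: "\<And>\<theta> l. \<theta> \<in> period_cell \<Longrightarrow> l \<noteq> 0 \<Longrightarrow> F (B *v \<theta> + dual_shift B l) = 0"
  shows "energy lborel (\<lambda>\<omega>. F \<omega> - T \<omega> * b \<omega>) = ennreal (c ^ CARD('n)) *
    (\<integral>\<^sup>+\<theta>. ennreal ((cmod (F (B *v \<theta>)))^2 * (1 - (cmod (b (B *v \<theta>)))^2 / \<Phi> \<theta>)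
      + \<Phi> \<theta> * (cmod (F (B *v \<theta>) * cnj (b (B *v \<theta>)) / of_real (\<Phi> \<theta>) - t \<theta>))^2) \<partial>cell_measure)"
proof -
  have "energy lborel (\<lambda>\<omega>. F \<omega> - T \<omega> * b \<omega>) = ennreal (c ^ CARD('n)) *
    (\<integral>\<^sup>+\<theta>. (\<integral>\<^sup>+l. ennreal ((cmod (F (B *v \<theta> + dual_shift B l) - T (B *v \<theta> + dual_shift B l) * b (B *v \<theta> + dual_shift B l)))^2)
      \<partial>count_space UNIV) \<partial>cell_measure)"
    unfolding energy_def by (rule nn_integral_unfold_lattice[OF _ B]) measurable
  also have "(\<integral>\<^sup>+\<theta>. (\<integral>\<^sup>+l. ennreal ((cmod (F (B *v \<theta> + dual_shift B l) - T (B *v \<theta> + dual_shift B l) * b (B *v \<theta> + dual_shift B l)))^2)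
      \<partial>count_space UNIV) \<partial>cell_measure)
    = (\<integral>\<^sup>+\<theta>. ennreal ((cmod (F (B *v \<theta>)))^2 * (1 - (cmod (b (B *v \<theta>)))^2 / \<Phi> \<theta>)
      + \<Phi> \<theta> * (cmod (F (B *v \<theta>) * cnj (b (B *v \<theta>)) / of_real (\<Phi> \<theta>) - t \<theta>))^2) \<partial>cell_measure)"
  proof (rule nn_integral_cong_AE, goal_cases)
    case 1
    have "AE \<theta> in (cell_measure :: (real^'n) measure). \<theta> \<in> period_cell"
      by (simp add: AE_cell_measure)
    then show ?case
      using \<Phi>
    proof eventually_elim
      case (elim \<theta>)
      have "F (B *v \<theta> + dual_shift B l) = (if l = 0 then F (B *v \<theta>) else 0)" for l
        using F[OF elim(1), of l] by auto
      then show ?case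
        using fibre_energy(2)[of "\<lambda>l. b (B *v \<theta> + dual_shift B l)" "\<Phi> \<theta>" "F (B *v \<theta>)" "t \<theta>"] elim(2)
        by (simp only: T dual_shift_0 add_0_right)
    qed
  qed
  finally show ?thesis .
qed

text \<open>The projection coefficient is square-integrable over the cell, so it can be replaced by a
  trigonometric polynomial at arbitrarily small cost: the upper Riesz bound controls the error.\<close>

lemma trig_poly_near_fibre_projection:
  fixes F b :: "real^'n \<Rightarrow> complex" and B R :: "real^'n^'n"
  assumes B: "B = c *\<^sub>R R" "orthogonal_matrix R" "c > 0"
    and F: "F \<in> L2" and b [measurable]: "b \<in> borel_measurable borel"
    and \<Phi>m [measurable]: "\<Phi> \<in> borel_measurable borel" and lo: "lo > 0"
    and \<Phi>: "AE \<theta> in cell_measure. lo \<le> \<Phi> \<theta> \<and> \<Phi> \<theta> \<le> up \<and>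
      periodization b B \<theta> = ennreal (\<Phi> \<theta>)"
    and Fcell: "\<And>\<theta> l. \<theta> \<in> period_cell \<Longrightarrow> l \<noteq> 0 \<Longrightarrow> F (B *v \<theta> + dual_shift B l) = 0"
    and \<epsilon>: "\<epsilon> > 0"
  obtains K a where "finite K"
    "\<And>T. T \<in> borel_measurable borel \<Longrightarrow>
      (\<And>\<theta> l. T (B *v \<theta> + dual_shift B l) = (\<Sum>k\<in>K. a k * character k \<theta>)) \<Longrightarrow>
      energy lborel (\<lambda>\<omega>. F \<omega> - T \<omega> * b \<omega>) \<le> ennreal (c ^ CARD('n)) *
        (\<integral>\<^sup>+\<theta>. ennreal ((cmod (F (B *v \<theta>)))^2 * (1 - (cmod (b (B *v \<theta>)))^2 / \<Phi> \<theta>)) \<partial>cell_measure)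
        + ennreal \<epsilon>"
proof -
  note [measurable] = L2_measurable[OF F]
  define q where "q = c ^ CARD('n)"
  have q: "q > 0" using B by (simp add: q_def)
  define P where "P \<theta> = F (B *v \<theta>) * cnj (b (B *v \<theta>)) / of_real (\<Phi> \<theta>)" for \<theta>
  have [measurable]: "P \<in> borel_measurable borel" unfolding P_def by measurable
  have \<Phi>b: "AE \<theta> in cell_measure. (cmod (b (B *v \<theta>)))^2 \<le> \<Phi> \<theta>"
    using \<Phi>
  proof eventually_elim
    case (elim \<theta>)
    then show ?case
      using fibre_energy(1)[of "\<lambda>l. b (B *v \<theta> + dual_shift B l)" "\<Phi> \<theta>"] lo by simp
  qed
  have Pfin: "energy cell_measure P < top"
  proof -
    have "energy cell_measure P \<le> (\<integral>\<^sup>+\<theta>. ennreal (1 / lo) * ennreal ((cmod (F (B *v \<theta>)))^2) \<partial>cell_measure)"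
      unfolding energy_def
    proof (rule nn_integral_mono_AE)
      show "AE \<theta> in cell_measure. ennreal ((cmod (P \<theta>))^2) \<le> ennreal (1 / lo) * ennreal ((cmod (F (B *v \<theta>)))^2)"
        using \<Phi> \<Phi>b
      proof eventually_elim
        case (elim \<theta>)
        note * = elim(1) and le = elim(2)
        have pos: "\<Phi> \<theta> > 0" using * lo by linarith
        have "(cmod (P \<theta>))^2 = (cmod (F (B *v \<theta>)))^2 * ((cmod (b (B *v \<theta>)))^2 / \<Phi> \<theta>) * (1 / \<Phi> \<theta>)"
          using pos by (simp add: P_def norm_mult norm_divide power_mult_distrib power_divide power2_eq_square)
        also have "\<dots> \<le> (cmod (F (B *v \<theta>)))^2 * 1 * (1 / lo)"
          using pos le * lo by (intro mult_mono) (auto simp: field_simps)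
        finally have "ennreal ((cmod (P \<theta>))^2) \<le> ennreal ((1 / lo) * (cmod (F (B *v \<theta>)))^2)"
          by (intro ennreal_leI) simp
        then show ?case
          using lo by (simp only: ennreal_mult less_imp_le zero_less_divide_1_iff zero_le_power2)
      qed
    qed
    also have "\<dots> = ennreal (1 / lo) * (\<integral>\<^sup>+\<theta>. ennreal ((cmod (F (B *v \<theta>)))^2) \<partial>cell_measure)"
      by (rule nn_integral_cmult) measurable
    also have "\<dots> < top"
    proof -
      have "ennreal q * (\<integral>\<^sup>+\<theta>. ennreal ((cmod (F (B *v \<theta>)))^2) \<partial>cell_measure) < top"
        using nn_integral_cell_conformal_le[OF _ B, of "\<lambda>\<omega>. ennreal ((cmod (F \<omega>))^2)"] L2_energy[OF F]
        by (auto simp: q_def energy_def intro: le_less_trans)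
      then show ?thesis
        using q by (auto simp: ennreal_mult_less_top ennreal_eq_0_iff)
    qed
    finally show ?thesis .
  qed
  (* The factor q * up is what an error in the coefficient costs; adding 1 keeps the divisor positive. *)
  define \<delta> where "\<delta> = \<epsilon> / (q * (\<bar>up\<bar> + 1))"
  have \<delta>: "\<delta> > 0" using \<epsilon> q by (simp add: \<delta>_def)
  have \<delta>\<epsilon>: "q * (\<bar>up\<bar> * \<delta>) \<le> \<epsilon>"
  proof -
    have "q * (\<bar>up\<bar> * \<delta>) \<le> q * ((\<bar>up\<bar> + 1) * \<delta>)" using q \<delta> by simp
    also have "\<dots> = \<epsilon>" using q by (simp add: \<delta>_def)
    finally show ?thesis .
  qed
  have "approximable P"
    by (rule trig_polys_dense[OF _ Pfin]) measurable
  then obtain t where t: "t \<in> trig_polys" "energy cell_measure (\<lambda>\<theta>. P \<theta> - t \<theta>) \<le> ennreal \<delta>"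
    using \<delta> unfolding approximable_def by blast
  note [measurable] = borel_measurable_trig_polys[OF t(1)]
  obtain K a where K: "finite K" and ta: "t = (\<lambda>\<theta>. \<Sum>k\<in>K. a k * character k \<theta>)"
    using trig_polys_eq_sum[OF t(1)] by blast
  show thesis
  proof (rule that[OF K, of a])
    fix T assume [measurable]: "T \<in> borel_measurable borel"
      and T: "\<And>\<theta> l. T (B *v \<theta> + dual_shift B l) = (\<Sum>k\<in>K. a k * character k \<theta>)"
    let ?m = "\<lambda>\<theta>. (cmod (F (B *v \<theta>)))^2 * (1 - (cmod (b (B *v \<theta>)))^2 / \<Phi> \<theta>)"
    have "energy lborel (\<lambda>\<omega>. F \<omega> - T \<omega> * b \<omega>)
      = ennreal q * (\<integral>\<^sup>+\<theta>. ennreal (?m \<theta> + \<Phi> \<theta> * (cmod (P \<theta> - t \<theta>))^2) \<partial>cell_measure)"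
      unfolding q_def P_def
    proof (rule fibre_projection_energy[OF B])
      show "AE \<theta> in cell_measure. \<Phi> \<theta> > 0 \<and>
        periodization b B \<theta> = ennreal (\<Phi> \<theta>)"
        using \<Phi> by eventually_elim (use lo in auto)
      show "T (B *v \<theta> + dual_shift B l) = t \<theta>" for \<theta> l by (simp add: T ta)
    qed (use Fcell in auto)
    also have "\<dots> \<le> ennreal q * (\<integral>\<^sup>+\<theta>. ennreal (?m \<theta>) + ennreal \<bar>up\<bar> * ennreal ((cmod (P \<theta> - t \<theta>))^2) \<partial>cell_measure)"
    proof (intro mult_left_mono nn_integral_mono_AE)
      show "AE \<theta> in cell_measure. ennreal (?m \<theta> + \<Phi> \<theta> * (cmod (P \<theta> - t \<theta>))^2)
        \<le> ennreal (?m \<theta>) + ennreal \<bar>up\<bar> * ennreal ((cmod (P \<theta> - t \<theta>))^2)"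
        using \<Phi> \<Phi>b
      proof eventually_elim
        case (elim \<theta>)
        note * = elim(1) and le = elim(2)
        have pos: "\<Phi> \<theta> > 0" using * lo by linarith
        have m0: "0 \<le> ?m \<theta>" using le pos by (intro mult_nonneg_nonneg) auto
        have "ennreal (?m \<theta> + \<Phi> \<theta> * (cmod (P \<theta> - t \<theta>))^2) \<le> ennreal (?m \<theta> + \<bar>up\<bar> * (cmod (P \<theta> - t \<theta>))^2)"
          using * by (intro ennreal_leI add_left_mono mult_right_mono) auto
        also have "\<dots> = ennreal (?m \<theta>) + ennreal \<bar>up\<bar> * ennreal ((cmod (P \<theta> - t \<theta>))^2)"
          using m0 by (simp only: ennreal_plus ennreal_mult abs_ge_zero zero_le_power2 mult_nonneg_nonneg)
        finally show ?case .
      qed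
    qed simp
    also have "\<dots> = ennreal q * ((\<integral>\<^sup>+\<theta>. ennreal (?m \<theta>) \<partial>cell_measure)
        + ennreal \<bar>up\<bar> * energy cell_measure (\<lambda>\<theta>. P \<theta> - t \<theta>))"
      unfolding energy_def by (subst nn_integral_add) (simp_all add: nn_integral_cmult)
    also have "\<dots> = ennreal q * (\<integral>\<^sup>+\<theta>. ennreal (?m \<theta>) \<partial>cell_measure)
        + ennreal q * (ennreal \<bar>up\<bar> * energy cell_measure (\<lambda>\<theta>. P \<theta> - t \<theta>))"
      by (rule distrib_left)
    also have "\<dots> \<le> ennreal q * (\<integral>\<^sup>+\<theta>. ennreal (?m \<theta>) \<partial>cell_measure) + ennreal q * (ennreal \<bar>up\<bar> * ennreal \<delta>)"
      by (intro add_left_mono mult_left_mono t) auto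
    also have "ennreal q * (ennreal \<bar>up\<bar> * ennreal \<delta>) = ennreal (q * (\<bar>up\<bar> * \<delta>))"
      using q \<delta> by (simp add: ennreal_mult)
    also have "\<dots> \<le> ennreal \<epsilon>" by (rule ennreal_leI[OF \<delta>\<epsilon>])
    finally show "energy lborel (\<lambda>\<omega>. F \<omega> - T \<omega> * b \<omega>) \<le> ennreal (c ^ CARD('n)) *
        (\<integral>\<^sup>+\<theta>. ennreal (?m \<theta>) \<partial>cell_measure) + ennreal \<epsilon>"
      unfolding q_def by (simp add: add_left_mono)
  qed
qed

section \<open>The approximation order\<close>

text \<open>The symbol is the pointwise limit of partial sums along an enumeration of the lattice.\<close>

lemma borel_measurable_discrete_symbol:
  fixes p :: "int^'n \<Rightarrow> complex"
  assumes p: "(\<lambda>k. cmod (p k)) summable_on UNIV"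
  shows "discrete_symbol D j p \<in> borel_measurable borel"
proof -
  let ?e = "from_nat_into (UNIV :: (int^'n) set)"
  have bij: "bij_betw ?e UNIV UNIV"
    by (rule bij_betw_from_nat_into) (simp_all add: infinite_UNIV_int_vec)
  show ?thesis
  proof (rule borel_measurable_LIMSEQ_metric)
    fix \<omega> :: "real^'n"
    let ?g = "\<lambda>k. p k * cis (\<omega> \<bullet> lattice_pt D j k)"
    have "(\<lambda>k. cmod (?g k)) summable_on UNIV" using p by (simp add: norm_mult)
    then have "?g summable_on UNIV" by (rule abs_summable_summable)
    then have "(\<lambda>i. ?g (?e i)) summable_on UNIV"
      by (simp only: summable_on_reindex_bij_betw[OF bij, of ?g])
    then have "((\<lambda>i. ?g (?e i)) has_sum (\<Sum>\<^sub>\<infinity>i. ?g (?e i))) UNIV" by (rule has_sum_infsum)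
    then have "(\<lambda>i. ?g (?e i)) sums (\<Sum>\<^sub>\<infinity>i. ?g (?e i))" by (rule has_sum_imp_sums)
    then show "(\<lambda>m. \<Sum>i<m. ?g (?e i)) \<longlonglongrightarrow> discrete_symbol D j p \<omega>"
      by (simp only: infsum_reindex_bij_betw[OF bij, of ?g] discrete_symbol_def sums_def)
  qed measurable
qed

lemma approx_error_le:
  assumes "s \<in> X" shows "approx_error f X \<le> L2_norm (\<lambda>x. f x - s x)"
  unfolding approx_error_def
proof (rule cINF_lower)
  show "bdd_below ((\<lambda>s. L2_norm (\<lambda>x. f x - s x)) ` X)"
    by (rule bdd_belowI[of _ 0]) (auto simp: L2_norm_def)
qed fact

text \<open>The frequencies outside the fundamental cell are large, and there the growth of the symbol makes
  the Sobolev weight at least a constant times \<open>s\<^sup>-\<^sup>2\<^sup>r\<close>; for coarse lattices (\<open>s \<ge> 1\<close>) the trivial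
  lower bound \<open>1\<close> of the weight suffices.\<close>

lemma weight_outside_cell:
  fixes s r r' C w l :: real
  assumes s: "s > 0" and w: "w \<ge> 1 / s" and r: "0 \<le> r'" "r' \<le> r" and l: "l \<ge> 0" and C: "C > 0"
    and growth: "w powr (2 * r) \<le> C * (1 + l)"
  shows "1 \<le> (C + 1) * (s powr r')^2 * (1 + l)"
proof -
  have sq: "(s powr r')^2 = s powr (2 * r')"
    using s by (simp add: power2_eq_square flip: powr_add)
  show ?thesis
  proof (cases "s \<le> 1")
    case True
    have "(1 / s) powr (2 * r) \<le> w powr (2 * r)"
      using s w r by (intro powr_mono2) auto
    then have "(1 / s) powr (2 * r) \<le> C * (1 + l)" using growth by linarith
    then have "1 \<le> s powr (2 * r) * (C * (1 + l))"
      using s by (simp add: powr_divide field_simps)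
    also have "\<dots> \<le> s powr (2 * r') * ((C + 1) * (1 + l))"
      using True s r C l by (intro mult_mono powr_mono') auto
    finally show ?thesis by (simp add: sq ac_simps)
  next
    case False
    then have "1 \<le> s powr (2 * r')" using r by (intro ge_one_powr_ge_zero) auto
    then have "1 * 1 * 1 \<le> (C + 1) * s powr (2 * r') * (1 + l)"
      using C l by (intro mult_mono) auto
    then show ?thesis by (simp add: sq)
  qed
qed

text \<open>The two lattices are dual to each other because \<open>B\<close> is the inverse transpose of \<open>D\<^sup>j\<close>: an inner product
  of a frequency with a lattice point becomes one with an integer vector after the substitution
  \<open>\<omega> = B x\<close>.\<close>

lemma dual_lattice_frame:
  fixes R D :: "real^'n^'n" and j :: int
  assumes R: "orthogonal_matrix R" and a: "a > 0" and D: "D = a *\<^sub>R R"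
  defines "B \<equiv> matrix_zpow (transpose D) (- j)"
  shows "\<exists>Q B'. B = (1 / a powr real_of_int j) *\<^sub>R Q \<and> orthogonal_matrix Q \<and>
    (\<forall>x. B' *v (B *v x) = x) \<and> (\<forall>x. norm (B' *v x) = a powr real_of_int j * norm x) \<and>
    (\<forall>x k. (B *v x) \<bullet> lattice_pt D j k = x \<bullet> real_vec k)"
proof -
  define s where "s = a powr real_of_int j"
  have s: "s > 0" using a by (simp add: s_def)
  obtain Q where Q: "orthogonal_matrix Q" and Dj: "matrix_zpow D j = s *\<^sub>R Q"
    and B: "B = (1 / s) *\<^sub>R Q"
    using matrix_zpow_scaled_orthogonal[OF R a D, of j] unfolding s_def B_def by auto
  define B' where "B' = s *\<^sub>R transpose Q"
  have sc: "s * (1 / s) = 1" "1 / s * s = 1" using s by simp_all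
  have Bv: "B *v x = (1 / s) *\<^sub>R (Q *v x)" for x by (simp only: B scaleR_matrix_vector_assoc)
  have B'v: "B' *v x = s *\<^sub>R (transpose Q *v x)" for x by (simp only: B'_def scaleR_matrix_vector_assoc)
  have QT: "transpose Q *v (Q *v x) = x" for x
    using Q by (simp only: matrix_vector_mul_assoc orthogonal_matrix_def matrix_vector_mul_lid)
  have orth: "orthogonal_transformation (\<lambda>x. A *v x)" if "orthogonal_matrix A" for A :: "real^'n^'n"
    using that by (simp add: orthogonal_transformation_matrix matrix_of_matrix_vector_mul)
  have QTo: "orthogonal_matrix (transpose Q)" using Q by simp
  show ?thesis
  proof (rule exI[of _ Q], rule exI[of _ B'], intro conjI allI)
    show "B = (1 / a powr real_of_int j) *\<^sub>R Q" "orthogonal_matrix Q"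
      by (simp_all add: B s_def[symmetric] Q)
    show "B' *v (B *v x) = x" for x
      by (simp only: Bv B'v matrix_vector_mult_scaleR QT scaleR_scaleR sc scaleR_one)
    show "norm (B' *v x) = a powr real_of_int j * norm x" for x
      using s orthogonal_transformation_norm[OF orth[OF QTo], of x]
      by (simp only: B'v norm_scaleR s_def abs_of_pos)
    show "(B *v x) \<bullet> lattice_pt D j k = x \<bullet> real_vec k" for x k
    proof -
      have "(B *v x) \<bullet> lattice_pt D j k = (s * (1 / s)) * ((Q *v x) \<bullet> (Q *v real_vec k))"
        by (simp add: lattice_pt_def Dj Bv scaleR_matrix_vector_assoc[symmetric])
      also have "(Q *v x) \<bullet> (Q *v real_vec k) = x \<bullet> real_vec k"
        using orth[OF Q] by (simp add: orthogonal_transformation_def)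
      finally show ?thesis by (simp only: sc mult_1)
    qed
  qed
qed

lemma cis_dual_shift:
  assumes lat: "\<And>x k. (B *v x) \<bullet> lattice_pt D j k = x \<bullet> real_vec k"
  shows "cis ((B *v x + dual_shift B l) \<bullet> lattice_pt D j k) = character k x"
proof -
  have "cis ((B *v x + dual_shift B l) \<bullet> lattice_pt D j k)
    = cis (real_vec k \<bullet> x) * cis (2 * pi * (real_vec k \<bullet> real_vec l))"
    unfolding add_dual_shift lat by (simp add: cis_mult inner_add_left inner_add_right inner_commute)
  then show ?thesis by (simp add: cis_2pi_real_vec character_def)
qed

text \<open>On a fibre the transform of the B-spline is a constant multiple of \<open>1 / L\<close>, and the constant
  cancels in the quotient that defines \<open>m\<^sub>j\<close>. The lower Riesz bound excludes that it vanishes.\<close>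

lemma bspline_hat_fibres:
  fixes L :: "real^'n \<Rightarrow> complex" and B D Q :: "real^'n^'n" and p :: "int^'n \<Rightarrow> complex"
    and j :: int
  defines "h \<equiv> bspline_hat L D j p"
  assumes [measurable]: "L \<in> borel_measurable borel" and loc: "localizing_coeffs L D j p"
    and B: "B = c *\<^sub>R Q" "orthogonal_matrix Q" "c > 0" and DTj: "matrix_zpow (transpose D) (- j) = B"
    and lat: "\<And>x k. (B *v x) \<bullet> lattice_pt D j k = x \<bullet> real_vec k"
  obtains lo up \<Phi> where "lo > 0" "\<Phi> \<in> borel_measurable borel" "h \<in> L2"
    "AE \<theta> in lborel. (lo \<le> \<Phi> \<theta> \<and> \<Phi> \<theta> \<le> up \<and> periodization h B \<theta> = ennreal (\<Phi> \<theta>)) \<and>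
      (cmod (h (B *v \<theta>)))^2 / \<Phi> \<theta> = m_ratio L D j (B *v \<theta>)"
proof -
  have dual: "dual_lattice_pt D j = dual_shift B"
    by (simp add: fun_eq_iff dual_lattice_pt_def dual_shift_def DTj)
  define P where "P = discrete_symbol D j p"
  have [measurable]: "P \<in> borel_measurable borel"
    unfolding P_def using loc by (intro borel_measurable_discrete_symbol) (simp add: localizing_coeffs_def)
  have h_eq: "h \<omega> = P \<omega> * inverse (L \<omega>)" for \<omega> by (simp add: h_def bspline_hat_def P_def)
  have [measurable]: "h \<in> borel_measurable borel" unfolding h_eq[abs_def] by measurable
  note per = cis_dual_shift[OF lat]
  have Pper: "P (B *v x + dual_shift B l) = P (B *v x)" for x l
    unfolding P_def discrete_symbol_def per using per[of x 0] by simp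
  obtain lo up where lo: "0 < lo" and bounds: "AE \<omega> in lborel.
        lo \<le> (\<Sum>\<^sub>\<infinity>l. (cmod (h (\<omega> + dual_shift B l)))^2) \<and> (\<Sum>\<^sub>\<infinity>l. (cmod (h (\<omega> + dual_shift B l)))^2) \<le> up"
    using loc unfolding localizing_coeffs_def dual h_def by blast
  define \<Phi> where "\<Phi> \<theta> = enn2real (periodization h B \<theta>)" for \<theta>
  have [measurable]: "(\<lambda>\<theta>. periodization h B \<theta>) \<in> borel_measurable borel"
    by (intro sigma_finite_measure.borel_measurable_nn_integral sigma_finite_measure_count_space_countable)
       auto
  have \<Phi>m: "\<Phi> \<in> borel_measurable borel" unfolding \<Phi>_def by measurable
  have AE: "AE \<theta> in lborel. (lo \<le> \<Phi> \<theta> \<and> \<Phi> \<theta> \<le> up \<and> periodization h B \<theta> = ennreal (\<Phi> \<theta>)) \<and>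
      (cmod (h (B *v \<theta>)))^2 / \<Phi> \<theta> = m_ratio L D j (B *v \<theta>)"
    using AE_lborel_conformal[OF B bounds]
  proof eventually_elim
    case (elim \<theta>)
    let ?g = "\<lambda>l. (cmod (h (B *v \<theta> + dual_shift B l)))^2"
    let ?S = "\<Sum>\<^sub>\<infinity>l. ?g l"
    (* A divergent series would have the value 0, below the lower Riesz bound. *)
    have S0: "?S \<noteq> 0" using elim lo by linarith
    then have "?g summable_on UNIV" using infsum_not_exists by blast
    then have nn: "(\<integral>\<^sup>+l. ennreal (?g l) \<partial>count_space UNIV) = ennreal ?S"
      by (rule nn_integral_count_space_eq_infsum) simp
    then have \<Phi>S: "\<Phi> \<theta> = ?S" using elim lo by (simp add: \<Phi>_def)
    have g_eq: "?g l = (cmod (P (B *v \<theta>)))^2 * inverse ((cmod (L (B *v \<theta> + dual_shift B l)))^2)" for l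
      by (simp add: h_eq Pper norm_mult power_mult_distrib norm_inverse power_inverse)
    have S_eq: "?S = (cmod (P (B *v \<theta>)))^2 * (\<Sum>\<^sub>\<infinity>l. inverse ((cmod (L (B *v \<theta> + dual_shift B l)))^2))"
      unfolding g_eq by (rule infsum_cmult_right')
    then have "(cmod (P (B *v \<theta>)))^2 \<noteq> 0" using S0 by auto
    then have "(cmod (h (B *v \<theta>)))^2 / \<Phi> \<theta> = m_ratio L D j (B *v \<theta>)"
      using g_eq[of 0] by (simp add: \<Phi>S S_eq m_ratio_def dual)
    then show ?case using elim nn \<Phi>S by simp
  qed
  have "energy lborel h = ennreal (c ^ CARD('n)) * (\<integral>\<^sup>+\<theta>. periodization h B \<theta> \<partial>cell_measure)"
    unfolding energy_def by (rule nn_integral_unfold_lattice[OF _ B]) measurable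
  also have "\<dots> \<le> ennreal (c ^ CARD('n)) * (\<integral>\<^sup>+\<theta>. ennreal up \<partial>(cell_measure :: (real^'n) measure))"
  proof (intro mult_left_mono nn_integral_mono_AE AE_cell_measureI)
    show "AE \<theta> in lborel. periodization h B \<theta> \<le> ennreal up"
      using AE by eventually_elim (auto simp: ennreal_leI)
  qed simp
  also have "\<dots> = ennreal (c ^ CARD('n)) * (ennreal up * ennreal ((2 * pi) ^ CARD('n)))"
    by (simp only: nn_integral_const space_cell_measure emeasure_cell_measure)
  also have "\<dots> < top" by (simp only: ennreal_mult_less_top ennreal_less_top simp_thms)
  finally have "h \<in> L2" by (simp add: L2_iff)
  then show thesis using that[OF lo \<Phi>m _ AE] by blast
qed

text \<open>The error bound at a single scale \<open>s = a\<^sup>j\<close>, with a constant in which \<open>j\<close> does not occur: low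
  frequencies contribute \<open>\<bar>M\<bar>\<close>, high frequencies \<open>C + 1\<close>, and the factor \<open>4\<close> stems from the two
  applications of \<open>|x + y|\<^sup>2 \<le> 2 |x|\<^sup>2 + 2 |y|\<^sup>2\<close>.\<close>

lemma approx_error_spline_space_le:
  fixes L :: "real^'n \<Rightarrow> complex" and D R :: "real^'n^'n" and r r' C a M :: real
  assumes L [measurable]: "L \<in> borel_measurable borel"
    and R: "orthogonal_matrix R" and a: "a > 1" and D: "D = a *\<^sub>R R"
    and r: "0 \<le> r'" "r' \<le> r" and C: "C > 0"
    and growth: "AE \<omega> in lborel. C * (1 + (cmod (L \<omega>))^2) \<ge> norm \<omega> powr (2 * r)"
    and loc: "localizing_coeffs L D j p"
    and M: "AE \<omega> in lborel.
      \<omega> \<in> (\<lambda>x. matrix_zpow (transpose D) (- j) *v x) ` cbox (\<chi> i. - pi) (\<chi> i. pi) \<longrightarrow>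
      \<bar>\<bar>det (transpose D)\<bar> powr (- 2 * real_of_int j * r' / real CARD('n)) *
        ((1 - m_ratio L D j \<omega>) / (1 + (cmod (L \<omega>))^2))\<bar> \<le> M"
    and f: "f \<in> sobolev_space L"
  shows "approx_error f (spline_space L D j p)
    \<le> sqrt (4 * \<bar>M\<bar> + 4 * (C + 1)) * \<bar>det D\<bar> powr (real_of_int j * r' / real CARD('n)) * sobolev_norm L f"
proof -
  let ?n = "CARD('n)"
  define s where "s = a powr real_of_int j"
  have s: "s > 0" using a by (simp add: s_def)
  define c where "c = 1 / s"
  have "a > 0" using a by simp
  define B where "B = matrix_zpow (transpose D) (- j)"
  obtain Q B' where BQ: "B = c *\<^sub>R Q" "orthogonal_matrix Q"
    and frame: "\<forall>x. B' *v (B *v x) = x" "\<forall>x. norm (B' *v x) = s * norm x"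
      "\<forall>x k. (B *v x) \<bullet> lattice_pt D j k = x \<bullet> real_vec k"
    using dual_lattice_frame[OF R \<open>a > 0\<close> D, of j, folded s_def B_def, folded c_def]
    by (elim exE conjE) (rule that; assumption)
  have DTj: "matrix_zpow (transpose D) (- j) = B" by (simp add: B_def)
  have B'B: "B' *v (B *v x) = x" and B'n: "norm (B' *v x) = s * norm x"
    and lat: "(B *v x) \<bullet> lattice_pt D j k = x \<bullet> real_vec k" for x k
    using frame by blast+
  have c: "c > 0" using s by (simp add: c_def)
  note B = BQ c
  define h where "h = bspline_hat L D j p"
  obtain lo up \<Phi> where lo: "lo > 0" and \<Phi>m [measurable]: "\<Phi> \<in> borel_measurable borel" and hL2: "h \<in> L2"
    and \<Phi>AE: "AE \<theta> in lborel. (lo \<le> \<Phi> \<theta> \<and> \<Phi> \<theta> \<le> up \<and> periodization h B \<theta> = ennreal (\<Phi> \<theta>)) \<and>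
      (cmod (h (B *v \<theta>)))^2 / \<Phi> \<theta> = m_ratio L D j (B *v \<theta>)"
    by (rule bspline_hat_fibres[OF L loc B DTj lat, folded h_def])
  have hm [measurable]: "h \<in> borel_measurable borel" using hL2 by (rule L2_measurable)
  have \<Phi>cell: "AE \<theta> in cell_measure. lo \<le> \<Phi> \<theta> \<and> \<Phi> \<theta> \<le> up \<and> periodization h B \<theta> = ennreal (\<Phi> \<theta>)"
    using \<Phi>AE by (intro AE_cell_measureI) (auto elim: eventually_mono)
  have fL2: "f \<in> L2" using f by (simp add: sobolev_space_def)
  define F where "F = fourier f"
  have FL2: "F \<in> L2" unfolding F_def by (rule fourier_L2(1)[OF fL2])
  note [measurable] = L2_measurable[OF FL2]
  define W where "W \<omega> = (cmod (F \<omega>))^2 * (1 + (cmod (L \<omega>))^2)" for \<omega>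
  have W0: "0 \<le> W \<omega>" for \<omega> by (simp add: W_def)
  have [measurable]: "W \<in> borel_measurable borel" unfolding W_def by measurable
  define S where "S = sobolev_norm L f"
  have S: "S \<ge> 0" "(\<integral>\<^sup>+\<omega>. ennreal (W \<omega>) \<partial>lborel) = ennreal (S^2)"
  proof -
    have "integrable lborel W" using f by (simp add: sobolev_space_def W_def[abs_def] F_def)
    then have "(\<integral>\<^sup>+\<omega>. ennreal (W \<omega>) \<partial>lborel) = ennreal (LINT \<omega>|lborel. W \<omega>)"
      by (intro nn_integral_eq_integral) (auto simp: W0)
    moreover have "0 \<le> (LINT \<omega>|lborel. W \<omega>)" by (rule Bochner_Integration.integral_nonneg) (rule W0)
    moreover have "S = sqrt (LINT \<omega>|lborel. W \<omega>)" by (simp add: S_def sobolev_norm_def W_def F_def)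
    ultimately show "S \<ge> 0" "(\<integral>\<^sup>+\<omega>. ennreal (W \<omega>) \<partial>lborel) = ennreal (S^2)" by simp_all
  qed
  define \<sigma> where "\<sigma> = (s powr r')^2"
  have \<sigma>: "\<sigma> > 0" using s by (simp add: \<sigma>_def)
  have detD: "\<bar>det D\<bar> = a ^ ?n"
    unfolding D using a by (intro abs_det_scaled_orthogonal R) simp
  have detpow: "\<bar>det D\<bar> powr (x / real ?n) = a powr x" for x
    using a by (simp add: detD powr_powr flip: powr_realpow)
  have spow: "s powr x = a powr (real_of_int j * x)" for x
    by (simp add: s_def powr_powr)
  (* The part of the transform in the fundamental cell B (-pi, pi]^n. *)
  define F1 where "F1 \<omega> = indicator period_cell (B' *v \<omega>) * F \<omega>" for \<omega>
  have [measurable]: "F1 \<in> borel_measurable borel"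
    unfolding F1_def
    by (intro borel_measurable_times measurable_compose[OF borel_measurable_matrix_vector]
        borel_measurable_indicator) auto
  have F1L2: "F1 \<in> L2"
    by (rule L2_dominated[OF FL2]) (auto simp: F1_def indicator_def)
  have F1cell: "F1 (B *v \<theta> + dual_shift B l) = 0" if \<theta>: "\<theta> \<in> period_cell" and l: "l \<noteq> 0" for \<theta> l
  proof -
    let ?x = "\<theta> + (2 * pi) *\<^sub>R real_vec l"
    have "?x - (2 * pi) *\<^sub>R real_vec l \<in> period_cell" using \<theta> by simp
    then have "?x - (2 * pi) *\<^sub>R real_vec 0 \<notin> period_cell"
      using period_cell_unique_translate[of ?x] l by blast
    then have "?x \<notin> period_cell" by (simp add: real_vec_simps)
    then show ?thesis by (simp add: F1_def add_dual_shift B'B)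
  qed
  let ?E = "\<lambda>\<theta>. (cmod (F1 (B *v \<theta>)))^2 * (1 - (cmod (h (B *v \<theta>)))^2 / \<Phi> \<theta>)"
  (* Inside the cell the projection loses the fraction 1 - m_j, which the hypothesis controls. *)
  have low: "ennreal (c ^ ?n) *
      (\<integral>\<^sup>+\<theta>. ennreal (?E \<theta>) \<partial>cell_measure)
      \<le> ennreal (\<bar>M\<bar> * \<sigma> * S^2)"
  proof -
    have "(\<integral>\<^sup>+\<theta>. ennreal (?E \<theta>) \<partial>cell_measure)
      \<le> (\<integral>\<^sup>+\<theta>. ennreal (\<bar>M\<bar> * \<sigma>) * ennreal (W (B *v \<theta>)) \<partial>cell_measure)"
    proof (rule nn_integral_mono_AE, unfold AE_cell_measure)
      show "AE \<theta> in lborel. \<theta> \<in> period_cell \<longrightarrow>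
        ennreal (?E \<theta>)
          \<le> ennreal (\<bar>M\<bar> * \<sigma>) * ennreal (W (B *v \<theta>))"
        using \<Phi>AE AE_lborel_conformal[OF B M]
      proof eventually_elim
        case (elim \<theta>)
        let ?m = "m_ratio L D j (B *v \<theta>)" and ?w = "1 + (cmod (L (B *v \<theta>)))^2"
        note \<Phi>\<theta> = elim(1) and M\<theta> = elim(2)
        show ?case
        proof
          assume \<theta>: "\<theta> \<in> period_cell"
          have w: "?w > 0" by (simp add: add_pos_nonneg)
          have "\<theta> \<in> cbox (\<chi> i. - pi) (\<chi> i. pi)"
            using \<theta> by (auto simp: period_cell_def mem_box_cart less_imp_le)
          then have "\<bar>\<bar>det D\<bar> powr (- 2 * real_of_int j * r' / real ?n) * ((1 - ?m) / ?w)\<bar> \<le> M"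
            using M\<theta> by (simp add: DTj det_transpose)
          moreover have "\<bar>det D\<bar> powr (- 2 * real_of_int j * r' / real ?n) = 1 / \<sigma>"
            unfolding detpow \<sigma>_def spow
            by (simp add: powr_minus_divide power2_eq_square mult.commute mult.left_commute flip: powr_add)
          ultimately have "\<bar>(1 / \<sigma>) * ((1 - ?m) / ?w)\<bar> \<le> M" by (simp only:)
          then have "(1 / \<sigma>) * ((1 - ?m) / ?w) \<le> \<bar>M\<bar>" by linarith
          moreover have "x \<le> \<bar>M\<bar> * \<sigma> * y" if "y > 0" "(1 / \<sigma>) * (x / y) \<le> \<bar>M\<bar>" for x y :: real
            using \<sigma> that by (simp add: field_simps)
          ultimately have m: "1 - ?m \<le> \<bar>M\<bar> * \<sigma> * ?w" using w by blast
          have "(cmod (F1 (B *v \<theta>)))^2 * (1 - ?m) \<le> (cmod (F (B *v \<theta>)))^2 * (\<bar>M\<bar> * \<sigma> * ?w)"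
            using \<theta> m by (simp add: F1_def B'B mult_left_mono)
          then have "ennreal ((cmod (F1 (B *v \<theta>)))^2 * (1 - ?m)) \<le> ennreal (\<bar>M\<bar> * \<sigma> * W (B *v \<theta>))"
            by (intro ennreal_leI) (simp add: W_def ac_simps)
          then show "ennreal (?E \<theta>)
            \<le> ennreal (\<bar>M\<bar> * \<sigma>) * ennreal (W (B *v \<theta>))"
            using \<Phi>\<theta> \<sigma> W0 by (simp add: ennreal_mult)
        qed
      qed
    qed
    also have "\<dots> = ennreal (\<bar>M\<bar> * \<sigma>) * (\<integral>\<^sup>+\<theta>. ennreal (W (B *v \<theta>)) \<partial>cell_measure)"
      by (rule nn_integral_cmult) measurable
    finally have "ennreal (c ^ ?n) *
      (\<integral>\<^sup>+\<theta>. ennreal (?E \<theta>) \<partial>cell_measure)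
      \<le> ennreal (\<bar>M\<bar> * \<sigma>) * (ennreal (c ^ ?n) * (\<integral>\<^sup>+\<theta>. ennreal (W (B *v \<theta>)) \<partial>cell_measure))"
      by (subst mult.left_commute) (rule mult_left_mono, simp_all)
    also have "\<dots> \<le> ennreal (\<bar>M\<bar> * \<sigma>) * (\<integral>\<^sup>+\<omega>. ennreal (W \<omega>) \<partial>lborel)"
      by (intro mult_left_mono nn_integral_cell_conformal_le[OF _ B]) auto
    also have "\<dots> = ennreal (\<bar>M\<bar> * \<sigma> * S^2)"
      using \<sigma> by (simp add: S ennreal_mult)
    finally show ?thesis .
  qed
  (* Outside the cell f is not approximated; the growth of the symbol makes this part small. *)
  have high: "energy lborel (\<lambda>\<omega>. F \<omega> - F1 \<omega>) \<le> ennreal ((C + 1) * \<sigma> * S^2)"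
  proof -
    have "energy lborel (\<lambda>\<omega>. F \<omega> - F1 \<omega>) \<le> (\<integral>\<^sup>+\<omega>. ennreal ((C + 1) * \<sigma>) * ennreal (W \<omega>) \<partial>lborel)"
      unfolding energy_def
    proof (rule nn_integral_mono_AE)
      show "AE \<omega> in lborel. ennreal ((cmod (F \<omega> - F1 \<omega>))^2) \<le> ennreal ((C + 1) * \<sigma>) * ennreal (W \<omega>)"
        using growth
      proof eventually_elim
        case (elim \<omega>)
        note g = elim
        have "(cmod (F \<omega> - F1 \<omega>))^2 \<le> (C + 1) * \<sigma> * W \<omega>"
        proof (cases "B' *v \<omega> \<in> period_cell")
          case True
          then show ?thesis using C \<sigma> W0 by (simp add: F1_def)
        next
          case False
          then obtain i where "(B' *v \<omega>) $ i \<le> - pi \<or> pi < (B' *v \<omega>) $ i"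
            unfolding period_cell_def mem_Collect_eq by (meson not_le)
          then have "pi \<le> \<bar>(B' *v \<omega>) $ i\<bar>" by linarith
          also have "\<dots> \<le> norm (B' *v \<omega>)" by (rule component_le_norm_cart)
          also have "norm (B' *v \<omega>) = s * norm \<omega>" by (rule B'n)
          finally have "1 / s \<le> norm \<omega>" using s pi_gt3 by (simp add: field_simps)
          then have "1 \<le> (C + 1) * \<sigma> * (1 + (cmod (L \<omega>))^2)"
            unfolding \<sigma>_def by (intro weight_outside_cell[OF s _ r _ C g]) auto
          then have "(cmod (F \<omega>))^2 * 1 \<le> (cmod (F \<omega>))^2 * ((C + 1) * \<sigma> * (1 + (cmod (L \<omega>))^2))"
            by (rule mult_left_mono) simp
          then show ?thesis using False by (simp add: F1_def W_def ac_simps)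
        qed
        then have "ennreal ((cmod (F \<omega> - F1 \<omega>))^2) \<le> ennreal ((C + 1) * \<sigma> * W \<omega>)" by (rule ennreal_leI)
        then show ?case
          using C \<sigma> W0 by (simp only: ennreal_mult mult_nonneg_nonneg add_nonneg_nonneg less_imp_le zero_le_one)
      qed
    qed
    also have "\<dots> = ennreal ((C + 1) * \<sigma>) * ennreal (S^2)"
      by (subst nn_integral_cmult) (auto simp: S)
    also have "\<dots> = ennreal ((C + 1) * \<sigma> * S^2)"
      using C \<sigma> by (intro ennreal_mult[symmetric]) auto
    finally show ?thesis .
  qed
  define Y where "Y = (4 * \<bar>M\<bar> + 4 * (C + 1)) * \<sigma> * S^2"
  have Y: "Y \<ge> 0" using C \<sigma> by (simp add: Y_def)
  have bound: "approx_error f (spline_space L D j p) \<le> sqrt (Y + 4 * \<epsilon>)" if \<epsilon>: "\<epsilon> > 0" for \<epsilon>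
  proof -
    obtain K b where K: "finite K" and near: "\<And>T. T \<in> borel_measurable borel \<Longrightarrow>
      (\<And>\<theta> l. T (B *v \<theta> + dual_shift B l) = (\<Sum>k\<in>K. b k * character k \<theta>)) \<Longrightarrow>
      energy lborel (\<lambda>\<omega>. F1 \<omega> - T \<omega> * h \<omega>) \<le> ennreal (c ^ ?n) *
        (\<integral>\<^sup>+\<theta>. ennreal (?E \<theta>) \<partial>cell_measure)
        + ennreal \<epsilon>"
      using trig_poly_near_fibre_projection[OF B F1L2 hm \<Phi>m lo, OF \<Phi>cell F1cell \<epsilon>] by blast
    (* A translation by v multiplies the transform by cis (- (w . v)), so the frequencies are negated. *)
    define K' where "K' = uminus ` K"
    have K': "finite K'" using K by (simp add: K'_def)
    define T where "T \<omega> = (\<Sum>k\<in>K'. b (- k) * cis (- (\<omega> \<bullet> lattice_pt D j k)))" for \<omega>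
    have [measurable]: "T \<in> borel_measurable borel" unfolding T_def by measurable
    have T_eq: "T \<omega> = (\<Sum>k\<in>K. b k * cis (\<omega> \<bullet> lattice_pt D j k))" for \<omega>
    proof -
      have "lattice_pt D j (- k) = - lattice_pt D j k" for k
        using linear_neg[OF matrix_vector_mul_linear, of "matrix_zpow D j" "real_vec k"]
        by (simp add: lattice_pt_def real_vec_simps)
      then show ?thesis
        unfolding T_def K'_def by (subst sum.reindex) (auto simp: inj_on_def)
    qed
    have E1: "energy lborel (\<lambda>\<omega>. F1 \<omega> - T \<omega> * h \<omega>) \<le> ennreal (\<bar>M\<bar> * \<sigma> * S^2) + ennreal \<epsilon>"
      by (rule order_trans[OF near]) (auto simp: T_eq cis_dual_shift[OF lat] intro: add_right_mono low)
    define u where "u x = (\<Sum>k\<in>K'. b (- k) * bspline L D j p (x - lattice_pt D j k))" for x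
    have u: "u \<in> spline_space L D j p"
      unfolding u_def using finite_spline_in_spline_space[OF K'] hL2 by (simp add: h_def)
    have uL2: "u \<in> L2" using u by (simp add: spline_space_def)
    have "energy lborel (\<lambda>x. f x - u x) \<le> 2 * energy lborel (\<lambda>\<omega>. F \<omega> - T \<omega> * h \<omega>)"
      using energy_spline_error_le[OF fL2 hL2 K', of "\<lambda>k. b (- k)" "lattice_pt D j"]
      by (simp only: u_def F_def T_def bspline_def h_def)
    also have "energy lborel (\<lambda>\<omega>. F \<omega> - T \<omega> * h \<omega>)
      \<le> 2 * energy lborel (\<lambda>\<omega>. F \<omega> - F1 \<omega>) + 2 * energy lborel (\<lambda>\<omega>. F1 \<omega> - T \<omega> * h \<omega>)"
      by (rule energy_diff_le) measurable
    also have "\<dots> \<le> 2 * ennreal ((C + 1) * \<sigma> * S^2) + 2 * (ennreal (\<bar>M\<bar> * \<sigma> * S^2) + ennreal \<epsilon>)"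
      by (intro add_mono mult_left_mono high E1) auto
    finally have "energy lborel (\<lambda>x. f x - u x)
      \<le> 2 * (2 * ennreal ((C + 1) * \<sigma> * S^2) + 2 * (ennreal (\<bar>M\<bar> * \<sigma> * S^2) + ennreal \<epsilon>))"
      by (simp add: mult_left_mono)
    also have "\<dots> = ennreal (Y + 4 * \<epsilon>)"
    proof -
      have "2 * (2 * ennreal x + 2 * (ennreal y + ennreal z)) = ennreal (4 * x + 4 * y + 4 * z)"
        if "0 \<le> x" "0 \<le> y" "0 \<le> z" for x y z
        using that by (simp add: ennreal_mult distrib_left mult.assoc[symmetric] add.assoc)
      moreover have "0 \<le> (C + 1) * \<sigma> * S^2" "0 \<le> \<bar>M\<bar> * \<sigma> * S^2" using C \<sigma> by simp_all
      moreover have "Y + 4 * \<epsilon> = 4 * ((C + 1) * \<sigma> * S^2) + 4 * (\<bar>M\<bar> * \<sigma> * S^2) + 4 * \<epsilon>"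
        by (simp add: Y_def algebra_simps)
      ultimately show ?thesis using \<epsilon> by simp
    qed
    finally have "ennreal ((L2_norm (\<lambda>x. f x - u x))^2) \<le> ennreal (Y + 4 * \<epsilon>)"
      by (simp only: L2_norm_square L2_diff fL2 uL2)
    then have "(L2_norm (\<lambda>x. f x - u x))^2 \<le> Y + 4 * \<epsilon>" using Y \<epsilon> by (subst (asm) ennreal_le_iff) auto
    then have "L2_norm (\<lambda>x. f x - u x) \<le> sqrt (Y + 4 * \<epsilon>)" by (rule real_le_rsqrt)
    then show ?thesis using approx_error_le[OF u, of f] by linarith
  qed
  have "approx_error f (spline_space L D j p) \<le> sqrt Y"
  proof (rule field_le_epsilon)
    fix e :: real assume e: "0 < e"
    have "approx_error f (spline_space L D j p) \<le> sqrt (Y + 4 * (e^2 / 4))"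
      using e by (intro bound) simp
    also have "\<dots> \<le> sqrt Y + sqrt (e^2)" using Y sqrt_add_le_add_sqrt[of Y "e^2"] by simp
    finally show "approx_error f (spline_space L D j p) \<le> sqrt Y + e" using e by simp
  qed
  also have "sqrt Y = sqrt (4 * \<bar>M\<bar> + 4 * (C + 1)) * s powr r' * S"
    unfolding Y_def \<sigma>_def using S(1) s by (simp add: real_sqrt_mult)
  also have "s powr r' = \<bar>det D\<bar> powr (real_of_int j * r' / real ?n)"
    by (simp only: detpow spow)
  finally show ?thesis by (simp only: S_def)
qed

theorem theorem1:
  fixes L :: "real^'n \<Rightarrow> complex" and D :: "real^'n^'n" and r r' :: real
    and p :: "int \<Rightarrow> int^'n \<Rightarrow> complex"
  assumes "spline_admissible_pair L D r"
    and "\<And>j. localizing_coeffs L D j (p j)"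
    and "0 \<le> r'" and "r' \<le> r"
    and "\<exists>M. \<forall>j::int. AE \<omega> in lborel.
           \<omega> \<in> (\<lambda>x. matrix_zpow (transpose D) (- j) *v x) ` cbox (\<chi> i. - pi) (\<chi> i. pi) \<longrightarrow>
           \<bar>\<bar>det (transpose D)\<bar> powr (- 2 * real_of_int j * r' / real CARD('n)) *
              ((1 - m_ratio L D j \<omega>) / (1 + (cmod (L \<omega>))\<^sup>2))\<bar> \<le> M"
  shows "\<exists>C>0. \<forall>f\<in>sobolev_space L. \<forall>j::int.
           approx_error f (spline_space L D j (p j))
             \<le> C * \<bar>det D\<bar> powr (real_of_int j * r' / real CARD('n)) * sobolev_norm L f"
proof -
  have adm: "L \<in> borel_measurable borel"
    using assms(1) by (simp add: spline_admissible_pair_def admissible_symbol_def)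
  obtain a R where D: "a > 1" "orthogonal_matrix R" "D = a *\<^sub>R R"
    using assms(1) by (auto simp: spline_admissible_pair_def)
  obtain C where C: "C > 0" "AE \<omega> in lborel. C * (1 + (cmod (L \<omega>))\<^sup>2) \<ge> norm \<omega> powr (2 * r)"
    using assms(1) by (auto simp: spline_admissible_pair_def)
  show ?thesis
    using assms(5)
  proof (elim exE, goal_cases)
    case (1 M)
    have "sqrt (4 * \<bar>M\<bar> + 4 * (C + 1)) > 0" using C(1) by (simp add: add_nonneg_pos)
    then show ?case
      using approx_error_spline_space_le[OF adm D(2,1,3) assms(3,4) C assms(2) 1[rule_format]] by blast
  qed
qed

end
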